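(* Let $X_1,\dots,X_n$ and $Y$ be Banach spaces over the same field $\mathbb K$. Then there exists an isometric isomorphism between $\Gamma(X_1,\dots,X_n;Y)$ (with the norm $\Gamma(\cdot)$) and $(X_1\otimes\dots\otimes X_n\otimes Y^*,\gamma)^*\cap\mathcal L(X_1,\dots,X_n;Y)$ (with the norm of $(X_1\otimes\dots\otimes X_n\otimes Y^*,\gamma)^*$). Under it, $T\in\Gamma(X_1,\dots,X_n;Y)$ corresponds to the functional $\zeta_T$ determined by $\zeta_T(x^1\otimes\dots\otimes x^n\otimes y^* )=y^*(T(x^1,\dots,x^n))$.
   Context: $\mathbb K$ is $\mathbb R$ or $\mathbb C$; $n$ is a positive integer. $\mathcal L(X_1,\dots,X_n;Y)$ is the space of bounded multilinear operators $X_1\times\dots\times X_n\to Y$, and $\mathcal L(X_1,\dots,X_n)$ that of bounded multilinear forms. Each functional $\varphi$ in $(X_1\otimes\dots\otimes X_n\otimes Y^*,\gamma)^*$ is identified with the bounded multilinear operator $T_\varphi:X_1\times\dots\times X_n\to Y^{**}$, $T_\varphi(x^1,\dots,x^n)(y^* )=\varphi(x^1\otimes\dots\otimes x^n\otimes y^* )$. The intersection $(X_1\otimes\dots\otimes X_n\otimes Y^*,\gamma)^*\cap\mathcal L(X_1,\dots,X_n;Y)$ consists of those $\varphi$ for which $T_\varphi$ takes values in $Y$, where $Y$ is regarded as a subspace of $Y^{**}$ via the canonical embedding. $\pi$ is the projective norm on $X_1\otimes\dots\otimes X_n$, and $\Sigma_{X_1\dots X_n}=\{x^1\otimes\dots\otimes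 x^n:x^i\in X_i\}$. For $\varphi\in\mathcal L(X_1,\dots,X_n)$, $f_\varphi(x^1\otimes\dots\otimes x^n)=\varphi(x^1,\dots,x^n)$ on $\Sigma_{X_1\dots X_n}$. For finite sequences $(p_i)_{i=1}^m,(q_i)_{i=1}^m,(a_j)_{j=1}^l,(b_j)_{j=1}^l$ in $\Sigma_{X_1\dots X_n}$ write $(p_i,q_i)\le_\pi(a_j,b_j)$ if $\sum_{i=1}^m|f_\varphi(p_i)-f_\varphi(q_i)|^2\le\sum_{j=1}^l|f_\varphi(a_j)-f_\varphi(b_j)|^2$ for all $\varphi\in\mathcal L(X_1,\dots,X_n)$ (by adding zeros one may always take $m=l$). For a Banach space $V$ (here $V=Y^*$), the norm $\gamma$ on $X_1\otimes\dots\otimes X_n\otimes V=(X_1\otimes\dots\otimes X_n)\otimes V$ is $$\gamma(u)=\inf\Big(\sum_{i=1}^m\pi(a_i-b_i)^2\Big)^{1/2}\Big(\sum_{i=1}^m\|v_i\|^2\Big)^{1/2},$$ the infimum over all representations $u=\sum_{i=1}^m(p_i-q_i)\otimes v_i$ with $p_i,q_i\in\Sigma_{X_1\dots X_n}$, $v_i\in V$, and all $a_i,b_i\in\Sigma_{X_1\dots X_n}$ with $(p_i,q_i)\le_\pi(a_i,b_i)$. A multilinear operator $T:X_1\times\dots\times X_n\to Y$ factors through a Hilbert space if there exist a Hilbert space $H$, a subset $M\subset H$, a bounded multilinear operator $A:X_1\times\dots\times X_n\to H$ with $A(X_1\times\dots\times X_n)\subset M$, and a Lipschitz function $B:M\to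 Y$ such that $T=B\circ A$. Then $\Gamma(T)=\inf\|A\|\,\mathrm{Lip}(B)$, the infimum over all such factorizations, where $\|A\|=\sup\{\|A(x^1,\dots,x^n)\|:\|x^i\|\le1\}$ and $\mathrm{Lip}(B)$ is the least Lipschitz constant. $\Gamma(X_1,\dots,X_n;Y)$ is the collection of all such $T$. *)

theory Defs
  imports "HOL-Analysis.Analysis" "HOL-Algebra.Module"
begin

section \<open>Normed spaces over the real or the complex field\<close>

text \<open>
  The scalar field is a set \<open>K\<close> of complex numbers, and the definitions are meant for
  \<open>K = \<real>\<close> and \<open>K = UNIV\<close>. Vector spaces have explicit carriers, so that a finite
  family of different spaces can be indexed by natural numbers: any finitely many spaces
  can be realised on subsets of one type (the disjoint union of their underlying sets).
  The fields \<open>mult\<close> and \<open>one\<close>, which \<^typ>\<open>('a, 'b) module\<close> inherits from rings, are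
  used for the scalar field only.
\<close>

record 'a nspace = "(complex, 'a) module" +
  nrm :: "'a \<Rightarrow> real"

definition scalars :: "complex set \<Rightarrow> complex nspace" where
  "scalars K = \<lparr>carrier = K, mult = (*), one = 1, zero = 0, add = (+), smult = (*), nrm = cmod\<rparr>"

definition normed_space :: "complex set \<Rightarrow> 'a nspace \<Rightarrow> bool" where
  "normed_space K V \<longleftrightarrow>
     Module.module (scalars K) V \<and>
     (\<forall>x\<in>carrier V. 0 \<le> nrm V x \<and> (nrm V x = 0 \<longleftrightarrow> x = \<zero>\<^bsub>V\<^esub>)) \<and>
     (\<forall>x\<in>carrier V. \<forall>y\<in>carrier V. nrm V (x \<oplus>\<^bsub>V\<^esub> y) \<le> nrm V x + nrm V y) \<and>
     (\<forall>c\<in>K. \<forall>x\<in>carrier V. nrm V (c \<odot>\<^bsub>V\<^esub> x) = cmod c * nrm V x)"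

definition banach_space :: "complex set \<Rightarrow> 'a nspace \<Rightarrow> bool" where
  "banach_space K V \<longleftrightarrow>
     normed_space K V \<and>
     (\<forall>s :: nat \<Rightarrow> 'a. range s \<subseteq> carrier V \<longrightarrow>
        (\<forall>e>0. \<exists>N. \<forall>i\<ge>N. \<forall>j\<ge>N. nrm V (s i \<ominus>\<^bsub>V\<^esub> s j) < e) \<longrightarrow>
        (\<exists>l\<in>carrier V. (\<lambda>i. nrm V (s i \<ominus>\<^bsub>V\<^esub> l)) \<longlonglongrightarrow> 0))"

definition inner_product :: "complex set \<Rightarrow> 'a nspace \<Rightarrow> ('a \<Rightarrow> 'a \<Rightarrow> complex) \<Rightarrow> bool" where
  "inner_product K V ip \<longleftrightarrow>
     (\<forall>x\<in>carrier V. \<forall>y\<in>carrier V. ip x y \<in> K \<and> ip y x = cnj (ip x y)) \<and>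
     (\<forall>x\<in>carrier V. \<forall>y\<in>carrier V. \<forall>z\<in>carrier V. ip (x \<oplus>\<^bsub>V\<^esub> y) z = ip x z + ip y z) \<and>
     (\<forall>c\<in>K. \<forall>x\<in>carrier V. \<forall>y\<in>carrier V. ip (c \<odot>\<^bsub>V\<^esub> x) y = c * ip x y) \<and>
     (\<forall>x\<in>carrier V. ip x x = complex_of_real ((nrm V x)\<^sup>2))"

definition hilbert_space :: "complex set \<Rightarrow> 'a nspace \<Rightarrow> bool" where
  "hilbert_space K V \<longleftrightarrow> banach_space K V \<and> (\<exists>ip. inner_product K V ip)"

definition linear_map :: "complex set \<Rightarrow> 'a nspace \<Rightarrow> 'b nspace \<Rightarrow> ('a \<Rightarrow> 'b) \<Rightarrow> bool" where
  "linear_map K V W f \<longleftrightarrow>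
     f \<in> carrier V \<rightarrow> carrier W \<and>
     (\<forall>x\<in>carrier V. \<forall>y\<in>carrier V. f (x \<oplus>\<^bsub>V\<^esub> y) = f x \<oplus>\<^bsub>W\<^esub> f y) \<and>
     (\<forall>c\<in>K. \<forall>x\<in>carrier V. f (c \<odot>\<^bsub>V\<^esub> x) = c \<odot>\<^bsub>W\<^esub> f x)"

definition isometric_isomorphism ::
    "complex set \<Rightarrow> 'a nspace \<Rightarrow> 'b nspace \<Rightarrow> ('a \<Rightarrow> 'b) \<Rightarrow> bool" where
  "isometric_isomorphism K V W f \<longleftrightarrow>
     normed_space K V \<and> normed_space K W \<and>
     linear_map K V W f \<and> bij_betw f (carrier V) (carrier W) \<and>
     (\<forall>x\<in>carrier V. nrm W (f x) = nrm V x)"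

text \<open>
  Maps that are elements of a space are taken to be \<^const>\<open>extensional\<close>, so that two of them
  are equal iff they agree on their domain. The definition also makes sense for a space
  whose \<^const>\<open>nrm\<close> is not known to be a norm.
\<close>

definition dual_space :: "complex set \<Rightarrow> 'a nspace \<Rightarrow> ('a \<Rightarrow> complex) nspace" where
  "dual_space K V =
     \<lparr>carrier = {f \<in> extensional (carrier V). linear_map K V (scalars K) f \<and>
                   (\<exists>C. \<forall>v\<in>carrier V. cmod (f v) \<le> C * nrm V v)},
      mult = undefined, one = undefined,
      zero = (\<lambda>v\<in>carrier V. 0),
      add = (\<lambda>f g. \<lambda>v\<in>carrier V. f v + g v),
      smult = (\<lambda>c f. \<lambda>v\<in>carrier V. c * f v),
      nrm = (\<lambda>f. Sup {cmod (f v) |v. v \<in> carrier V \<and> nrm V v \<le> 1})\<rparr>"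


section \<open>Multilinear operators\<close>

definition prod_carrier :: "nat \<Rightarrow> (nat \<Rightarrow> 'a nspace) \<Rightarrow> (nat \<Rightarrow> 'a) set" where
  "prod_carrier n X = (\<Pi>\<^sub>E i\<in>{..<n}. carrier (X i))"

definition multilinear ::
    "complex set \<Rightarrow> nat \<Rightarrow> (nat \<Rightarrow> 'a nspace) \<Rightarrow> 'b nspace \<Rightarrow> ((nat \<Rightarrow> 'a) \<Rightarrow> 'b) \<Rightarrow> bool" where
  "multilinear K n X Z T \<longleftrightarrow>
     T \<in> prod_carrier n X \<rightarrow> carrier Z \<and>
     (\<forall>x\<in>prod_carrier n X. \<forall>i<n. linear_map K (X i) Z (\<lambda>y. T (x(i := y))))"

definition bounded_multilinear ::
    "complex set \<Rightarrow> nat \<Rightarrow> (nat \<Rightarrow> 'a nspace) \<Rightarrow> 'b nspace \<Rightarrow> ((nat \<Rightarrow> 'a) \<Rightarrow> 'b) \<Rightarrow> bool" where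
  "bounded_multilinear K n X Z T \<longleftrightarrow>
     multilinear K n X Z T \<and>
     (\<exists>C. \<forall>x\<in>prod_carrier n X. nrm Z (T x) \<le> C * (\<Prod>i<n. nrm (X i) (x i)))"

definition multilinear_norm ::
    "nat \<Rightarrow> (nat \<Rightarrow> 'a nspace) \<Rightarrow> 'b nspace \<Rightarrow> ((nat \<Rightarrow> 'a) \<Rightarrow> 'b) \<Rightarrow> real" where
  "multilinear_norm n X Z T =
     Sup {nrm Z (T x) |x. x \<in> prod_carrier n X \<and> (\<forall>i<n. nrm (X i) (x i) \<le> 1)}"


section \<open>Tensor products\<close>

text \<open>
  An elementary tensor is realised as the evaluation functional on multilinear forms, and
  the algebraic tensor product as the linear span of the elementary tensors. Thus linear
  forms on the tensor product correspond exactly to multilinear forms, the form \<open>\<phi>\<close> being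
  linearised by \<open>u \<mapsto> u \<phi>\<close>.
\<close>

definition fun_span ::
    "complex set \<Rightarrow> ('f \<Rightarrow> complex) set \<Rightarrow> (('f \<Rightarrow> complex) \<Rightarrow> real) \<Rightarrow> ('f \<Rightarrow> complex) nspace" where
  "fun_span K S N =
     \<lparr>carrier = {u. \<exists>(m::nat) c s. (\<forall>j<m. c j \<in> K \<and> s j \<in> S) \<and> u = (\<lambda>\<phi>. \<Sum>j<m. c j * s j \<phi>)},
      mult = undefined, one = undefined,
      zero = (\<lambda>\<phi>. 0),
      add = (\<lambda>u w. \<lambda>\<phi>. u \<phi> + w \<phi>),
      smult = (\<lambda>c u. \<lambda>\<phi>. c * u \<phi>),
      nrm = N\<rparr>"

definition tensor ::
    "complex set \<Rightarrow> nat \<Rightarrow> (nat \<Rightarrow> 'a nspace) \<Rightarrow> (nat \<Rightarrow> 'a) \<Rightarrow> (((nat \<Rightarrow> 'a) \<Rightarrow> complex) \<Rightarrow> complex)" where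
  "tensor K n X x = (\<lambda>\<phi>. if multilinear K n X (scalars K) \<phi> then \<phi> x else 0)"

definition segre ::
    "complex set \<Rightarrow> nat \<Rightarrow> (nat \<Rightarrow> 'a nspace) \<Rightarrow> (((nat \<Rightarrow> 'a) \<Rightarrow> complex) \<Rightarrow> complex) set" where
  "segre K n X = tensor K n X ` prod_carrier n X"

definition proj_norm ::
    "complex set \<Rightarrow> nat \<Rightarrow> (nat \<Rightarrow> 'a nspace) \<Rightarrow> (((nat \<Rightarrow> 'a) \<Rightarrow> complex) \<Rightarrow> complex) \<Rightarrow> real" where
  "proj_norm K n X u =
     Inf {\<Sum>j<m. \<Prod>i<n. nrm (X i) (x j i) |(m::nat) x.
            (\<forall>j<m. x j \<in> prod_carrier n X) \<and> u = (\<lambda>\<phi>. \<Sum>j<m. tensor K n X (x j) \<phi>)}"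

definition proj_tensor ::
    "complex set \<Rightarrow> nat \<Rightarrow> (nat \<Rightarrow> 'a nspace) \<Rightarrow> (((nat \<Rightarrow> 'a) \<Rightarrow> complex) \<Rightarrow> complex) nspace" where
  "proj_tensor K n X = fun_span K (segre K n X) (proj_norm K n X)"

definition linearised :: "('f \<Rightarrow> complex) \<Rightarrow> (('f \<Rightarrow> complex) \<Rightarrow> complex) \<Rightarrow> complex" where
  "linearised \<phi> p = p \<phi>"

lemma linearised_tensor:
  "multilinear K n X (scalars K) \<phi> \<Longrightarrow> linearised \<phi> (tensor K n X x) = \<phi> x"
  by (simp add: linearised_def tensor_def)

definition bilinear_form ::
    "complex set \<Rightarrow> 'w nspace \<Rightarrow> 'v nspace \<Rightarrow> ('w \<Rightarrow> 'v \<Rightarrow> complex) \<Rightarrow> bool" where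
  "bilinear_form K W V \<beta> \<longleftrightarrow>
     (\<forall>w\<in>carrier W. linear_map K V (scalars K) (\<beta> w)) \<and>
     (\<forall>v\<in>carrier V. linear_map K W (scalars K) (\<lambda>w. \<beta> w v))"

definition tensor2 ::
    "complex set \<Rightarrow> 'w nspace \<Rightarrow> 'v nspace \<Rightarrow> 'w \<Rightarrow> 'v \<Rightarrow> (('w \<Rightarrow> 'v \<Rightarrow> complex) \<Rightarrow> complex)" where
  "tensor2 K W V w v = (\<lambda>\<beta>. if bilinear_form K W V \<beta> then \<beta> w v else 0)"


section \<open>The norm gamma\<close>

text \<open>The relation \<open>(p\<^sub>i, q\<^sub>i) \<le> (a\<^sub>j, b\<^sub>j)\<close> for \<open>i < m\<close> and \<open>j < l\<close>.\<close>

definition pairs_le ::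
    "complex set \<Rightarrow> nat \<Rightarrow> (nat \<Rightarrow> 'a nspace) \<Rightarrow>
     nat \<Rightarrow> (nat \<Rightarrow> ((nat \<Rightarrow> 'a) \<Rightarrow> complex) \<Rightarrow> complex) \<Rightarrow> (nat \<Rightarrow> ((nat \<Rightarrow> 'a) \<Rightarrow> complex) \<Rightarrow> complex) \<Rightarrow>
     nat \<Rightarrow> (nat \<Rightarrow> ((nat \<Rightarrow> 'a) \<Rightarrow> complex) \<Rightarrow> complex) \<Rightarrow> (nat \<Rightarrow> ((nat \<Rightarrow> 'a) \<Rightarrow> complex) \<Rightarrow> complex) \<Rightarrow> bool" where
  "pairs_le K n X m p q l a b \<longleftrightarrow>
     (\<forall>\<phi>. bounded_multilinear K n X (scalars K) \<phi> \<longrightarrow>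
        (\<Sum>i<m. (cmod (linearised \<phi> (p i) - linearised \<phi> (q i)))\<^sup>2)
          \<le> (\<Sum>j<l. (cmod (linearised \<phi> (a j) - linearised \<phi> (b j)))\<^sup>2))"

definition gamma ::
    "complex set \<Rightarrow> nat \<Rightarrow> (nat \<Rightarrow> 'a nspace) \<Rightarrow> 'v nspace \<Rightarrow>
     (((((nat \<Rightarrow> 'a) \<Rightarrow> complex) \<Rightarrow> complex) \<Rightarrow> 'v \<Rightarrow> complex) \<Rightarrow> complex) \<Rightarrow> real" where
  "gamma K n X V u =
     (let W = proj_tensor K n X; \<Sigma> = segre K n X in
      Inf {sqrt (\<Sum>i<m. (nrm W (a i \<ominus>\<^bsub>W\<^esub> b i))\<^sup>2) * sqrt (\<Sum>i<m. (nrm V (v i))\<^sup>2) |(m::nat) p q v a b.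
             (\<forall>i<m. p i \<in> \<Sigma> \<and> q i \<in> \<Sigma> \<and> v i \<in> carrier V \<and> a i \<in> \<Sigma> \<and> b i \<in> \<Sigma>) \<and>
             u = (\<lambda>\<beta>. \<Sum>i<m. tensor2 K W V (p i \<ominus>\<^bsub>W\<^esub> q i) (v i) \<beta>) \<and>
             pairs_le K n X m p q m a b})"

definition gamma_tensor ::
    "complex set \<Rightarrow> nat \<Rightarrow> (nat \<Rightarrow> 'a nspace) \<Rightarrow> 'v nspace \<Rightarrow>
     (((((nat \<Rightarrow> 'a) \<Rightarrow> complex) \<Rightarrow> complex) \<Rightarrow> 'v \<Rightarrow> complex) \<Rightarrow> complex) nspace" where
  "gamma_tensor K n X V =
     (let W = proj_tensor K n X in
      fun_span K {tensor2 K W V w v |w v. w \<in> carrier W \<and> v \<in> carrier V} (gamma K n X V))"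

definition tensor_vec ::
    "complex set \<Rightarrow> nat \<Rightarrow> (nat \<Rightarrow> 'a nspace) \<Rightarrow> 'v nspace \<Rightarrow> (nat \<Rightarrow> 'a) \<Rightarrow> 'v \<Rightarrow>
     (((((nat \<Rightarrow> 'a) \<Rightarrow> complex) \<Rightarrow> complex) \<Rightarrow> 'v \<Rightarrow> complex) \<Rightarrow> complex)" where
  "tensor_vec K n X V x v = tensor2 K (proj_tensor K n X) V (tensor K n X x) v"

definition associated_op ::
    "complex set \<Rightarrow> nat \<Rightarrow> (nat \<Rightarrow> 'a nspace) \<Rightarrow> 'y nspace \<Rightarrow>
     ((((((nat \<Rightarrow> 'a) \<Rightarrow> complex) \<Rightarrow> complex) \<Rightarrow> ('y \<Rightarrow> complex) \<Rightarrow> complex) \<Rightarrow> complex) \<Rightarrow> complex) \<Rightarrow>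
     (nat \<Rightarrow> 'a) \<Rightarrow> (('y \<Rightarrow> complex) \<Rightarrow> complex)" where
  "associated_op K n X Y \<zeta> x =
     (\<lambda>f\<in>carrier (dual_space K Y). \<zeta> (tensor_vec K n X (dual_space K Y) x f))"

definition canonical_embedding ::
    "complex set \<Rightarrow> 'y nspace \<Rightarrow> 'y \<Rightarrow> (('y \<Rightarrow> complex) \<Rightarrow> complex)" where
  "canonical_embedding K Y y = (\<lambda>f\<in>carrier (dual_space K Y). f y)"

text \<open>
  The functionals in the dual of \<open>(X\<^sub>1 \<otimes> \<dots> \<otimes> X\<^sub>n \<otimes> Y\<^sup>*, \<gamma>)\<close> whose associated operator into
  the bidual of \<open>Y\<close> takes its values in \<open>Y\<close>.
\<close>

definition gamma_dual ::
    "complex set \<Rightarrow> nat \<Rightarrow> (nat \<Rightarrow> 'a nspace) \<Rightarrow> 'y nspace \<Rightarrow>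
     ((((((nat \<Rightarrow> 'a) \<Rightarrow> complex) \<Rightarrow> complex) \<Rightarrow> ('y \<Rightarrow> complex) \<Rightarrow> complex) \<Rightarrow> complex) \<Rightarrow> complex) nspace" where
  "gamma_dual K n X Y =
     (let D = dual_space K (gamma_tensor K n X (dual_space K Y)) in
      D\<lparr>carrier := {\<zeta> \<in> carrier D. \<forall>x\<in>prod_carrier n X.
          associated_op K n X Y \<zeta> x \<in> canonical_embedding K Y ` carrier Y}\<rparr>)"


section \<open>Factorization through Hilbert spaces\<close>

definition lipschitz_const :: "'h nspace \<Rightarrow> 'y nspace \<Rightarrow> 'h set \<Rightarrow> ('h \<Rightarrow> 'y) \<Rightarrow> real \<Rightarrow> bool" where
  "lipschitz_const H Y M B L \<longleftrightarrow>
     0 \<le> L \<and> (\<forall>u\<in>M. \<forall>v\<in>M. nrm Y (B u \<ominus>\<^bsub>Y\<^esub> B v) \<le> L * nrm H (u \<ominus>\<^bsub>H\<^esub> v))"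

definition Lip :: "'h nspace \<Rightarrow> 'y nspace \<Rightarrow> 'h set \<Rightarrow> ('h \<Rightarrow> 'y) \<Rightarrow> real" where
  "Lip H Y M B = Inf {L. lipschitz_const H Y M B L}"

definition hilbert_factorization ::
    "complex set \<Rightarrow> nat \<Rightarrow> (nat \<Rightarrow> 'a nspace) \<Rightarrow> 'y nspace \<Rightarrow> ((nat \<Rightarrow> 'a) \<Rightarrow> 'y) \<Rightarrow>
     'h nspace \<Rightarrow> ((nat \<Rightarrow> 'a) \<Rightarrow> 'h) \<Rightarrow> 'h set \<Rightarrow> ('h \<Rightarrow> 'y) \<Rightarrow> bool" where
  "hilbert_factorization K n X Y T H A M B \<longleftrightarrow>
     hilbert_space K H \<and> M \<subseteq> carrier H \<and>
     bounded_multilinear K n X H A \<and> A ` prod_carrier n X \<subseteq> M \<and>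
     B \<in> M \<rightarrow> carrier Y \<and> (\<exists>L. lipschitz_const H Y M B L) \<and>
     (\<forall>x\<in>prod_carrier n X. T x = B (A x))"

lemma inner_product_cauchy_schwarz:
  assumes V: "normed_space K V" and ip: "inner_product K V ip"
    and x: "x \<in> carrier V" and y: "y \<in> carrier V"
  shows "cmod (ip x y) \<le> nrm V x * nrm V y"
proof -
  interpret Module.module "scalars K" V using V by (simp add: normed_space_def)
  have add1: "ip (x \<oplus>\<^bsub>V\<^esub> y) z = ip x z + ip y z"
    if "x \<in> carrier V" "y \<in> carrier V" "z \<in> carrier V" for x y z
    using ip that unfolding inner_product_def by blast
  have scl1: "ip (c \<odot>\<^bsub>V\<^esub> x) y = c * ip x y"
    if "c \<in> K" "x \<in> carrier V" "y \<in> carrier V" for c x y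
    using ip that unfolding inner_product_def by blast
  have sym: "ip y x = cnj (ip x y)" and inK: "ip x y \<in> K"
    if "x \<in> carrier V" "y \<in> carrier V" for x y
    using ip that unfolding inner_product_def by blast+
  have sq: "ip x x = complex_of_real ((nrm V x)\<^sup>2)" if "x \<in> carrier V" for x
    using ip that unfolding inner_product_def by blast
  have Kc: "carrier (scalars K) = K" by (simp add: scalars_def)
  have smc: "c \<odot>\<^bsub>V\<^esub> x \<in> carrier V" if "c \<in> K" "x \<in> carrier V" for c x
    using smult_closed that by (simp add: Kc)
  define c where "c = ip x y"
  define a where "a = (nrm V y)\<^sup>2"
  have aK: "complex_of_real a \<in> K" using inK[OF y y] sq[OF y] by (simp add: a_def)
  have cK: "c \<in> K" by (simp add: c_def inK x y)
  have negK: "- c \<in> K"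
  proof -
    have "\<ominus>\<^bsub>scalars K\<^esub> c \<in> K" using R.a_inv_closed[of c] cK by (simp add: Kc)
    moreover have "c \<oplus>\<^bsub>scalars K\<^esub> (\<ominus>\<^bsub>scalars K\<^esub> c) = \<zero>\<^bsub>scalars K\<^esub>"
      by (rule R.r_neg) (simp add: Kc cK)
    ultimately show ?thesis by (simp add: scalars_def add_eq_0_iff)
  qed
  define u where "u = complex_of_real a \<odot>\<^bsub>V\<^esub> x"
  define w where "w = (- c) \<odot>\<^bsub>V\<^esub> y"
  have u: "u \<in> carrier V" and w: "w \<in> carrier V"
    unfolding u_def w_def by (simp_all add: smc aK negK x y)
  have yx: "ip y x = cnj c" using sym[OF x y] by (simp add: c_def)
  have xw: "ip x w = - cnj c * c"
    using sym[OF w x] scl1[OF negK y x] yx by (simp add: w_def)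
  have yw: "ip y w = - cnj c * complex_of_real a"
    using sym[OF w y] scl1[OF negK y y] sq[OF y] by (simp add: w_def a_def)
  have xu: "ip x u = complex_of_real a * complex_of_real ((nrm V x)\<^sup>2)"
    using sym[OF u x] scl1[OF aK x x] sq[OF x] by (simp add: u_def)
  have yu: "ip y u = complex_of_real a * cnj c"
    using sym[OF u y] scl1[OF aK x y] by (simp add: u_def c_def)
  have uw: "u \<oplus>\<^bsub>V\<^esub> w \<in> carrier V" using u w by simp
  have half: "ip (u \<oplus>\<^bsub>V\<^esub> w) z = complex_of_real a * ip x z - c * ip y z" if "z \<in> carrier V" for z
    using add1[OF u w that] scl1[OF aK x that] scl1[OF negK y that] by (simp add: u_def w_def)
  have ipw: "ip x (u \<oplus>\<^bsub>V\<^esub> w) = ip x u + ip x w" "ip y (u \<oplus>\<^bsub>V\<^esub> w) = ip y u + ip y w"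
    using sym[OF uw x] sym[OF uw y] add1[OF u w x] add1[OF u w y]
      sym[OF u x] sym[OF w x] sym[OF u y] sym[OF w y] by simp_all
  have "ip (u \<oplus>\<^bsub>V\<^esub> w) (u \<oplus>\<^bsub>V\<^esub> w)
      = complex_of_real a * (complex_of_real a * complex_of_real ((nrm V x)\<^sup>2) - c * cnj c)"
    unfolding half[OF uw] ipw xw yw xu yu by (simp add: algebra_simps)
  also have "\<dots> = complex_of_real (a * (a * (nrm V x)\<^sup>2 - (cmod c)\<^sup>2))"
    by (simp only: of_real_mult of_real_diff complex_norm_square)
  finally have "(nrm V (u \<oplus>\<^bsub>V\<^esub> w))\<^sup>2 = a * (a * (nrm V x)\<^sup>2 - (cmod c)\<^sup>2)"
    using sq[OF uw] by (metis of_real_eq_iff)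
  then have nonneg: "0 \<le> a * (a * (nrm V x)\<^sup>2 - (cmod c)\<^sup>2)"
    by (metis zero_le_power2)
  have nx: "0 \<le> nrm V x" and ny: "0 \<le> nrm V y"
    using V x y by (auto simp: normed_space_def)
  show ?thesis
  proof (cases "a = 0")
    case True
    then have "y = \<zero>\<^bsub>V\<^esub>" using V y by (simp add: a_def normed_space_def)
    then have "ip y x = ip y x + ip y x" using add1[OF y y x] by simp
    then have "c = 0" using yx by simp
    then show ?thesis using nx ny by (simp add: c_def)
  next
    case False
    then have "a > 0" by (simp add: a_def)
    then have "(cmod c)\<^sup>2 \<le> a * (nrm V x)\<^sup>2" using nonneg by (simp add: zero_le_mult_iff)
    then have "(cmod c)\<^sup>2 \<le> (nrm V x * nrm V y)\<^sup>2" by (simp add: a_def power_mult_distrib mult.commute)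
    then have "cmod c \<le> nrm V x * nrm V y" by (rule power2_le_imp_le) (simp add: nx ny)
    then show ?thesis by (simp add: c_def)
  qed
qed

lemma hilbert_factorization_universe:
  fixes H :: "'h nspace" and X :: "nat \<Rightarrow> 'a nspace"
  assumes fac: "hilbert_factorization K n X Y T H A M B"
  obtains H' :: "((nat \<Rightarrow> 'a) \<Rightarrow> complex) nspace" and A' M' B'
  where "hilbert_factorization K n X Y T H' A' M' B'"
    and "multilinear_norm n X H' A' = multilinear_norm n X H A"
    and "Lip H' Y M' B' \<le> Lip H Y M B"
proof -
  define P where "P = prod_carrier n X"
  have hil: "hilbert_space K H" and MH: "M \<subseteq> carrier H"
    and Abm: "bounded_multilinear K n X H A" and AM: "A ` P \<subseteq> M"
    and BY: "B \<in> M \<rightarrow> carrier Y" and TBA: "\<And>x. x \<in> P \<Longrightarrow> T x = B (A x)"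
    using fac by (auto simp: hilbert_factorization_def P_def)
  obtain L0 where L0: "lipschitz_const H Y M B L0"
    using fac by (auto simp: hilbert_factorization_def)
  have ns: "normed_space K H" and ban: "banach_space K H"
    using hil by (auto simp: hilbert_space_def banach_space_def)
  obtain ip where ip: "inner_product K H ip" using hil by (auto simp: hilbert_space_def)
  interpret Module.module "scalars K" H using ns by (simp add: normed_space_def)
  have Kc: "carrier (scalars K) = K" by (simp add: scalars_def)
  have smc: "c \<odot>\<^bsub>H\<^esub> x \<in> carrier H" if "c \<in> K" "x \<in> carrier H" for c x
    using smult_closed that by (simp add: Kc)
  have add1: "ip (x \<oplus>\<^bsub>H\<^esub> y) z = ip x z + ip y z"
    if "x \<in> carrier H" "y \<in> carrier H" "z \<in> carrier H" for x y z
    using ip that unfolding inner_product_def by blast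
  have scl1: "ip (c \<odot>\<^bsub>H\<^esub> x) y = c * ip x y"
    if "c \<in> K" "x \<in> carrier H" "y \<in> carrier H" for c x y
    using ip that unfolding inner_product_def by blast
  have sym: "ip y x = cnj (ip x y)" and inK: "ip x y \<in> K"
    if "x \<in> carrier H" "y \<in> carrier H" for x y
    using ip that unfolding inner_product_def by blast+
  have sq: "ip x x = complex_of_real ((nrm H x)\<^sup>2)" if "x \<in> carrier H" for x
    using ip that unfolding inner_product_def by blast
  have zero1: "ip \<zero>\<^bsub>H\<^esub> z = 0" if "z \<in> carrier H" for z
    using add1[of "\<zero>\<^bsub>H\<^esub>" "\<zero>\<^bsub>H\<^esub>" z] that by simp
  have neg1: "ip (\<ominus>\<^bsub>H\<^esub> x) z = - ip x z" if "x \<in> carrier H" "z \<in> carrier H" for x z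
    using add1[of x "\<ominus>\<^bsub>H\<^esub> x" z] zero1 that by (simp add: M.r_neg add_eq_0_iff)
  have minus1: "ip (x \<ominus>\<^bsub>H\<^esub> y) z = ip x z - ip y z"
    if "x \<in> carrier H" "y \<in> carrier H" "z \<in> carrier H" for x y z
    using add1[of x "\<ominus>\<^bsub>H\<^esub> y" z] neg1 that by (simp add: a_minus_def)
  have AH: "A x \<in> carrier H" if "x \<in> P" for x using AM MH that by blast

  text \<open>The closed span of the range of \<open>A\<close>, as a double orthogonal complement.\<close>
  define N where "N = {g \<in> carrier H. \<forall>x\<in>P. ip g (A x) = 0}"
  define H0 where "H0 = {h \<in> carrier H. \<forall>g\<in>N. ip h g = 0}"
  have NH: "g \<in> carrier H" if "g \<in> N" for g using that by (simp add: N_def)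
  have H0H: "h \<in> carrier H" if "h \<in> H0" for h using that by (simp add: H0_def)
  have H0_0: "\<zero>\<^bsub>H\<^esub> \<in> H0" by (simp add: H0_def zero1 NH)
  have H0_add: "h \<oplus>\<^bsub>H\<^esub> k \<in> H0" if "h \<in> H0" "k \<in> H0" for h k
    using that by (simp add: H0_def add1 NH)
  have H0_neg: "\<ominus>\<^bsub>H\<^esub> h \<in> H0" if "h \<in> H0" for h
    using that by (simp add: H0_def neg1 NH)
  have H0_minus: "h \<ominus>\<^bsub>H\<^esub> k \<in> H0" if "h \<in> H0" "k \<in> H0" for h k
    using that by (simp add: a_minus_def H0_add H0_neg)
  have H0_smult: "c \<odot>\<^bsub>H\<^esub> h \<in> H0" if "c \<in> K" "h \<in> H0" for c h
    using that by (simp add: H0_def scl1 smc NH)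
  have H0_A: "A x \<in> H0" if "x \<in> P" for x
    using that sym[OF NH AH] AH by (auto simp: H0_def N_def)

  define J where "J h = (\<lambda>x. if x \<in> P then ip h (A x) else 0)" for h
  have J_add: "J (h \<oplus>\<^bsub>H\<^esub> k) = (\<lambda>x. J h x + J k x)" if "h \<in> H0" "k \<in> H0" for h k
    using that by (auto simp: J_def add1 H0H AH)
  have J_smult: "J (c \<odot>\<^bsub>H\<^esub> h) = (\<lambda>x. c * J h x)" if "c \<in> K" "h \<in> H0" for c h
    using that by (auto simp: J_def scl1 H0H AH)
  have J_0: "J \<zero>\<^bsub>H\<^esub> = (\<lambda>x. 0)" by (auto simp: J_def zero1 AH)
  have inj: "inj_on J H0"
  proof (rule inj_onI)
    fix h k assume h: "h \<in> H0" and k: "k \<in> H0" and e: "J h = J k"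
    define d where "d = h \<ominus>\<^bsub>H\<^esub> k"
    have d: "d \<in> H0" by (simp add: d_def H0_minus h k)
    have "d \<in> N"
      unfolding N_def
    proof (intro CollectI conjI ballI)
      show "d \<in> carrier H" using d H0H by simp
      fix x assume x: "x \<in> P"
      then show "ip d (A x) = 0"
        using fun_cong[OF e, of x] by (simp add: J_def d_def minus1 h k H0H AH)
    qed
    then have "ip d d = 0" using d by (simp add: H0_def)
    then have "nrm H d = 0" using sq[OF H0H[OF d]] by simp
    then have "d = \<zero>\<^bsub>H\<^esub>" using ns H0H[OF d] by (simp add: normed_space_def)
    then have "\<ominus>\<^bsub>H\<^esub> (\<ominus>\<^bsub>H\<^esub> k) = h"
      using h k H0H by (intro M.minus_equality) (simp_all add: d_def a_minus_def)
    then show "h = k" using k H0H by (simp add: M.minus_minus)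
  qed
  define G where "G = inv_into H0 J"
  have GJ: "G (J h) = h" if "h \<in> H0" for h
    using inj that by (simp add: G_def)
  define H' :: "((nat \<Rightarrow> 'a) \<Rightarrow> complex) nspace" where "H' = \<lparr>carrier = J ` H0, mult = undefined, one = undefined, zero = (\<lambda>x. 0),
      add = (\<lambda>f g. \<lambda>x. f x + g x), smult = (\<lambda>c f. \<lambda>x. c * f x), nrm = (\<lambda>f. nrm H (G f))\<rparr>"
  have H'_c: "carrier H' = J ` H0" by (simp add: H'_def)
  have H'_0: "\<zero>\<^bsub>H'\<^esub> = J \<zero>\<^bsub>H\<^esub>" by (simp add: H'_def J_0)
  have H'_a: "J h \<oplus>\<^bsub>H'\<^esub> J k = J (h \<oplus>\<^bsub>H\<^esub> k)" if "h \<in> H0" "k \<in> H0" for h k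
    by (simp add: H'_def J_add that)
  have H'_s: "c \<odot>\<^bsub>H'\<^esub> J h = J (c \<odot>\<^bsub>H\<^esub> h)" if "c \<in> K" "h \<in> H0" for c h
    by (simp add: H'_def J_smult that)
  have H'_n: "nrm H' (J h) = nrm H h" if "h \<in> H0" for h
    by (simp add: H'_def GJ that)
  have ab: "abelian_group H'"
  proof (rule abelian_groupI)
    fix f assume "f \<in> carrier H'"
    then obtain h where h: "h \<in> H0" "f = J h" by (auto simp: H'_c)
    have "J (\<ominus>\<^bsub>H\<^esub> h) \<oplus>\<^bsub>H'\<^esub> f = \<zero>\<^bsub>H'\<^esub>"
      using h by (simp add: H'_a H0_neg H'_0 M.l_neg H0H)
    then show "\<exists>g\<in>carrier H'. g \<oplus>\<^bsub>H'\<^esub> f = \<zero>\<^bsub>H'\<^esub>"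
      using H0_neg[OF h(1)] by (auto simp: H'_c)
  qed (auto simp: H'_c H'_0 H'_a H0_add H0_0 H0H M.a_ac)
  have mod: "Module.module (scalars K) H'"
  proof (rule Module.moduleI)
    show "cring (scalars K)" by (rule R.is_cring)
    show "abelian_group H'" by (rule ab)
  next
    fix a b x assume "a \<in> carrier (scalars K)" "b \<in> carrier (scalars K)" "x \<in> carrier H'"
    then show "(a \<oplus>\<^bsub>scalars K\<^esub> b) \<odot>\<^bsub>H'\<^esub> x = a \<odot>\<^bsub>H'\<^esub> x \<oplus>\<^bsub>H'\<^esub> b \<odot>\<^bsub>H'\<^esub> x"
      "(a \<otimes>\<^bsub>scalars K\<^esub> b) \<odot>\<^bsub>H'\<^esub> x = a \<odot>\<^bsub>H'\<^esub> (b \<odot>\<^bsub>H'\<^esub> x)"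
      by (auto simp: H'_def scalars_def algebra_simps)
  next
    fix a x y assume "a \<in> carrier (scalars K)" "x \<in> carrier H'" "y \<in> carrier H'"
    then show "a \<odot>\<^bsub>H'\<^esub> (x \<oplus>\<^bsub>H'\<^esub> y) = a \<odot>\<^bsub>H'\<^esub> x \<oplus>\<^bsub>H'\<^esub> a \<odot>\<^bsub>H'\<^esub> y"
      by (auto simp: H'_def algebra_simps)
  next
    fix a x assume "a \<in> carrier (scalars K)" "x \<in> carrier H'"
    then show "a \<odot>\<^bsub>H'\<^esub> x \<in> carrier H'" by (auto simp: Kc H'_c H'_s H0_smult)
  next
    fix x assume "x \<in> carrier H'"
    then show "\<one>\<^bsub>scalars K\<^esub> \<odot>\<^bsub>H'\<^esub> x = x" by (simp add: H'_def scalars_def)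
  qed
  interpret H': abelian_group H' by (rule ab)
  have H'_m: "J h \<ominus>\<^bsub>H'\<^esub> J k = J (h \<ominus>\<^bsub>H\<^esub> k)" if hk: "h \<in> H0" "k \<in> H0" for h k
  proof -
    have c: "J k \<in> carrier H'" "J (\<ominus>\<^bsub>H\<^esub> k) \<in> carrier H'" using hk H0_neg by (auto simp: H'_c)
    have "J (\<ominus>\<^bsub>H\<^esub> k) \<oplus>\<^bsub>H'\<^esub> J k = \<zero>\<^bsub>H'\<^esub>"
      using hk by (simp add: H'_a H0_neg H'_0 M.l_neg H0H)
    then have "\<ominus>\<^bsub>H'\<^esub> J k = J (\<ominus>\<^bsub>H\<^esub> k)" using H'.minus_equality c by blast
    then show ?thesis using hk by (simp add: a_minus_def H'_a H0_neg)
  qed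
  have ns': "normed_space K H'"
    unfolding normed_space_def
  proof (intro conjI ballI mod)
    fix f assume "f \<in> carrier H'"
    then obtain h where h: "h \<in> H0" "f = J h" by (auto simp: H'_c)
    show "0 \<le> nrm H' f" "nrm H' f = 0 \<longleftrightarrow> f = \<zero>\<^bsub>H'\<^esub>"
      using h ns H0H[OF h(1)] inj_on_eq_iff[OF inj h(1) H0_0] by (auto simp: H'_n H'_0 normed_space_def)
    show "nrm H' (c \<odot>\<^bsub>H'\<^esub> f) = cmod c * nrm H' f" if "c \<in> K" for c
      using h ns H0H[OF h(1)] that by (simp add: H'_s H'_n H0_smult normed_space_def)
    fix g assume "g \<in> carrier H'"
    then obtain k where k: "k \<in> H0" "g = J k" by (auto simp: H'_c)
    show "nrm H' (f \<oplus>\<^bsub>H'\<^esub> g) \<le> nrm H' f + nrm H' g"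
      using h k ns H0H by (simp add: H'_a H'_n H0_add normed_space_def)
  qed
  have ban': "banach_space K H'"
    unfolding banach_space_def
  proof (intro conjI ns' allI impI)
    fix s :: "nat \<Rightarrow> (nat \<Rightarrow> 'a) \<Rightarrow> complex"
    assume r: "range s \<subseteq> carrier H'"
      and cau: "\<forall>e>0. \<exists>N. \<forall>i\<ge>N. \<forall>j\<ge>N. nrm H' (s i \<ominus>\<^bsub>H'\<^esub> s j) < e"
    define t where "t i = G (s i)" for i
    have "\<exists>h\<in>H0. s i = J h" for i using r by (auto simp: H'_c)
    then have t: "t i \<in> H0" and st: "s i = J (t i)" for i
      using GJ by (metis t_def)+
    have "\<forall>e>0. \<exists>N. \<forall>i\<ge>N. \<forall>j\<ge>N. nrm H (t i \<ominus>\<^bsub>H\<^esub> t j) < e"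
      using cau by (simp add: st H'_m H'_n t H0_minus)
    moreover have "range t \<subseteq> carrier H" using t H0H by auto
    ultimately obtain l where l: "l \<in> carrier H" and lim: "(\<lambda>i. nrm H (t i \<ominus>\<^bsub>H\<^esub> l)) \<longlonglongrightarrow> 0"
      using ban unfolding banach_space_def by blast
    have "ip l g = 0" if g: "g \<in> N" for g
    proof -
      have "cmod (ip l g) \<le> nrm H (t i \<ominus>\<^bsub>H\<^esub> l) * nrm H g" for i
      proof -
        have "ip (t i \<ominus>\<^bsub>H\<^esub> l) g = - ip l g"
          using t[of i] g l by (simp add: minus1 NH H0H) (simp add: H0_def)
        then show ?thesis
          using inner_product_cauchy_schwarz[OF ns ip, of "t i \<ominus>\<^bsub>H\<^esub> l" g] NH[OF g] l H0H[OF t[of i]]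
          by simp
      qed
      moreover have "(\<lambda>i. nrm H (t i \<ominus>\<^bsub>H\<^esub> l) * nrm H g) \<longlonglongrightarrow> 0"
        using tendsto_mult_right[OF lim, of "nrm H g"] by simp
      ultimately have "cmod (ip l g) \<le> 0"
        by (intro LIMSEQ_le_const) auto
      then show ?thesis by simp
    qed
    then have l0: "l \<in> H0" using l by (simp add: H0_def)
    then have "(\<lambda>i. nrm H' (s i \<ominus>\<^bsub>H'\<^esub> J l)) \<longlonglongrightarrow> 0"
      using lim by (simp add: st H'_m H'_n t H0_minus)
    then show "\<exists>l\<in>carrier H'. (\<lambda>i. nrm H' (s i \<ominus>\<^bsub>H'\<^esub> l)) \<longlonglongrightarrow> 0"
      using l0 by (auto simp: H'_c)
  qed
  have "inner_product K H' (\<lambda>f g. ip (G f) (G g))"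
    unfolding inner_product_def H'_c
  proof (intro conjI ballI)
    fix f g assume "f \<in> J ` H0" "g \<in> J ` H0"
    then obtain h k where hk: "h \<in> H0" "f = J h" "k \<in> H0" "g = J k" by auto
    show "ip (G f) (G g) \<in> K" using hk inK by (simp add: GJ H0H)
    show "ip (G g) (G f) = cnj (ip (G f) (G g))"
      using sym[of h k] hk H0H by (simp only: GJ)
    show "ip (G (c \<odot>\<^bsub>H'\<^esub> f)) (G g) = c * ip (G f) (G g)" if "c \<in> K" for c
      using hk that by (simp add: H'_s GJ H0_smult scl1 H0H)
    show "ip (G f) (G f) = complex_of_real ((nrm H' f)\<^sup>2)"
      using hk sq by (simp add: GJ H'_n H0H)
    fix e assume "e \<in> J ` H0"
    then obtain l where "l \<in> H0" "e = J l" by auto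
    then show "ip (G (f \<oplus>\<^bsub>H'\<^esub> g)) (G e) = ip (G f) (G e) + ip (G g) (G e)"
      using hk by (simp add: H'_a GJ H0_add add1 H0H)
  qed
  then have hil': "hilbert_space K H'" using ban' by (auto simp: hilbert_space_def)

  define A' where "A' x = J (A x)" for x
  define M' where "M' = A' ` P"
  define B' where "B' f = B (G f)" for f
  have upd: "x(i := y) \<in> P" if "x \<in> P" "i < n" "y \<in> carrier (X i)" for x i y
    using that unfolding P_def prod_carrier_def by (auto simp: PiE_def extensional_def Pi_def)
  have nA': "nrm H' (A' x) = nrm H (A x)" if "x \<in> P" for x
    by (simp add: A'_def H'_n H0_A that)
  have "multilinear K n X H' A'"
    unfolding multilinear_def P_def[symmetric]
  proof (intro conjI ballI allI impI)
    show "A' \<in> P \<rightarrow> carrier H'" by (auto simp: A'_def H'_c H0_A)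
    fix x i assume x: "x \<in> P" and i: "i < n"
    then have "linear_map K (X i) H (\<lambda>y. A (x(i := y)))"
      using Abm by (simp add: bounded_multilinear_def multilinear_def P_def)
    then show "linear_map K (X i) H' (\<lambda>y. A' (x(i := y)))"
      using x i upd by (auto simp: linear_map_def A'_def H'_c H'_a H'_s H0_A)
  qed
  then have bm': "bounded_multilinear K n X H' A'"
    using Abm nA' by (auto simp: bounded_multilinear_def P_def)
  have lip: "lipschitz_const H' Y M' B' L" if "lipschitz_const H Y M B L" for L
    using that AM
    by (auto simp: lipschitz_const_def M'_def B'_def A'_def GJ H0_A H'_m H'_n H0_minus)
  have fac': "hilbert_factorization K n X Y T H' A' M' B'"
    unfolding hilbert_factorization_def P_def[symmetric]
  proof (intro conjI hil' bm' ballI)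
    show "M' \<subseteq> carrier H'" by (auto simp: M'_def A'_def H'_c H0_A)
    show "A' ` P \<subseteq> M'" by (simp add: M'_def)
    show "B' \<in> M' \<rightarrow> carrier Y" 
      using BY AM by (auto simp: M'_def B'_def A'_def GJ H0_A Pi_iff image_subset_iff)
    show "\<exists>L. lipschitz_const H' Y M' B' L" using lip L0 by blast
    show "T x = B' (A' x)" if "x \<in> P" for x using TBA that by (simp add: B'_def A'_def GJ H0_A)
  qed
  have nrm_eq: "multilinear_norm n X H' A' = multilinear_norm n X H A"
    unfolding multilinear_norm_def P_def[symmetric]
    by (rule arg_cong[where f = Sup]) (metis (no_types, lifting) nA')
  have Lip_le: "Lip H' Y M' B' \<le> Lip H Y M B"
    unfolding Lip_def
  proof (rule cInf_superset_mono)
    show "{L. lipschitz_const H Y M B L} \<noteq> {}" using L0 by auto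
    show "bdd_below {L. lipschitz_const H' Y M' B' L}"
      by (rule bdd_belowI[of _ 0]) (simp add: lipschitz_const_def)
    show "{L. lipschitz_const H Y M B L} \<subseteq> {L. lipschitz_const H' Y M' B' L}" using lip by auto
  qed
  show thesis by (rule that[OF fac' nrm_eq Lip_le])
qed

text \<open>
  The definitions of the class and of its norm quantify over all Hilbert spaces \<open>H\<close>, but a HOL
  formula cannot quantify over types. Below, \<open>H\<close> ranges over all Hilbert spaces whose carrier is
  a set of functions from tuples to scalars. By \<open>hilbert_factorization_universe\<close> this loses
  nothing: from a factorization through a Hilbert space on any type one obtains
  one through such a space that is at least as good, by identifying a vector \<open>h\<close> of the closed
  span of the range of \<open>A\<close> with the function \<open>x \<mapsto> \<langle>h, A x\<rangle>\<close>.
\<close>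

definition factors_through_hilbert ::
    "complex set \<Rightarrow> nat \<Rightarrow> (nat \<Rightarrow> 'a nspace) \<Rightarrow> 'y nspace \<Rightarrow> ((nat \<Rightarrow> 'a) \<Rightarrow> 'y) \<Rightarrow> bool" where
  "factors_through_hilbert K n X Y T \<longleftrightarrow>
     (\<exists>(H :: ((nat \<Rightarrow> 'a) \<Rightarrow> complex) nspace) A M B. hilbert_factorization K n X Y T H A M B)"

definition Gamma_norm ::
    "complex set \<Rightarrow> nat \<Rightarrow> (nat \<Rightarrow> 'a nspace) \<Rightarrow> 'y nspace \<Rightarrow> ((nat \<Rightarrow> 'a) \<Rightarrow> 'y) \<Rightarrow> real" where
  "Gamma_norm K n X Y T =
     Inf {multilinear_norm n X H A * Lip H Y M B |(H :: ((nat \<Rightarrow> 'a) \<Rightarrow> complex) nspace) A M B.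
            hilbert_factorization K n X Y T H A M B}"

definition Gamma_space ::
    "complex set \<Rightarrow> nat \<Rightarrow> (nat \<Rightarrow> 'a nspace) \<Rightarrow> 'y nspace \<Rightarrow> ((nat \<Rightarrow> 'a) \<Rightarrow> 'y) nspace" where
  "Gamma_space K n X Y =
     \<lparr>carrier = {T \<in> extensional (prod_carrier n X).
                   multilinear K n X Y T \<and> factors_through_hilbert K n X Y T},
      mult = undefined, one = undefined,
      zero = (\<lambda>x\<in>prod_carrier n X. \<zero>\<^bsub>Y\<^esub>),
      add = (\<lambda>S T. \<lambda>x\<in>prod_carrier n X. S x \<oplus>\<^bsub>Y\<^esub> T x),
      smult = (\<lambda>c T. \<lambda>x\<in>prod_carrier n X. c \<odot>\<^bsub>Y\<^esub> T x),
      nrm = Gamma_norm K n X Y\<rparr>"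

end

theory Submission
  imports Defs
begin

text \<open>
  An operator \<open>T\<close> corresponds to the functional \<open>\<zeta>\<^sub>T\<close> that evaluates an element of
  \<open>(X\<^sub>1 \<otimes> \<dots> \<otimes> X\<^sub>n) \<otimes> Y\<^sup>*\<close> at the bilinear form \<open>(w, f) \<mapsto> w (f \<circ> T)\<close>.

  If \<open>T = B \<circ> A\<close> through a Hilbert space, then \<open>(p\<^sub>i, q\<^sub>i) \<le> (a\<^sub>i, b\<^sub>i)\<close> applied to the forms
  \<open>\<langle>A x, h\<rangle>\<close> gives \<open>\<Sum> \<parallel>A p\<^sub>i - A q\<^sub>i\<parallel>\<^sup>2 \<le> \<Sum> \<parallel>A a\<^sub>i - A b\<^sub>i\<parallel>\<^sup>2\<close>, and the Cauchy--Schwarz inequality bounds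
  \<open>\<zeta>\<^sub>T\<close> by \<open>\<parallel>A\<parallel> Lip(B) \<gamma>\<close>.

  Conversely, let \<open>\<zeta>\<close> have norm \<open>C\<close> and operator \<open>T\<close>. Testing \<open>\<zeta>\<close> with norming functionals yields
  \<open>\<Sum> \<parallel>T p\<^sub>i - T q\<^sub>i\<parallel>\<^sup>2 \<le> C\<^sup>2 \<Sum> \<pi>(a\<^sub>i - b\<^sub>i)\<^sup>2\<close> whenever \<open>(p\<^sub>i, q\<^sub>i) \<le> (a\<^sub>i, b\<^sub>i)\<close>. By the Hahn--Banach
  theorem there is a positive linear functional \<open>l\<close> on a space of real functions of a bounded form
  \<open>\<phi>\<close> with \<open>\<parallel>T p - T q\<parallel>\<^sup>2 \<le> l (\<bar>\<phi> p - \<phi> q\<bar>\<^sup>2) \<le> C\<^sup>2 \<pi>(p - q)\<^sup>2\<close>. The semi-inner product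
  \<open>(w, w') \<mapsto> l (w \<phi> cnj (w' \<phi>))\<close> on \<open>X\<^sub>1 \<otimes> \<dots> \<otimes> X\<^sub>n\<close> then completes to a Hilbert space through which
  \<open>T\<close> factors with constant \<open>C\<close>.
\<close>

section \<open>Modules over the real or the complex field\<close>

text \<open>The sum of two factorable operators is not visibly factorable, and the triangle
  inequality of \<open>Gamma_norm\<close> is not visible either. Both are obtained by transport:
  \<open>zeta\<close> is a norm preserving bijection onto a space of functionals, and the linear
  structure is pulled back along it. The map \<open>B\<close> lives only on the range of
  \<open>A\<close>, so the Hilbert seminorm has to dominate \<open>T\<close> on differences of two
  elementary tensors, not on general tensors. This is why everything is phrased with pairs. A single
  functional \<open>l\<close> must satisfy a lower bound (to make \<open>B\<close> Lipschitz) and an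
  upper bound (to bound \<open>A\<close>). The sublinear functional \<open>gauge\<close> encodes
  both at once, and the inequality obtained from \<open>\<zeta>\<close> is exactly what keeps it
  finite. Elementary tensors form a cone, so positive multiples of the sums of squares are again
  such sums; this makes \<open>gauge\<close> homogeneous. The completion consists of functions on
  the tensor product, whereas \<open>Gamma_space\<close> asks for Hilbert spaces of functions on
  tuples; \<open>hilbert_factorization_universe\<close> moves the factorization there.\<close>

locale scalar_field =
  fixes K :: "complex set"
  assumes K_cases: "K = \<real> \<or> K = UNIV"
begin

lemma K_closed [simp, intro]:
  "0 \<in> K" "1 \<in> K" "complex_of_real r \<in> K"
  "a \<in> K \<Longrightarrow> b \<in> K \<Longrightarrow> a + b \<in> K"
  "a \<in> K \<Longrightarrow> b \<in> K \<Longrightarrow> a * b \<in> K"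
  "a \<in> K \<Longrightarrow> - a \<in> K"
  "a \<in> K \<Longrightarrow> b \<in> K \<Longrightarrow> a - b \<in> K"
  "a \<in> K \<Longrightarrow> cnj a \<in> K"
  using K_cases by (auto simp: Reals_cnj_iff)

lemma scalars_simps [simp]:
  "carrier (scalars K) = K" "\<zero>\<^bsub>scalars K\<^esub> = 0" "\<one>\<^bsub>scalars K\<^esub> = 1"
  "a \<oplus>\<^bsub>scalars K\<^esub> b = a + b" "a \<otimes>\<^bsub>scalars K\<^esub> b = a * b"
  "a \<odot>\<^bsub>scalars K\<^esub> b = a * b" "nrm (scalars K) = cmod"
  by (simp_all add: scalars_def)

lemma cring_scalars: "cring (scalars K)"
proof (rule cringI)
  show "abelian_group (scalars K)"
  proof (rule abelian_groupI)
    fix x assume "x \<in> carrier (scalars K)"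
    then show "\<exists>y\<in>carrier (scalars K). y \<oplus>\<^bsub>scalars K\<^esub> x = \<zero>\<^bsub>scalars K\<^esub>"
      by (intro bexI[of _ "- x"]) auto
  qed auto
  show "comm_monoid (scalars K)"
    by (rule comm_monoidI) auto
qed (auto simp: algebra_simps)

lemma minus_scalars [simp]:
  assumes "a \<in> K" "b \<in> K" shows "a \<ominus>\<^bsub>scalars K\<^esub> b = a - b"
proof -
  interpret cring "scalars K" by (rule cring_scalars)
  have "\<ominus>\<^bsub>scalars K\<^esub> b = - b" using assms by (intro minus_equality) auto
  then show ?thesis by (simp add: a_minus_def)
qed

text \<open>The axiom \<open>0 \<odot> x = \<zero>\<close> replaces the existence of negatives.\<close>

lemma module_scalarsI:
  fixes V :: "'v nspace" (structure)
  assumes "\<zero> \<in> carrier V"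
    and add: "\<And>x y. x \<in> carrier V \<Longrightarrow> y \<in> carrier V \<Longrightarrow> x \<oplus> y \<in> carrier V"
    and smult: "\<And>c x. c \<in> K \<Longrightarrow> x \<in> carrier V \<Longrightarrow> c \<odot> x \<in> carrier V"
    and "\<And>x y z. x \<in> carrier V \<Longrightarrow> y \<in> carrier V \<Longrightarrow> z \<in> carrier V \<Longrightarrow>
      x \<oplus> y \<oplus> z = x \<oplus> (y \<oplus> z)"
    and "\<And>x y. x \<in> carrier V \<Longrightarrow> y \<in> carrier V \<Longrightarrow> x \<oplus> y = y \<oplus> x"
    and "\<And>x. x \<in> carrier V \<Longrightarrow> \<zero> \<oplus> x = x"
    and zero: "\<And>x. x \<in> carrier V \<Longrightarrow> 0 \<odot> x = \<zero>"
    and one: "\<And>x. x \<in> carrier V \<Longrightarrow> 1 \<odot> x = x"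
    and l_distr: "\<And>a b x. a \<in> K \<Longrightarrow> b \<in> K \<Longrightarrow> x \<in> carrier V \<Longrightarrow>
      (a + b) \<odot> x = a \<odot> x \<oplus> b \<odot> x"
    and "\<And>a x y. a \<in> K \<Longrightarrow> x \<in> carrier V \<Longrightarrow> y \<in> carrier V \<Longrightarrow>
      a \<odot> (x \<oplus> y) = a \<odot> x \<oplus> a \<odot> y"
    and "\<And>a b x. a \<in> K \<Longrightarrow> b \<in> K \<Longrightarrow> x \<in> carrier V \<Longrightarrow>
      (a * b) \<odot> x = a \<odot> (b \<odot> x)"
  shows "Module.module (scalars K) V"
proof (rule Module.moduleI)
  show "abelian_group V"
  proof (rule abelian_groupI)
    fix x assume x: "x \<in> carrier V"
    have "(- 1) \<odot> x \<oplus> x = \<zero>"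
      using l_distr[of "- 1" 1 x] x one zero by simp
    then show "\<exists>y\<in>carrier V. y \<oplus> x = \<zero>" using smult[of "- 1" x] x by auto
  qed (use assms in auto)
qed (use assms cring_scalars in auto)

end

locale kmodule = scalar_field + Module.module "scalars K" V for V :: "'v nspace" (structure)
begin

lemma smult_in [simp, intro]: "c \<in> K \<Longrightarrow> x \<in> carrier V \<Longrightarrow> c \<odot> x \<in> carrier V"
  using smult_closed by simp

lemma smult_distr_scalar: "a \<in> K \<Longrightarrow> b \<in> K \<Longrightarrow> x \<in> carrier V \<Longrightarrow>
   (a + b) \<odot> x = a \<odot> x \<oplus> b \<odot> x"
  using smult_l_distr by simp

lemma smult_distr_vec: "a \<in> K \<Longrightarrow> x \<in> carrier V \<Longrightarrow> y \<in> carrier V \<Longrightarrow>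
   a \<odot> (x \<oplus> y) = a \<odot> x \<oplus> a \<odot> y"
  using smult_r_distr by simp

lemma smult_smult: "a \<in> K \<Longrightarrow> b \<in> K \<Longrightarrow> x \<in> carrier V \<Longrightarrow>
   a \<odot> (b \<odot> x) = (a * b) \<odot> x"
  using smult_assoc1 by simp

lemma smult_1 [simp]: "x \<in> carrier V \<Longrightarrow> 1 \<odot> x = x"
  using smult_one by simp

lemma smult_0 [simp]:
  assumes "x \<in> carrier V" shows "0 \<odot> x = \<zero>"
proof -
  have "0 \<odot> x \<oplus> 0 \<odot> x = 0 \<odot> x"
    using smult_distr_scalar[of 0 0 x] assms by simp
  then show ?thesis using assms by (simp add: M.add.l_cancel_one')
qed

lemma smult_zero [simp]:
  assumes "c \<in> K" shows "c \<odot> \<zero> = \<zero>"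
  using smult_smult[of c 0 "\<zero>"] assms by simp

lemma uminus_eq: assumes "x \<in> carrier V" shows "\<ominus> x = (- 1) \<odot> x"
proof (rule M.minus_equality)
  show "(- 1) \<odot> x \<oplus> x = \<zero>"
    using smult_distr_scalar[of "- 1" 1 x] assms by simp
qed (use assms in auto)

lemma minus_eq: "x \<in> carrier V \<Longrightarrow> y \<in> carrier V \<Longrightarrow> x \<ominus> y = x \<oplus> (- 1) \<odot> y"
  by (simp add: a_minus_def uminus_eq)

lemma minus_in [simp, intro]: "x \<in> carrier V \<Longrightarrow> y \<in> carrier V \<Longrightarrow> x \<ominus> y \<in> carrier V"
  by (simp add: minus_eq)

lemma minus_self [simp]: "x \<in> carrier V \<Longrightarrow> x \<ominus> x = \<zero>"
  by (simp add: a_minus_def M.r_neg)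

lemma minus_eq_zero: "x \<in> carrier V \<Longrightarrow> y \<in> carrier V \<Longrightarrow> x \<ominus> y = \<zero> \<longleftrightarrow> x = y"
  by (metis M.a_inv_closed M.minus_equality M.minus_minus a_minus_def minus_self)

lemma add_minus_cancel: "x \<in> carrier V \<Longrightarrow> y \<in> carrier V \<Longrightarrow> (x \<ominus> y) \<oplus> y = x"
  by (simp add: a_minus_def M.a_assoc M.l_neg)

lemma minus_add_minus: "x \<in> carrier V \<Longrightarrow> y \<in> carrier V \<Longrightarrow> z \<in> carrier V \<Longrightarrow>
   (x \<ominus> y) \<oplus> (y \<ominus> z) = x \<ominus> z"
  by (simp add: a_minus_def) (metis M.a_assoc M.a_inv_closed M.l_neg M.r_zero M.add.m_closed M.l_zero)

lemma linear_map_zero: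
  assumes "kmodule K W" "linear_map K V W f" shows "f \<zero> = \<zero>\<^bsub>W\<^esub>"
proof -
  interpret W: kmodule K W by fact
  have "f (0 \<odot> \<zero>) = 0 \<odot>\<^bsub>W\<^esub> f \<zero>" "f \<zero> \<in> carrier W"
    using assms(2) unfolding linear_map_def Pi_iff by blast+
  then show ?thesis by simp
qed

lemma linear_map_minus:
  assumes "kmodule K W" "linear_map K V W f" "x \<in> carrier V" "y \<in> carrier V"
  shows "f (x \<ominus> y) = f x \<ominus>\<^bsub>W\<^esub> f y"
proof -
  interpret W: kmodule K W by fact
  have f: "f \<in> carrier V \<rightarrow> carrier W" "\<And>x y. x \<in> carrier V \<Longrightarrow> y \<in> carrier V \<Longrightarrow> f (x \<oplus> y) = f x \<oplus>\<^bsub>W\<^esub> f y"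
    "\<And>c x. c \<in> K \<Longrightarrow> x \<in> carrier V \<Longrightarrow> f (c \<odot> x) = c \<odot>\<^bsub>W\<^esub> f x"
    using assms(2) by (auto simp: linear_map_def)
  then have "f x \<in> carrier W" "f y \<in> carrier W" using assms by auto
  then show ?thesis using assms f by (simp add: minus_eq W.minus_eq)
qed

end

context scalar_field begin

lemma kmodule_scalars: "kmodule K (scalars K)"
  by (intro kmodule.intro scalar_field_axioms module_scalarsI) (auto simp: algebra_simps)

lemma kmoduleI: "Module.module (scalars K) V \<Longrightarrow> kmodule K V"
  by (intro kmodule.intro scalar_field_axioms)

lemma normed_space_kmodule: "normed_space K V \<Longrightarrow> kmodule K V"
  by (simp add: normed_space_def kmoduleI)

end

section \<open>The Hahn--Banach theorem\<close>

definition sublinear :: "'v nspace \<Rightarrow> ('v \<Rightarrow> real) \<Rightarrow> bool" where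
  "sublinear V p \<longleftrightarrow>
     (\<forall>x\<in>carrier V. \<forall>y\<in>carrier V. p (x \<oplus>\<^bsub>V\<^esub> y) \<le> p x + p y) \<and>
     (\<forall>t\<ge>0. \<forall>x\<in>carrier V. p (of_real t \<odot>\<^bsub>V\<^esub> x) = t * p x)"

text \<open>The standard device for linearising \<open>p\<close> along \<open>y\<close>: the result
  is again sublinear, lies below \<open>p\<close>, and is at most \<open>- p y\<close> at the
  negative of \<open>y\<close>. A linear functional below it therefore takes at least the value
  \<open>p y\<close> at \<open>y\<close>.\<close>

definition sublinear_shift :: "'v nspace \<Rightarrow> ('v \<Rightarrow> real) \<Rightarrow> 'v \<Rightarrow> 'v \<Rightarrow> real" where
  "sublinear_shift V p y x = Inf {p (x \<oplus>\<^bsub>V\<^esub> of_real t \<odot>\<^bsub>V\<^esub> y) - t * p y |t. t \<ge> 0}"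

lemma sublinearD:
  assumes "sublinear V p"
  shows "x \<in> carrier V \<Longrightarrow> y \<in> carrier V \<Longrightarrow> p (x \<oplus>\<^bsub>V\<^esub> y) \<le> p x + p y"
    "0 \<le> t \<Longrightarrow> x \<in> carrier V \<Longrightarrow> p (of_real t \<odot>\<^bsub>V\<^esub> x) = t * p x"
  using assms by (auto simp: sublinear_def)

context
  fixes V :: "'v nspace" (structure)
  assumes V: "kmodule \<real> V"
begin

interpretation kmodule \<real> V by (rule V)

lemma sublinear_zero: "sublinear V p \<Longrightarrow> p \<zero> = 0"
  using sublinearD(2)[of V p 0 "\<zero>"] by simp

lemma sublinear_neg:
  assumes "sublinear V p" "x \<in> carrier V" shows "- p ((- 1) \<odot> x) \<le> p x"
proof -
  have "p (x \<oplus> (- 1) \<odot> x) \<le> p x + p ((- 1) \<odot> x)"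
    using assms by (intro sublinearD) auto
  then show ?thesis using assms by (simp add: minus_eq[symmetric] sublinear_zero)
qed

context
  fixes p y
  assumes p: "sublinear V p" and y: "y \<in> carrier V"
begin

text \<open>Subadditivity at \<open>t y = - x + (x + t y)\<close>. The bound does not depend on
  \<open>t\<close>, so the infimum in the shift is finite.\<close>

lemma shift_lower:
  assumes "x \<in> carrier V" "t \<ge> 0"
  shows "- p ((- 1) \<odot> x) \<le> p (x \<oplus> of_real t \<odot> y) - t * p y"
proof -
  let ?ty = "of_real t \<odot> y"
  have "p (((- 1) \<odot> x) \<oplus> (x \<oplus> ?ty)) \<le> p ((- 1) \<odot> x) + p (x \<oplus> ?ty)"
    using p y assms by (intro sublinearD) auto
  also have "((- 1) \<odot> x) \<oplus> (x \<oplus> ?ty) = ?ty"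
    using assms y by (simp add: uminus_eq[symmetric] M.r_neg1)
  finally show ?thesis using sublinearD(2)[OF p] assms y by simp
qed

lemma bdd_shift: "x \<in> carrier V \<Longrightarrow>
    bdd_below {p (x \<oplus> of_real t \<odot> y) - t * p y |t. t \<ge> 0}"
  using shift_lower by (intro bdd_belowI) auto

lemma shift_le: "x \<in> carrier V \<Longrightarrow> t \<ge> 0 \<Longrightarrow>
    sublinear_shift V p y x \<le> p (x \<oplus> of_real t \<odot> y) - t * p y"
  unfolding sublinear_shift_def by (intro cInf_lower bdd_shift) auto

lemma shift_greatest:
  assumes "\<And>t. t \<ge> 0 \<Longrightarrow> r \<le> p (x \<oplus> of_real t \<odot> y) - t * p y"
  shows "r \<le> sublinear_shift V p y x"
  unfolding sublinear_shift_def
  by (rule cInf_greatest) (use assms in \<open>auto intro!: exI[of _ 0]\<close>)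

lemma shift_le_self: "x \<in> carrier V \<Longrightarrow> sublinear_shift V p y x \<le> p x"
  using shift_le[of x 0] y by simp

lemma shift_neg: "sublinear_shift V p y ((- 1) \<odot> y) \<le> - p y"
  using shift_le[of "(- 1) \<odot> y" 1] y
  by (simp add: uminus_eq[symmetric] M.l_neg sublinear_zero[OF p])

text \<open>Parameters \<open>s\<close> for \<open>x\<close> and \<open>t\<close> for
  \<open>z\<close> combine to the parameter \<open>s + t\<close> for the sum, and
  \<open>r * t\<close> serves the multiple by \<open>r\<close>. The two infima are then taken one
  after the other.\<close>

lemma sublinear_shift: "sublinear V (sublinear_shift V p y)"
  unfolding sublinear_def
proof (intro conjI ballI allI impI)
  let ?q = "sublinear_shift V p y"
  fix x z assume x: "x \<in> carrier V" and z: "z \<in> carrier V"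
  have "?q (x \<oplus> z) \<le> (p (x \<oplus> of_real s \<odot> y) - s * p y)
     + (p (z \<oplus> of_real t \<odot> y) - t * p y)" if "s \<ge> 0" "t \<ge> 0" for s t
  proof -
    let ?s = "of_real s \<odot> y" and ?t = "of_real t \<odot> y"
    have "?q (x \<oplus> z) \<le> p ((x \<oplus> z) \<oplus> of_real (s + t) \<odot> y) - (s + t) * p y"
      using x z that by (intro shift_le) auto
    also have "(x \<oplus> z) \<oplus> of_real (s + t) \<odot> y = (x \<oplus> ?s) \<oplus> (z \<oplus> ?t)"
      using x y z by (simp add: smult_distr_scalar M.a_ac)
    also have "p \<dots> \<le> p (x \<oplus> ?s) + p (z \<oplus> ?t)"
      using p x y z by (intro sublinearD) auto
    finally show ?thesis by (simp add: algebra_simps)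
  qed
  then have "?q (x \<oplus> z) - (p (z \<oplus> of_real t \<odot> y) - t * p y) \<le> ?q x"
    if "t \<ge> 0" for t
    using that by (intro shift_greatest) (simp add: algebra_simps)
  then have "?q (x \<oplus> z) - ?q x \<le> ?q z"
    by (intro shift_greatest) (simp add: algebra_simps)
  then show "?q (x \<oplus> z) \<le> ?q x + ?q z" by simp
next
  let ?q = "sublinear_shift V p y"
  have le: "?q (of_real r \<odot> x) \<le> r * ?q x" if x: "x \<in> carrier V" and r: "r > 0" for x r
  proof -
    have "?q (of_real r \<odot> x) / r \<le> ?q x"
    proof (rule shift_greatest)
      fix t :: real assume t: "t \<ge> 0"
      let ?t = "of_real t \<odot> y"
      have "?q (of_real r \<odot> x)
          \<le> p (of_real r \<odot> x \<oplus> of_real (r * t) \<odot> y) - (r * t) * p y"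
        using x r t by (intro shift_le) auto
      also have "of_real r \<odot> x \<oplus> of_real (r * t) \<odot> y
          = of_real r \<odot> (x \<oplus> ?t)"
        using x y by (simp add: smult_distr_vec smult_smult)
      also have "p \<dots> = r * p (x \<oplus> ?t)"
        using x y r by (intro sublinearD(2)[OF p]) auto
      finally show "?q (of_real r \<odot> x) / r \<le> p (x \<oplus> ?t) - t * p y"
        using r by (simp add: field_simps)
    qed
    then show ?thesis using r by (simp add: field_simps)
  qed
  fix r :: real and x assume r: "0 \<le> r" and x: "x \<in> carrier V"
  show "?q (of_real r \<odot> x) = r * ?q x"
  proof (cases "r = 0")
    case True
    have "?q \<zero> \<le> 0" using shift_le_self[of "\<zero>"] sublinear_zero[OF p] by simp
    moreover have "0 \<le> ?q \<zero>"
      using sublinearD(2)[OF p] y by (intro shift_greatest) simp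
    ultimately show ?thesis using True x by simp
  next
    case False
    then have "r > 0" using r by simp
    \<comment> \<open>The reverse inequality is \<open>le\<close> for the factor
      \<open>1 / r\<close> at the vector \<open>r x\<close>.\<close>
    have "?q (of_real (1 / r) \<odot> (of_real r \<odot> x)) \<le> 1 / r * ?q (of_real r \<odot> x)"
      using x \<open>r > 0\<close> by (intro le) auto
    moreover have "complex_of_real (1 / r) * complex_of_real r = 1"
      using \<open>r > 0\<close> by simp
    then have "of_real (1 / r) \<odot> (of_real r \<odot> x) = x"
      using x by (subst smult_smult) auto
    ultimately have "r * ?q x \<le> ?q (of_real r \<odot> x)"
      using \<open>r > 0\<close> by (simp add: field_simps)
    then show ?thesis using le[OF x \<open>r > 0\<close>] by simp
  qed
qed

end

text \<open>A minimal sublinear functional coincides with all of its shifts, hence is linear.\<close>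

lemma hahn_banach:
  assumes p: "sublinear V p" and y: "y \<in> carrier V"
  obtains l where "\<And>x z. x \<in> carrier V \<Longrightarrow> z \<in> carrier V \<Longrightarrow> l (x \<oplus> z) = l x + l z"
    and "\<And>t x. x \<in> carrier V \<Longrightarrow> l (of_real t \<odot> x) = t * l x"
    and "\<And>x. x \<in> carrier V \<Longrightarrow> l x \<le> p x"
    and "l y = p y"
proof -
  \<comment> \<open>Starting the search below the shift at \<open>y\<close>, not below
    \<open>p\<close>, is what yields \<open>l y = p y\<close>: a linear \<open>m\<close> below
    \<open>q0\<close> satisfies \<open>- m y \<le> q0 (- y) \<le> - p y\<close>.\<close>
  define q0 where "q0 = sublinear_shift V p y"
  have q0: "sublinear V q0" unfolding q0_def by (rule sublinear_shift[OF p y])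
  define A where "A = {q \<in> extensional (carrier V). sublinear V q \<and> (\<forall>x\<in>carrier V. q x \<le> q0 x)}"
  \<comment> \<open>The order is reversed, so a maximal element in the sense of Zorn is a minimal
    functional. Extensionality in \<open>A\<close> makes the order antisymmetric.\<close>
  define P :: "('v \<Rightarrow> real) \<Rightarrow> ('v \<Rightarrow> real) \<Rightarrow> bool" where "P = (\<lambda>a b. \<forall>x\<in>carrier V. b x \<le> a x)"
  have restr: "restrict q (carrier V) \<in> A"
    if "sublinear V q" "\<And>x. x \<in> carrier V \<Longrightarrow> q x \<le> q0 x" for q
    using that by (auto simp: A_def sublinear_def)
  have "\<exists>m\<in>A. \<forall>a\<in>A. P m a \<longrightarrow> a = m"
  proof (rule predicate_Zorn)
    show "partial_order_on A (relation_of P A)"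
    proof (rule partial_order_on_relation_ofI)
      fix a b assume ab: "a \<in> A" "b \<in> A" "P a b" "P b a"
      show "a = b"
      proof (rule extensionalityI)
        show "a \<in> extensional (carrier V)" "b \<in> extensional (carrier V)"
          using ab by (simp_all add: A_def)
        show "a x = b x" if "x \<in> carrier V" for x
          using ab that by (auto simp: P_def intro!: antisym)
      qed
    qed (auto simp: P_def intro: order_trans)
  next
    fix C assume C: "C \<in> Chains (relation_of P A)"
    then have CA: "C \<subseteq> A" and tot: "\<And>a b. a \<in> C \<Longrightarrow> b \<in> C \<Longrightarrow> P a b \<or> P b a"
      by (auto simp: Chains_def relation_of_def)
    show "\<exists>u\<in>A. \<forall>a\<in>C. P a u"
    proof (cases "C = {}")
      case True
      then show ?thesis using restr[OF q0] by auto
    next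
      case False
      \<comment> \<open>Uniform over the chain, from \<open>- q (- x) \<le> q x\<close> and
        \<open>q \<le> q0\<close>; it makes the pointwise infimum \<open>u\<close> finite.\<close>
      have low: "- q0 ((- 1) \<odot> x) \<le> q x" if "q \<in> C" "x \<in> carrier V" for q x
      proof -
        have q: "sublinear V q" "q ((- 1) \<odot> x) \<le> q0 ((- 1) \<odot> x)"
          using that CA by (auto simp: A_def)
        show ?thesis using sublinear_neg[OF q(1) that(2)] q(2) by linarith
      qed
      define u where "u x = (INF q\<in>C. q x)" for x
      have bdd: "bdd_below ((\<lambda>q. q x) ` C)" if "x \<in> carrier V" for x
        using low that by (intro bdd_belowI) auto
      have ule: "u x \<le> q x" if "q \<in> C" "x \<in> carrier V" for q x
        unfolding u_def using that bdd by (intro cINF_lower)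
      have ugr: "r \<le> u x" if "\<And>q. q \<in> C \<Longrightarrow> r \<le> q x" for r x
        unfolding u_def using that False by (intro cINF_greatest)
      have "sublinear V u"
        unfolding sublinear_def
      proof (intro conjI ballI allI impI)
        fix x z assume x: "x \<in> carrier V" and z: "z \<in> carrier V"
        have "u (x \<oplus> z) \<le> q1 x + q2 z" if q12: "q1 \<in> C" "q2 \<in> C" for q1 q2
        proof -
          \<comment> \<open>The two functionals are comparable, and the smaller one serves both
            arguments.\<close>
          obtain q where q: "q \<in> C" "q x \<le> q1 x" "q z \<le> q2 z"
            using tot[OF q12] q12 x z by (auto simp: P_def)
          then have "sublinear V q" using CA by (auto simp: A_def)
          then have "q (x \<oplus> z) \<le> q x + q z" using x z by (rule sublinearD)
          then show ?thesis using ule[OF q(1), of "x \<oplus> z"] x z q by simp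
        qed
        then have "u (x \<oplus> z) - q2 z \<le> u x" if "q2 \<in> C" for q2
          using that by (intro ugr) (simp add: algebra_simps)
        then have "u (x \<oplus> z) - u x \<le> u z" by (intro ugr) (simp add: algebra_simps)
        then show "u (x \<oplus> z) \<le> u x + u z" by simp
      next
        fix t :: real and x assume t: "0 \<le> t" and x: "x \<in> carrier V"
        have qt: "q (of_real t \<odot> x) = t * q x" if "q \<in> C" for q
          using that CA t x by (intro sublinearD(2)) (auto simp: A_def)
        show "u (of_real t \<odot> x) = t * u x"
        proof (cases "t = 0")
          case True
          have "u (of_real t \<odot> x) = (INF q\<in>C. 0)"
            unfolding u_def using qt True by (intro INF_cong) auto
          then show ?thesis using False True by simp
        next
          case t0: False
          have "u (of_real t \<odot> x) / t \<le> u x"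
          proof (rule ugr)
            fix q assume "q \<in> C"
            then show "u (of_real t \<odot> x) / t \<le> q x"
              using ule[of q "of_real t \<odot> x"] qt t t0 x by (simp add: field_simps)
          qed
          moreover have "t * u x \<le> u (of_real t \<odot> x)"
            using t x by (intro ugr) (simp add: qt ule mult_left_mono)
          ultimately show ?thesis using t t0 by (simp add: field_simps)
        qed
      qed
      moreover have "u x \<le> q0 x" if "x \<in> carrier V" for x
        using False CA ule that unfolding A_def by fastforce
      ultimately have "restrict u (carrier V) \<in> A" by (rule restr)
      then show ?thesis using ule by (intro bexI) (auto simp: P_def)
    qed
  qed
  then obtain m where mA: "m \<in> A" and min: "\<And>a. a \<in> A \<Longrightarrow> P m a \<Longrightarrow> a = m" by blast
  have m: "sublinear V m" and mq: "\<And>x. x \<in> carrier V \<Longrightarrow> m x \<le> q0 x"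
    using mA by (auto simp: A_def)
  have add: "m (x \<oplus> z) = m x + m z" if x: "x \<in> carrier V" and z: "z \<in> carrier V" for x z
  proof -
    let ?s = "restrict (sublinear_shift V m z) (carrier V)"
    have "?s \<in> A"
      using shift_le_self[OF m z] mq by (intro restr sublinear_shift m z) (auto intro: order_trans)
    moreover have "P m ?s" using shift_le_self[OF m z] by (auto simp: P_def)
    ultimately have "?s = m" by (rule min)
    then have "m x = sublinear_shift V m z x" using x by (metis restrict_apply')
    \<comment> \<open>The term \<open>t = 1\<close> of the infimum; it gives superadditivity, the
      half of additivity that sublinearity lacks.\<close>
    also have "\<dots> \<le> m (x \<oplus> z) - m z" using shift_le[OF m z x, of 1] z by simp
    finally show ?thesis using sublinearD(1)[OF m x z] by simp
  qed
  have neg: "m ((- 1) \<odot> x) = - m x" if "x \<in> carrier V" for x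
    using add[of x "(- 1) \<odot> x"] that by (simp add: minus_eq[symmetric] sublinear_zero[OF m])
  show thesis
  proof (rule that)
    show "m (x \<oplus> z) = m x + m z" if "x \<in> carrier V" "z \<in> carrier V" for x z
      using that by (rule add)
    show "m (of_real t \<odot> x) = t * m x" if x: "x \<in> carrier V" for t x
    proof (cases "t \<ge> 0")
      case True
      then show ?thesis using sublinearD(2)[OF m] x by simp
    next
      case False
      have "m (of_real (- t) \<odot> ((- 1) \<odot> x)) = - t * m ((- 1) \<odot> x)"
        using False x by (intro sublinearD(2)[OF m]) auto
      then show ?thesis using x by (simp add: smult_smult neg)
    qed
    show mp: "m x \<le> p x" if "x \<in> carrier V" for x
      using mq[OF that] shift_le_self[OF p y that] by (simp add: q0_def)
    show "m y = p y"
      using mq[of "(- 1) \<odot> y"] shift_neg[OF p y] neg[OF y] mp[OF y] y by (simp add: q0_def)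
  qed
qed

end

section \<open>Spans and dual spaces\<close>

lemma sum_append:
  fixes f g :: "nat \<Rightarrow> 'b::comm_monoid_add"
  shows "(\<Sum>j<m + k. if j < m then f j else g (j - m)) = (\<Sum>j<m. f j) + (\<Sum>j<k. g j)"
  by (induction k) (simp_all add: add.assoc)

lemma fun_span_simps [simp]:
  "\<zero>\<^bsub>fun_span K S N\<^esub> = (\<lambda>\<phi>. 0)"
  "u \<oplus>\<^bsub>fun_span K S N\<^esub> w = (\<lambda>\<phi>. u \<phi> + w \<phi>)"
  "c \<odot>\<^bsub>fun_span K S N\<^esub> u = (\<lambda>\<phi>. c * u \<phi>)"
  "nrm (fun_span K S N) = N"
  by (simp_all add: fun_span_def)

lemma fun_spanI:
  "(\<And>j. j < m \<Longrightarrow> c j \<in> K \<and> s j \<in> S) \<Longrightarrow>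
    (\<lambda>\<phi>. \<Sum>j<m::nat. c j * s j \<phi>) \<in> carrier (fun_span K S N)"
  by (auto simp: fun_span_def)

lemma fun_span_zero: "(\<lambda>\<phi>. 0) \<in> carrier (fun_span K S N)"
  using fun_spanI[of 0 _ K _ S] by simp

lemma fun_span_add:
  assumes "u \<in> carrier (fun_span K S N)" "w \<in> carrier (fun_span K S N)"
  shows "(\<lambda>\<phi>. u \<phi> + w \<phi>) \<in> carrier (fun_span K S N)"
proof -
  obtain m c s where u: "\<And>j. j < m \<Longrightarrow> c j \<in> K \<and> s j \<in> S" "u = (\<lambda>\<phi>. \<Sum>j<m::nat. c j * s j \<phi>)"
    using assms(1) by (auto simp: fun_span_def)
  obtain k d t where w: "\<And>j. j < k \<Longrightarrow> d j \<in> K \<and> t j \<in> S" "w = (\<lambda>\<phi>. \<Sum>j<k::nat. d j * t j \<phi>)"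
    using assms(2) by (auto simp: fun_span_def)
  have "(\<lambda>\<phi>. u \<phi> + w \<phi>) = (\<lambda>\<phi>. \<Sum>j<m + k. (if j < m then c j else d (j - m)) *
     (if j < m then s j else t (j - m)) \<phi>)"
    unfolding u w sum_append[symmetric] by (auto intro!: ext sum.cong)
  also have "\<dots> \<in> carrier (fun_span K S N)"
    by (rule fun_spanI) (use u(1) w(1) in auto)
  finally show ?thesis .
qed

lemma fun_span_induct [consumes 1, case_names zero step]:
  assumes "u \<in> carrier (fun_span K S N)"
    and "P (\<lambda>\<phi>. 0)"
    and step: "\<And>c s u. c \<in> K \<Longrightarrow> s \<in> S \<Longrightarrow> u \<in> carrier (fun_span K S N) \<Longrightarrow> P u \<Longrightarrow>
      P (\<lambda>\<phi>. u \<phi> + c * s \<phi>)"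
  shows "P u"
proof -
  have "P (\<lambda>\<phi>. \<Sum>j<m. c j * s j \<phi>)" if "\<And>j. j < m \<Longrightarrow> c j \<in> K \<and> s j \<in> S" for m :: nat and c s
    using that
  proof (induction m)
    case (Suc m)
    then show ?case
      using step[of "c m" "s m" "\<lambda>\<phi>. \<Sum>j<m. c j * s j \<phi>"] fun_spanI[of m c K s S] by auto
  qed (use assms in simp)
  then show ?thesis using assms(1) by (auto simp: fun_span_def)
qed

context scalar_field begin

lemma fun_span_smult:
  assumes "c \<in> K" "u \<in> carrier (fun_span K S N)"
  shows "(\<lambda>\<phi>. c * u \<phi>) \<in> carrier (fun_span K S N)"
proof -
  obtain m d s where u: "\<And>j. j < m \<Longrightarrow> d j \<in> K \<and> s j \<in> S" "u = (\<lambda>\<phi>. \<Sum>j<m::nat. d j * s j \<phi>)"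
    using assms(2) by (auto simp: fun_span_def)
  have "(\<lambda>\<phi>. c * u \<phi>) = (\<lambda>\<phi>. \<Sum>j<m. (c * d j) * s j \<phi>)"
    by (simp add: u sum_distrib_left mult.assoc)
  also have "\<dots> \<in> carrier (fun_span K S N)"
    by (rule fun_spanI) (use u(1) assms(1) in auto)
  finally show ?thesis .
qed

lemma fun_span_base:
  assumes "s \<in> S" shows "s \<in> carrier (fun_span K S N)"
  using fun_spanI[of 1 "\<lambda>_. 1" K "\<lambda>_. s" S N] assms by simp

lemma kmodule_fun_span: "kmodule K (fun_span K S N)"
  by (intro kmoduleI module_scalarsI)
    (auto simp: fun_span_zero fun_span_add fun_span_smult algebra_simps)

lemma fun_span_minus [simp]:
  assumes "u \<in> carrier (fun_span K S N)" "w \<in> carrier (fun_span K S N)"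
  shows "u \<ominus>\<^bsub>fun_span K S N\<^esub> w = (\<lambda>\<phi>. u \<phi> - w \<phi>)"
  using kmodule.minus_eq[OF kmodule_fun_span assms] by simp

text \<open>Restriction of scalars, through which the real Hahn-Banach theorem reaches spaces over
  \<open>K\<close>.\<close>

lemma kmodule_real:
  assumes "kmodule K V" shows "kmodule \<real> V"
proof -
  interpret kmodule K V by fact
  interpret R: scalar_field \<real> by unfold_locales simp
  have sub: "c \<in> K" if "c \<in> \<real>" for c using K_cases that by auto
  show ?thesis
    by (intro R.kmoduleI R.module_scalarsI)
      (auto simp: sub M.a_ac smult_distr_scalar smult_distr_vec smult_smult)
qed

end

text \<open>Abstracts from a norm so that one theory of dual spaces covers both \<open>Y\<close> and
  the tensor product under \<open>gamma\<close>. Nonnegativity and scaling by positive reals are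
  enough to normalise vectors, hence for the duality between a functional and its norm.\<close>

locale gauged_module = kmodule K V for K and V :: "'v nspace" (structure) +
  assumes nrm_nonneg: "x \<in> carrier V \<Longrightarrow> 0 \<le> nrm V x"
    and nrm_scale: "r > 0 \<Longrightarrow> x \<in> carrier V \<Longrightarrow> nrm V (complex_of_real r \<odot> x) = r * nrm V x"
begin

lemma nrm_zero: "nrm V \<zero> = 0"
  using nrm_scale[of 2 "\<zero>"] smult_zero[OF K_closed(3), of 2] by simp

lemma dual_simps [simp]:
  "\<zero>\<^bsub>dual_space K V\<^esub> = (\<lambda>v\<in>carrier V. 0)"
  "f \<oplus>\<^bsub>dual_space K V\<^esub> g = (\<lambda>v\<in>carrier V. f v + g v)"
  "c \<odot>\<^bsub>dual_space K V\<^esub> f = (\<lambda>v\<in>carrier V. c * f v)"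
  by (simp_all add: dual_space_def)

lemma dualI:
  assumes "f \<in> extensional (carrier V)" "\<And>v. v \<in> carrier V \<Longrightarrow> f v \<in> K"
    "\<And>v w. v \<in> carrier V \<Longrightarrow> w \<in> carrier V \<Longrightarrow> f (v \<oplus> w) = f v + f w"
    "\<And>c v. c \<in> K \<Longrightarrow> v \<in> carrier V \<Longrightarrow> f (c \<odot> v) = c * f v"
    "\<And>v. v \<in> carrier V \<Longrightarrow> cmod (f v) \<le> C * nrm V v"
  shows "f \<in> carrier (dual_space K V)"
  using assms by (auto simp: dual_space_def linear_map_def intro!: exI[of _ C])

lemma dualD:
  assumes "f \<in> carrier (dual_space K V)"
  shows "f \<in> extensional (carrier V)" "linear_map K V (scalars K) f"
    "\<And>v. v \<in> carrier V \<Longrightarrow> f v \<in> K"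
    "\<And>v w. v \<in> carrier V \<Longrightarrow> w \<in> carrier V \<Longrightarrow> f (v \<oplus> w) = f v + f w"
    "\<And>c v. c \<in> K \<Longrightarrow> v \<in> carrier V \<Longrightarrow> f (c \<odot> v) = c * f v"
    "\<And>v w. v \<in> carrier V \<Longrightarrow> w \<in> carrier V \<Longrightarrow> f (v \<ominus> w) = f v - f w"
    "\<exists>C. \<forall>v\<in>carrier V. cmod (f v) \<le> C * nrm V v"
    "f \<zero> = 0"
proof -
  show lin: "linear_map K V (scalars K) f" using assms by (simp add: dual_space_def)
  show "f \<zero> = 0" using linear_map_zero[OF kmodule_scalars lin] by simp
  show val: "f v \<in> K" if "v \<in> carrier V" for v
    using lin that by (auto simp: linear_map_def)
  show "f (v \<ominus> w) = f v - f w" if "v \<in> carrier V" "w \<in> carrier V" for v w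
    using linear_map_minus[OF kmodule_scalars lin that] that val by simp
qed (use assms in \<open>auto simp: dual_space_def linear_map_def\<close>)

lemma dual_bdd:
  assumes "f \<in> carrier (dual_space K V)"
  shows "bdd_above {cmod (f v) |v. v \<in> carrier V \<and> nrm V v \<le> 1}"
proof -
  obtain C where C: "\<And>v. v \<in> carrier V \<Longrightarrow> cmod (f v) \<le> C * nrm V v"
    using dualD(7)[OF assms] by auto
  show ?thesis
  proof (rule bdd_aboveI)
    fix r assume "r \<in> {cmod (f v) |v. v \<in> carrier V \<and> nrm V v \<le> 1}"
    then obtain v where v: "v \<in> carrier V" "nrm V v \<le> 1" "r = cmod (f v)" by auto
    have "C * nrm V v \<le> \<bar>C\<bar> * 1"
      using v nrm_nonneg by (intro mult_mono) auto
    then show "r \<le> \<bar>C\<bar>" using C[OF v(1)] v(3) by linarith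
  qed
qed

lemma dual_nonneg:
  assumes "f \<in> carrier (dual_space K V)" shows "0 \<le> nrm (dual_space K V) f"
proof -
  have "cmod (f \<zero>) \<le> nrm (dual_space K V) f"
    unfolding dual_space_def nspace.simps
    by (rule cSup_upper[OF _ dual_bdd[OF assms]]) (auto intro!: exI[of _ "\<zero>"] simp: nrm_zero)
  then show ?thesis using norm_ge_zero order_trans by blast
qed

lemma dual_bound:
  assumes f: "f \<in> carrier (dual_space K V)" and v: "v \<in> carrier V"
  shows "cmod (f v) \<le> nrm (dual_space K V) f * nrm V v"
proof (cases "nrm V v = 0")
  case True
  \<comment> \<open>Such a vector cannot be normalised; the constant in the definition of
    boundedness gives \<open>f v = 0\<close> directly.\<close>
  then show ?thesis using dualD(7)[OF f] v by force
next
  case False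
  then have pos: "nrm V v > 0" using nrm_nonneg[OF v] by simp
  let ?w = "complex_of_real (1 / nrm V v) \<odot> v"
  have "nrm V ?w = 1" using nrm_scale[of "1 / nrm V v" v] pos v by simp
  then have "cmod (f ?w) \<le> nrm (dual_space K V) f"
    unfolding dual_space_def nspace.simps
    by (intro cSup_upper[OF _ dual_bdd[OF f]]) (auto intro!: exI[of _ ?w] v)
  then have "cmod (complex_of_real (1 / nrm V v) * f v) \<le> nrm (dual_space K V) f"
    using dualD(5)[OF f K_closed(3) v, of "1 / nrm V v"] by simp
  then show ?thesis using pos by (simp add: norm_mult norm_divide field_simps)
qed

lemma dual_norm_le:
  assumes "C \<ge> 0" "\<And>v. v \<in> carrier V \<Longrightarrow> cmod (f v) \<le> C * nrm V v"
  shows "nrm (dual_space K V) f \<le> C"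
  unfolding dual_space_def nspace.simps
proof (rule cSup_least)
  show "{cmod (f v) |v. v \<in> carrier V \<and> nrm V v \<le> 1} \<noteq> {}"
    using nrm_zero by (auto intro!: exI[of _ "\<zero>"])
  fix r assume "r \<in> {cmod (f v) |v. v \<in> carrier V \<and> nrm V v \<le> 1}"
  then obtain v where v: "v \<in> carrier V" "nrm V v \<le> 1" "r = cmod (f v)" by auto
  then show "r \<le> C" using assms(2)[OF v(1)] mult_left_mono[OF v(2) assms(1)] by simp
qed

lemma normed_dual: "normed_space K (dual_space K V)"
proof -
  let ?D = "dual_space K V"
  have ext: "f = g" if "f \<in> extensional (carrier V)" "g \<in> extensional (carrier V)"
    "\<And>v. v \<in> carrier V \<Longrightarrow> f v = g v" for f g :: "'v \<Rightarrow> complex"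
    using that by (metis extensionalityI)
  have zero: "\<zero>\<^bsub>?D\<^esub> \<in> carrier ?D"
    by (simp, rule dualI[where C = 0]) auto
  have add: "f \<oplus>\<^bsub>?D\<^esub> g \<in> carrier ?D"
      and tri: "nrm ?D (f \<oplus>\<^bsub>?D\<^esub> g) \<le> nrm ?D f + nrm ?D g"
    if f: "f \<in> carrier ?D" and g: "g \<in> carrier ?D" for f g
  proof -
    have *: "cmod (f v + g v) \<le> (nrm ?D f + nrm ?D g) * nrm V v" if "v \<in> carrier V" for v
      using dual_bound[OF f that] dual_bound[OF g that] norm_triangle_ineq[of "f v" "g v"]
      by (simp add: algebra_simps)
    show "f \<oplus>\<^bsub>?D\<^esub> g \<in> carrier ?D"
      using dualD[OF f] dualD[OF g] *
      by (simp, intro dualI[where C = "nrm ?D f + nrm ?D g"]) (auto simp: algebra_simps)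
    show "nrm ?D (f \<oplus>\<^bsub>?D\<^esub> g) \<le> nrm ?D f + nrm ?D g"
      using * dual_nonneg f g by (intro dual_norm_le) auto
  qed
  have smult: "c \<odot>\<^bsub>?D\<^esub> f \<in> carrier ?D"
      and hom_le: "nrm ?D (c \<odot>\<^bsub>?D\<^esub> f) \<le> cmod c * nrm ?D f"
    if c: "c \<in> K" and f: "f \<in> carrier ?D" for c f
  proof -
    have *: "cmod (c * f v) \<le> (cmod c * nrm ?D f) * nrm V v" if "v \<in> carrier V" for v
      using mult_left_mono[OF dual_bound[OF f that], of "cmod c"] by (simp add: norm_mult mult.assoc)
    show "c \<odot>\<^bsub>?D\<^esub> f \<in> carrier ?D"
      using dualD[OF f] c * by (simp, intro dualI[where C = "cmod c * nrm ?D f"]) (auto simp: algebra_simps)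
    show "nrm ?D (c \<odot>\<^bsub>?D\<^esub> f) \<le> cmod c * nrm ?D f"
      using * dual_nonneg f by (intro dual_norm_le) auto
  qed
  have mod: "Module.module (scalars K) ?D"
  proof (rule module_scalarsI)
    fix x y z assume "x \<in> carrier ?D" "y \<in> carrier ?D" "z \<in> carrier ?D"
    note x = dualD(1)[OF this(1)] and y = dualD(1)[OF this(2)] and z = dualD(1)[OF this(3)]
    show "x \<oplus>\<^bsub>?D\<^esub> y \<oplus>\<^bsub>?D\<^esub> z = x \<oplus>\<^bsub>?D\<^esub> (y \<oplus>\<^bsub>?D\<^esub> z)" "x \<oplus>\<^bsub>?D\<^esub> y = y \<oplus>\<^bsub>?D\<^esub> x"
      by (auto intro!: ext)
  next
    fix x assume "x \<in> carrier ?D"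
    note x = dualD(1)[OF this]
    show "\<zero>\<^bsub>?D\<^esub> \<oplus>\<^bsub>?D\<^esub> x = x" "0 \<odot>\<^bsub>?D\<^esub> x = \<zero>\<^bsub>?D\<^esub>" "1 \<odot>\<^bsub>?D\<^esub> x = x"
      using x by (auto intro!: ext)
  qed (use zero add smult in \<open>auto intro!: ext simp: algebra_simps\<close>)
  show ?thesis
    unfolding normed_space_def
  proof (intro conjI ballI)
    fix f assume f: "f \<in> carrier ?D"
    show "0 \<le> nrm ?D f" by (rule dual_nonneg[OF f])
    show "nrm ?D f = 0 \<longleftrightarrow> f = \<zero>\<^bsub>?D\<^esub>"
    proof
      assume "nrm ?D f = 0"
      then have "f v = 0" if "v \<in> carrier V" for v using dual_bound[OF f that] by simp
      then show "f = \<zero>\<^bsub>?D\<^esub>" using dualD(1)[OF f] by (auto intro!: ext)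
    next
      assume "f = \<zero>\<^bsub>?D\<^esub>"
      then have "nrm ?D f \<le> 0" by (intro dual_norm_le) auto
      then show "nrm ?D f = 0" using dual_nonneg[OF f] by simp
    qed
    show "nrm ?D (c \<odot>\<^bsub>?D\<^esub> f) = cmod c * nrm ?D f" if c: "c \<in> K" for c
    proof (cases "c = 0")
      case True
      have "nrm ?D (0 \<odot>\<^bsub>?D\<^esub> f) \<le> 0" using hom_le[OF K_closed(1) f] by simp
      then show ?thesis using True dual_nonneg[OF smult[OF c f]] by (simp del: dual_simps)
    next
      case False
      \<comment> \<open>The missing half of homogeneity is \<open>hom_le\<close> for the inverse
        scalar.\<close>
      have inv: "1 / c \<in> K" using K_cases c by (auto simp: Reals_divide)
      have "(1 / c) \<odot>\<^bsub>?D\<^esub> (c \<odot>\<^bsub>?D\<^esub> f) = f"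
        using False dualD(1)[OF f] by (auto intro!: ext)
      then have "nrm ?D f \<le> cmod (1 / c) * nrm ?D (c \<odot>\<^bsub>?D\<^esub> f)"
        using hom_le[OF inv smult[OF c f]] by simp
      then have "cmod c * nrm ?D f \<le> nrm ?D (c \<odot>\<^bsub>?D\<^esub> f)"
        using False by (simp add: norm_divide field_simps del: dual_simps)
      then show ?thesis using hom_le[OF c f] by simp
    qed
  qed (use mod tri in auto)
qed

end

context scalar_field begin

lemma normed_spaceD:
  assumes "normed_space K V"
  shows "x \<in> carrier V \<Longrightarrow> 0 \<le> nrm V x"
    "x \<in> carrier V \<Longrightarrow> nrm V x = 0 \<longleftrightarrow> x = \<zero>\<^bsub>V\<^esub>"
    "x \<in> carrier V \<Longrightarrow> y \<in> carrier V \<Longrightarrow> nrm V (x \<oplus>\<^bsub>V\<^esub> y) \<le> nrm V x + nrm V y"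
    "c \<in> K \<Longrightarrow> x \<in> carrier V \<Longrightarrow> nrm V (c \<odot>\<^bsub>V\<^esub> x) = cmod c * nrm V x"
  using assms by (auto simp: normed_space_def)

lemma normed_space_gauged: "normed_space K V \<Longrightarrow> gauged_module K V"
  by (intro gauged_module.intro normed_space_kmodule gauged_module_axioms.intro)
    (auto simp: normed_spaceD)

text \<open>Real Hahn-Banach below the norm, followed by the passage from a real functional to a
  \<open>K\<close>-linear one with that real part. The norm bound survives because every value can
  be rotated onto the positive real axis.\<close>

lemma norming_functional:
  assumes Y: "normed_space K Y" and y: "y \<in> carrier Y"
  obtains f where "f \<in> carrier (dual_space K Y)" "f y = complex_of_real (nrm Y y)"
    "nrm (dual_space K Y) f \<le> 1"
proof -
  interpret gauged_module K Y by (rule normed_space_gauged[OF Y])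
  have R: "kmodule \<real> Y" by (rule kmodule_real) (rule kmodule_axioms)
  have "sublinear Y (nrm Y)"
    unfolding sublinear_def using normed_spaceD[OF Y] by auto
  then obtain l where add: "\<And>x z. x \<in> carrier Y \<Longrightarrow> z \<in> carrier Y \<Longrightarrow> l (x \<oplus>\<^bsub>Y\<^esub> z) = l x + l z"
    and hom: "\<And>t x. x \<in> carrier Y \<Longrightarrow> l (complex_of_real t \<odot>\<^bsub>Y\<^esub> x) = t * l x"
    and le: "\<And>x. x \<in> carrier Y \<Longrightarrow> l x \<le> nrm Y x" and ly: "l y = nrm Y y"
    using hahn_banach[OF R _ y] by blast
  obtain f where f: "\<And>x. x \<in> carrier Y \<Longrightarrow> f x \<in> K"
    "\<And>v w. v \<in> carrier Y \<Longrightarrow> w \<in> carrier Y \<Longrightarrow> f (v \<oplus>\<^bsub>Y\<^esub> w) = f v + f w"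
    "\<And>c v. c \<in> K \<Longrightarrow> v \<in> carrier Y \<Longrightarrow> f (c \<odot>\<^bsub>Y\<^esub> v) = c * f v"
    "\<And>x. x \<in> carrier Y \<Longrightarrow> Re (f x) = l x"
  proof (cases "K = UNIV")
    case False
    then have "K = \<real>" using K_cases by simp
    show thesis
    proof (rule that[of "\<lambda>x. complex_of_real (l x)"])
      fix c v assume "c \<in> K" and v: "v \<in> carrier Y"
      then obtain r where "c = complex_of_real r" using \<open>K = \<real>\<close> by (auto elim: Reals_cases)
      then show "complex_of_real (l (c \<odot>\<^bsub>Y\<^esub> v)) = c * complex_of_real (l v)"
        using hom[OF v, of r] by simp
    qed (auto simp: add)
  next
    case True
    \<comment> \<open>The imaginary part is forced: a complex linear \<open>f\<close> with real part
      \<open>l\<close> has \<open>Im (f x) = - Re (f (\<i> x))\<close>.\<close>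
    let ?f = "\<lambda>x. Complex (l x) (- l (\<i> \<odot>\<^bsub>Y\<^esub> x))"
    show thesis
    proof (rule that[of ?f])
      show "?f (v \<oplus>\<^bsub>Y\<^esub> w) = ?f v + ?f w" if "v \<in> carrier Y" "w \<in> carrier Y" for v w
        using that True by (simp add: add smult_distr_vec complex_eq_iff)
      fix c v assume v: "v \<in> carrier Y"
      have split: "l (d \<odot>\<^bsub>Y\<^esub> v) = Re d * l v + Im d * l (\<i> \<odot>\<^bsub>Y\<^esub> v)" for d
      proof -
        have "d = complex_of_real (Re d) + complex_of_real (Im d) * \<i>"
          by (simp add: complex_eq_iff)
        then have "d \<odot>\<^bsub>Y\<^esub> v = (complex_of_real (Re d) + complex_of_real (Im d) * \<i>) \<odot>\<^bsub>Y\<^esub> v"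
          by (rule arg_cong)
        also have "\<dots> = complex_of_real (Re d) \<odot>\<^bsub>Y\<^esub> v \<oplus>\<^bsub>Y\<^esub> complex_of_real (Im d) \<odot>\<^bsub>Y\<^esub> (\<i> \<odot>\<^bsub>Y\<^esub> v)"
          using True v by (simp add: smult_smult smult_distr_scalar)
        finally show ?thesis using True v by (simp only: add hom smult_in UNIV_I)
      qed
      show "?f (c \<odot>\<^bsub>Y\<^esub> v) = c * ?f v"
        using True v split[of c] split[of "\<i> * c"] by (simp add: smult_smult complex_eq_iff)
    qed (use True in auto)
  qed
  have bound: "cmod (f x) \<le> nrm Y x" if x: "x \<in> carrier Y" for x
  proof (cases "f x = 0")
    case True
    then show ?thesis using nrm_nonneg[OF x] by simp
  next
    case False
    \<comment> \<open>A scalar of modulus 1 that turns \<open>f x\<close> into its modulus, so that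
      the bound for the real part \<open>l\<close> applies to the rotated vector.\<close>
    define c where "c = cnj (f x) / cmod (f x)"
    have "c \<in> K" using K_cases f(1)[OF x] by (auto simp: c_def Reals_cnj_iff intro!: Reals_divide)
    have "c * f x = (complex_of_real (cmod (f x)))\<^sup>2 / complex_of_real (cmod (f x))"
      using complex_norm_square[of "f x"] by (simp add: c_def mult.commute)
    then have "c * f x = complex_of_real (cmod (f x))"
      using False by (simp add: power2_eq_square)
    then have "cmod (f x) = Re (f (c \<odot>\<^bsub>Y\<^esub> x))" using f(3)[OF \<open>c \<in> K\<close> x] by simp
    also have "\<dots> \<le> nrm Y (c \<odot>\<^bsub>Y\<^esub> x)" using f(4) le \<open>c \<in> K\<close> x by simp
    also have "\<dots> = nrm Y x"
      using normed_spaceD(4)[OF Y \<open>c \<in> K\<close> x] False by (simp add: c_def norm_divide)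
    finally show ?thesis .
  qed
  let ?f = "restrict f (carrier Y)"
  show thesis
  proof (rule that[of ?f])
    show "?f \<in> carrier (dual_space K Y)"
      using f bound by (intro dualI[where C = 1]) auto
    have "Re (f y) = nrm Y y" using f(4) ly y by simp
    \<comment> \<open>A complex number whose modulus does not exceed its real part is real, so
      \<open>f y\<close> is the norm itself.\<close>
    moreover have "cmod (f y) \<le> Re (f y)" using bound[OF y] calculation by simp
    ultimately show "?f y = complex_of_real (nrm Y y)"
      using y cmod_power2[of "f y"] power_mono[OF bound[OF y], of 2]
      by (simp add: complex_eq_iff)
    show "nrm (dual_space K Y) ?f \<le> 1" using bound by (intro dual_norm_le) auto
  qed
qed

lemma dual_separates:
  assumes Y: "normed_space K Y" and "x \<in> carrier Y" "y \<in> carrier Y"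
    and eq: "\<And>f. f \<in> carrier (dual_space K Y) \<Longrightarrow> f x = f y"
  shows "x = y"
proof -
  interpret gauged_module K Y by (rule normed_space_gauged[OF Y])
  obtain f where f: "f \<in> carrier (dual_space K Y)" "f (x \<ominus>\<^bsub>Y\<^esub> y) = complex_of_real (nrm Y (x \<ominus>\<^bsub>Y\<^esub> y))"
    using norming_functional[OF Y, of "x \<ominus>\<^bsub>Y\<^esub> y"] assms by blast
  then have "nrm Y (x \<ominus>\<^bsub>Y\<^esub> y) = 0" using dualD(6)[OF f(1) assms(2,3)] eq[OF f(1)] f(2) by simp
  then show ?thesis using normed_spaceD(2)[OF Y] assms by (simp add: minus_eq_zero)
qed

lemma normed_subspace:
  assumes V: "normed_space K V" and S: "S \<subseteq> carrier V" "\<zero>\<^bsub>V\<^esub> \<in> S"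
    "\<And>x y. x \<in> S \<Longrightarrow> y \<in> S \<Longrightarrow> x \<oplus>\<^bsub>V\<^esub> y \<in> S" "\<And>c x. c \<in> K \<Longrightarrow> x \<in> S \<Longrightarrow> c \<odot>\<^bsub>V\<^esub> x \<in> S"
  shows "normed_space K (V\<lparr>carrier := S\<rparr>)"
proof -
  interpret kmodule K V by (rule normed_space_kmodule[OF V])
  have c: "x \<in> S \<Longrightarrow> x \<in> carrier V" for x using S by auto
  have "Module.module (scalars K) (V\<lparr>carrier := S\<rparr>)"
    using S by (intro module_scalarsI)
      (auto simp: c M.a_ac smult_distr_scalar smult_distr_vec smult_smult)
  then show ?thesis using V c by (auto simp: normed_space_def)
qed

end

section \<open>Tensor products and the norm gamma\<close>

locale tensor_setting = scalar_field K for K :: "complex set" +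
  fixes n :: nat and X :: "nat \<Rightarrow> 'a nspace"
  assumes n_pos: "n \<ge> 1" and X_normed: "\<And>i. i < n \<Longrightarrow> normed_space K (X i)"
begin

abbreviation "P \<equiv> prod_carrier n X"
abbreviation "W \<equiv> proj_tensor K n X"
abbreviation "tens \<equiv> tensor K n X"
abbreviation "form \<equiv> multilinear K n X (scalars K)"

definition zero_tuple :: "nat \<Rightarrow> 'a" where
  "zero_tuple = (\<lambda>i\<in>{..<n}. \<zero>\<^bsub>X i\<^esub>)"

text \<open>The whole scalar goes into coordinate 0, which exists as \<open>n \<ge> 1\<close>. Hence
  scalar multiples of elementary tensors are elementary tensors.\<close>

definition scale_tuple :: "complex \<Rightarrow> (nat \<Rightarrow> 'a) \<Rightarrow> nat \<Rightarrow> 'a" where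
  "scale_tuple c x = x(0 := c \<odot>\<^bsub>X 0\<^esub> x 0)"

lemma X_module: "i < n \<Longrightarrow> kmodule K (X i)"
  by (intro normed_space_kmodule X_normed)

lemma P_at: "x \<in> P \<Longrightarrow> i < n \<Longrightarrow> x i \<in> carrier (X i)"
  by (auto simp: prod_carrier_def)

lemma P_upd: "x \<in> P \<Longrightarrow> i < n \<Longrightarrow> y \<in> carrier (X i) \<Longrightarrow> x(i := y) \<in> P"
  by (auto simp: prod_carrier_def PiE_def extensional_def)

lemma zero_tuple_in [simp]: "zero_tuple \<in> P"
  using kmodule.axioms(2)[OF X_module]
  by (auto simp: prod_carrier_def zero_tuple_def intro!: abelian_monoid.zero_closed
      abelian_group.axioms Module.module.axioms)

lemma scale_tuple_in [simp]: "c \<in> K \<Longrightarrow> x \<in> P \<Longrightarrow> scale_tuple c x \<in> P"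
  using n_pos unfolding scale_tuple_def
  by (intro P_upd kmodule.smult_in[OF X_module] P_at) auto

lemma multilinear_in: "multilinear K n X Z T \<Longrightarrow> x \<in> P \<Longrightarrow> T x \<in> carrier Z"
  by (auto simp: multilinear_def)

lemma multilinear_smult:
  assumes "multilinear K n X Z T" "x \<in> P" "i < n" "c \<in> K"
  shows "T (x(i := c \<odot>\<^bsub>X i\<^esub> x i)) = c \<odot>\<^bsub>Z\<^esub> T x"
proof -
  have "linear_map K (X i) Z (\<lambda>y. T (x(i := y)))"
    using assms by (simp add: multilinear_def)
  then have "T (x(i := c \<odot>\<^bsub>X i\<^esub> x i)) = c \<odot>\<^bsub>Z\<^esub> T (x(i := x i))"
    using assms P_at[OF assms(2,3)] unfolding linear_map_def by blast
  then show ?thesis by simp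
qed

lemma multilinear_scale:
  "multilinear K n X Z T \<Longrightarrow> x \<in> P \<Longrightarrow> c \<in> K \<Longrightarrow> T (scale_tuple c x) = c \<odot>\<^bsub>Z\<^esub> T x"
  unfolding scale_tuple_def using n_pos by (intro multilinear_smult) auto

lemma zero_tuple_scale: "scale_tuple 0 zero_tuple = zero_tuple"
  using n_pos P_at[OF zero_tuple_in, of 0] kmodule.smult_0[OF X_module[of 0]]
  by (auto simp: scale_tuple_def zero_tuple_def)

lemma multilinear_zero:
  assumes "kmodule K Z" "multilinear K n X Z T" shows "T zero_tuple = \<zero>\<^bsub>Z\<^esub>"
  using multilinear_scale[OF assms(2) zero_tuple_in, of 0] multilinear_in[OF assms(2) zero_tuple_in]
    kmodule.smult_0[OF assms(1)] by (simp add: zero_tuple_scale)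

lemma multilinear_comp:
  assumes "multilinear K n X Y T" "linear_map K Y Z g"
  shows "multilinear K n X Z (\<lambda>x. g (T x))"
  unfolding multilinear_def
proof (intro conjI ballI allI impI)
  show "(\<lambda>x. g (T x)) \<in> P \<rightarrow> carrier Z"
    using assms by (auto simp: multilinear_def linear_map_def)
  fix x i assume "x \<in> P" "i < n"
  then have "linear_map K (X i) Y (\<lambda>y. T (x(i := y)))"
    using assms(1) by (simp add: multilinear_def)
  then show "linear_map K (X i) Z (\<lambda>y. g (T (x(i := y))))"
    using assms(2) by (auto simp: linear_map_def Pi_iff)
qed

definition pnorm :: "(nat \<Rightarrow> 'a) \<Rightarrow> real" where
  "pnorm x = (\<Prod>i<n. nrm (X i) (x i))"

lemma pnorm_nonneg: "x \<in> P \<Longrightarrow> 0 \<le> pnorm x"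
  unfolding pnorm_def using normed_spaceD(1)[OF X_normed] P_at by (intro prod_nonneg) auto

lemma pnorm_scale:
  assumes "c \<in> K" "x \<in> P" shows "pnorm (scale_tuple c x) = cmod c * pnorm x"
proof -
  have 0: "0 \<in> {..<n}" using n_pos by simp
  have "pnorm (scale_tuple c x) = nrm (X 0) (c \<odot>\<^bsub>X 0\<^esub> x 0) * (\<Prod>i\<in>{..<n} - {0}. nrm (X i) (x i))"
    unfolding pnorm_def by (subst prod.remove[OF _ 0]) (auto simp: scale_tuple_def intro!: prod.cong)
  also have "nrm (X 0) (c \<odot>\<^bsub>X 0\<^esub> x 0) = cmod c * nrm (X 0) (x 0)"
    using normed_spaceD(4)[OF X_normed] assms 0 P_at by auto
  also have "(cmod c * nrm (X 0) (x 0)) * (\<Prod>i\<in>{..<n} - {0}. nrm (X i) (x i)) = cmod c * pnorm x"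
    unfolding pnorm_def by (subst prod.remove[OF _ 0]) auto
  finally show ?thesis .
qed

lemma tens_form [simp]: "form \<phi> \<Longrightarrow> tens x \<phi> = \<phi> x"
  and tens_not_form [simp]: "\<not> form \<phi> \<Longrightarrow> tens x \<phi> = 0"
  by (auto simp: tensor_def)

lemma tens_scale: "c \<in> K \<Longrightarrow> x \<in> P \<Longrightarrow> tens (scale_tuple c x) = (\<lambda>\<phi>. c * tens x \<phi>)"
  by (rule ext) (auto simp: tensor_def multilinear_scale)

lemma tens_zero: "tens zero_tuple = (\<lambda>\<phi>. 0)"
  using multilinear_zero[OF kmodule_scalars] by (auto simp: tensor_def)

lemma W_module: "kmodule K W"
  unfolding proj_tensor_def by (rule kmodule_fun_span)

lemma W_simps [simp]:
  "\<zero>\<^bsub>W\<^esub> = (\<lambda>\<phi>. 0)" "u \<oplus>\<^bsub>W\<^esub> w = (\<lambda>\<phi>. u \<phi> + w \<phi>)" "c \<odot>\<^bsub>W\<^esub> u = (\<lambda>\<phi>. c * u \<phi>)"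
  "nrm W = proj_norm K n X"
  by (simp_all add: proj_tensor_def)

lemma W_minus [simp]: "u \<in> carrier W \<Longrightarrow> w \<in> carrier W \<Longrightarrow> u \<ominus>\<^bsub>W\<^esub> w = (\<lambda>\<phi>. u \<phi> - w \<phi>)"
  by (simp add: proj_tensor_def)

lemma tens_segre [simp]: "x \<in> P \<Longrightarrow> tens x \<in> segre K n X"
  by (simp add: segre_def)

lemma segre_W: "p \<in> segre K n X \<Longrightarrow> p \<in> carrier W"
  unfolding proj_tensor_def by (rule fun_span_base)

lemma tens_W [simp]: "x \<in> P \<Longrightarrow> tens x \<in> carrier W"
  by (simp add: segre_W)

lemma W_closed [simp]:
  "(\<lambda>\<phi>. 0) \<in> carrier W"
  "u \<in> carrier W \<Longrightarrow> w \<in> carrier W \<Longrightarrow> (\<lambda>\<phi>. u \<phi> + w \<phi>) \<in> carrier W"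
  "c \<in> K \<Longrightarrow> u \<in> carrier W \<Longrightarrow> (\<lambda>\<phi>. c * u \<phi>) \<in> carrier W"
  by (simp_all add: proj_tensor_def fun_span_zero fun_span_add fun_span_smult)

lemma W_closed_minus [simp]:
  "u \<in> carrier W \<Longrightarrow> w \<in> carrier W \<Longrightarrow> (\<lambda>\<phi>. u \<phi> - w \<phi>) \<in> carrier W"
  using kmodule.minus_in[OF W_module] by simp

text \<open>Coefficients of a linear combination are absorbed into the tuples by
  \<open>scale_tuple\<close>, so a step adds a bare elementary tensor.\<close>

lemma W_induct [consumes 1, case_names zero step]:
  assumes "u \<in> carrier W" "Q (\<lambda>\<phi>. 0)"
    and step: "\<And>x u. x \<in> P \<Longrightarrow> u \<in> carrier W \<Longrightarrow> Q u \<Longrightarrow> Q (\<lambda>\<phi>. u \<phi> + tens x \<phi>)"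
  shows "Q u"
  using assms(1) unfolding proj_tensor_def
proof (induction rule: fun_span_induct)
  case (step c s u)
  then obtain x where x: "x \<in> P" "s = tens x" by (auto simp: segre_def)
  have "u \<in> carrier W" using step by (simp add: proj_tensor_def)
  then have "Q (\<lambda>\<phi>. u \<phi> + tens (scale_tuple c x) \<phi>)" using assms(3) x step by simp
  then show ?case using x step by (simp add: tens_scale)
qed (rule assms(2))

lemma W_repr:
  assumes "u \<in> carrier W"
  obtains m and x :: "nat \<Rightarrow> nat \<Rightarrow> 'a" where "\<forall>j<m. x j \<in> P" "u = (\<lambda>\<phi>. \<Sum>j<m. tens (x j) \<phi>)"
proof -
  have "\<exists>(m::nat) x. (\<forall>j<m. x j \<in> P) \<and> u = (\<lambda>\<phi>. \<Sum>j<m. tens (x j) \<phi>)"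
    using assms
  proof (induction rule: W_induct)
    case zero
    show ?case by (rule exI[of _ 0]) simp
  next
    case (step y u)
    then obtain m x where "\<forall>j<m. x j \<in> P" "u = (\<lambda>\<phi>. \<Sum>j<m::nat. tens (x j) \<phi>)" by blast
    then show ?case
      using step by (intro exI[of _ "Suc m"] exI[of _ "x(m := y)"]) (auto simp: less_Suc_eq)
  qed
  then show thesis using that by blast
qed

text \<open>Elements of the tensor product are sums of evaluations at tuples in \<open>P\<close>,
  hence linear in the form. Forms are not extensional, so the linear relation between them is
  required on \<open>P\<close> only.\<close>

lemma W_linear:
  assumes "w \<in> carrier W" "form \<phi>" "form \<psi>" "form \<omega>"
    and eq: "\<And>x. x \<in> P \<Longrightarrow> \<omega> x = a * \<phi> x + b * \<psi> x"
  shows "w \<omega> = a * w \<phi> + b * w \<psi>"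
  using assms(1) by (induction rule: W_induct) (simp_all add: assms algebra_simps)

lemma W_value:
  assumes "w \<in> carrier W" "form \<phi>" shows "w \<phi> \<in> K"
  using assms(1) by (induction rule: W_induct) (use multilinear_in[OF assms(2)] assms(2) in auto)

lemma multilinear_tens: "multilinear K n X W tens"
  unfolding multilinear_def linear_map_def
proof (intro conjI ballI allI impI)
  fix x i assume x: "x \<in> P" "i < n"
  show "(\<lambda>y. tens (x(i := y))) \<in> carrier (X i) \<rightarrow> carrier W" using x P_upd by auto
  have lin: "linear_map K (X i) (scalars K) (\<lambda>y. \<phi> (x(i := y)))" if "form \<phi>" for \<phi>
    using that x by (simp add: multilinear_def)
  show "tens (x(i := y \<oplus>\<^bsub>X i\<^esub> z)) = tens (x(i := y)) \<oplus>\<^bsub>W\<^esub> tens (x(i := z))"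
    if "y \<in> carrier (X i)" "z \<in> carrier (X i)" for y z
    using lin that by (auto simp: tensor_def linear_map_def)
  show "tens (x(i := c \<odot>\<^bsub>X i\<^esub> y)) = c \<odot>\<^bsub>W\<^esub> tens (x(i := y))"
    if "c \<in> K" "y \<in> carrier (X i)" for c y
    using lin that by (auto simp: tensor_def linear_map_def)
qed auto

abbreviation "\<pi> \<equiv> proj_norm K n X"

lemma proj_norm_lower:
  assumes "\<forall>j<m. x j \<in> P" "u = (\<lambda>\<phi>. \<Sum>j<m. tens (x j) \<phi>)"
  shows "\<pi> u \<le> (\<Sum>j<m::nat. pnorm (x j))"
  unfolding proj_norm_def
proof (rule cInf_lower)
  show "bdd_below {\<Sum>j<m. \<Prod>i<n. nrm (X i) (x j i) |(m::nat) x.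
            (\<forall>j<m. x j \<in> P) \<and> u = (\<lambda>\<phi>. \<Sum>j<m. tens (x j) \<phi>)}"
    using pnorm_nonneg by (intro bdd_belowI[of _ 0]) (auto simp: pnorm_def[symmetric] intro!: sum_nonneg)
qed (use assms in \<open>auto simp: pnorm_def\<close>)

lemma proj_norm_greatest:
  assumes "u \<in> carrier W"
    and "\<And>m x. \<forall>j<m. x j \<in> P \<Longrightarrow> u = (\<lambda>\<phi>. \<Sum>j<m. tens (x j) \<phi>) \<Longrightarrow> r \<le> (\<Sum>j<m::nat. pnorm (x j))"
  shows "r \<le> \<pi> u"
  unfolding proj_norm_def
proof (rule cInf_greatest)
  show "{\<Sum>j<m. \<Prod>i<n. nrm (X i) (x j i) |(m::nat) x.
            (\<forall>j<m. x j \<in> P) \<and> u = (\<lambda>\<phi>. \<Sum>j<m. tens (x j) \<phi>)} \<noteq> {}"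
    using W_repr[OF assms(1)] by (auto, metis)
qed (use assms(2) in \<open>auto simp: pnorm_def\<close>)

lemma proj_norm_nonneg: "u \<in> carrier W \<Longrightarrow> 0 \<le> \<pi> u"
  using pnorm_nonneg by (intro proj_norm_greatest) (auto intro!: sum_nonneg)

lemma proj_norm_tens: "x \<in> P \<Longrightarrow> \<pi> (tens x) \<le> pnorm x"
  using proj_norm_lower[of 1 "\<lambda>_. x"] by simp

lemma proj_norm_zero: "\<pi> (\<lambda>\<phi>. 0) = 0"
  using proj_norm_lower[of 0] proj_norm_nonneg[of "\<lambda>\<phi>. 0"] by simp

lemma proj_norm_scale_le:
  assumes "u \<in> carrier W" "r > 0"
  shows "\<pi> (\<lambda>\<phi>. complex_of_real r * u \<phi>) \<le> r * \<pi> u"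
proof -
  have "\<pi> (\<lambda>\<phi>. complex_of_real r * u \<phi>) / r \<le> \<pi> u"
  proof (rule proj_norm_greatest[OF assms(1)])
    fix m :: nat and x assume x: "\<forall>j<m. x j \<in> P" "u = (\<lambda>\<phi>. \<Sum>j<m. tens (x j) \<phi>)"
    have "\<pi> (\<lambda>\<phi>. complex_of_real r * u \<phi>)
        \<le> (\<Sum>j<m. pnorm (scale_tuple (complex_of_real r) (x j)))"
      using x by (intro proj_norm_lower) (auto simp: tens_scale sum_distrib_left)
    also have "\<dots> = r * (\<Sum>j<m. pnorm (x j))"
      using x assms(2) by (simp add: pnorm_scale sum_distrib_left)
    finally show "\<pi> (\<lambda>\<phi>. complex_of_real r * u \<phi>) / r \<le> (\<Sum>j<m. pnorm (x j))"
      using assms(2) by (simp add: field_simps)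
  qed
  then show ?thesis using assms(2) by (simp add: field_simps)
qed

lemma proj_norm_scale:
  assumes "u \<in> carrier W" "r > 0"
  shows "\<pi> (\<lambda>\<phi>. complex_of_real r * u \<phi>) = r * \<pi> u"
proof (rule antisym)
  have "\<pi> (\<lambda>\<phi>. complex_of_real (1 / r) * (complex_of_real r * u \<phi>))
      \<le> 1 / r * \<pi> (\<lambda>\<phi>. complex_of_real r * u \<phi>)"
    using assms by (intro proj_norm_scale_le) auto
  moreover have "(\<lambda>\<phi>. complex_of_real (1 / r) * (complex_of_real r * u \<phi>)) = u"
    using assms by auto
  ultimately show "r * \<pi> u \<le> \<pi> (\<lambda>\<phi>. complex_of_real r * u \<phi>)"
    using assms by (simp add: field_simps)
qed (rule proj_norm_scale_le[OF assms])

end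

section \<open>The gauge gamma on the tensor product with a normed space\<close>

locale gamma_setting = tensor_setting K n X for K n and X :: "nat \<Rightarrow> 'a nspace" +
  fixes V :: "'v nspace"
  assumes V_normed: "normed_space K V"
begin

abbreviation "tv \<equiv> tensor_vec K n X V"
abbreviation "G \<equiv> gamma_tensor K n X V"
abbreviation "ten2 \<equiv> tensor2 K W V"

sublocale V: gauged_module K V by (rule normed_space_gauged[OF V_normed])

lemma G_simps [simp]:
  "\<zero>\<^bsub>G\<^esub> = (\<lambda>\<beta>. 0)" "u \<oplus>\<^bsub>G\<^esub> w = (\<lambda>\<beta>. u \<beta> + w \<beta>)" "c \<odot>\<^bsub>G\<^esub> u = (\<lambda>\<beta>. c * u \<beta>)"
  "nrm G = gamma K n X V"
  by (simp_all add: gamma_tensor_def Let_def)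

lemma G_module: "kmodule K G"
  by (simp add: gamma_tensor_def Let_def kmodule_fun_span)

lemma ten2_form: "bilinear_form K W V \<beta> \<Longrightarrow> ten2 w v \<beta> = \<beta> w v"
  by (simp add: tensor2_def)

lemma bilinear_formD:
  assumes "bilinear_form K W V \<beta>"
  shows "w \<in> carrier W \<Longrightarrow> w' \<in> carrier W \<Longrightarrow> v \<in> carrier V \<Longrightarrow> \<beta> (\<lambda>\<phi>. w \<phi> + w' \<phi>) v = \<beta> w v + \<beta> w' v"
    "c \<in> K \<Longrightarrow> w \<in> carrier W \<Longrightarrow> v \<in> carrier V \<Longrightarrow> \<beta> (\<lambda>\<phi>. c * w \<phi>) v = c * \<beta> w v"
    "w \<in> carrier W \<Longrightarrow> w' \<in> carrier W \<Longrightarrow> v \<in> carrier V \<Longrightarrow> \<beta> (\<lambda>\<phi>. w \<phi> - w' \<phi>) v = \<beta> w v - \<beta> w' v"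
    "w \<in> carrier W \<Longrightarrow> c \<in> K \<Longrightarrow> v \<in> carrier V \<Longrightarrow> \<beta> w (c \<odot>\<^bsub>V\<^esub> v) = c * \<beta> w v"
    "w \<in> carrier W \<Longrightarrow> v \<in> carrier V \<Longrightarrow> \<beta> w v \<in> K"
    "v \<in> carrier V \<Longrightarrow> \<beta> (\<lambda>\<phi>. 0) v = 0"
proof -
  have l: "linear_map K W (scalars K) (\<lambda>w. \<beta> w v)" if "v \<in> carrier V" for v
    using assms that by (simp add: bilinear_form_def)
  show "\<beta> (\<lambda>\<phi>. w \<phi> + w' \<phi>) v = \<beta> w v + \<beta> w' v" if "w \<in> carrier W" "w' \<in> carrier W" "v \<in> carrier V"
    using l[OF that(3)] that by (auto simp: linear_map_def)
  show "\<beta> (\<lambda>\<phi>. c * w \<phi>) v = c * \<beta> w v" if "c \<in> K" "w \<in> carrier W" "v \<in> carrier V"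
    using l[OF that(3)] that by (auto simp: linear_map_def)
  show K: "\<beta> w v \<in> K" if "w \<in> carrier W" "v \<in> carrier V" for w
    using l[OF that(2)] that by (auto simp: linear_map_def)
  show "\<beta> (\<lambda>\<phi>. w \<phi> - w' \<phi>) v = \<beta> w v - \<beta> w' v" if "w \<in> carrier W" "w' \<in> carrier W" "v \<in> carrier V"
    using kmodule.linear_map_minus[OF W_module kmodule_scalars l[OF that(3)] that(1,2)] that K by simp
  show "\<beta> (\<lambda>\<phi>. 0) v = 0" if "v \<in> carrier V"
    using kmodule.linear_map_zero[OF W_module kmodule_scalars l[OF that]] by simp
  show "\<beta> w (c \<odot>\<^bsub>V\<^esub> v) = c * \<beta> w v" if "w \<in> carrier W" "c \<in> K" "v \<in> carrier V"
    using assms that by (auto simp: bilinear_form_def linear_map_def)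
qed

lemma ten2_minus:
  "w \<in> carrier W \<Longrightarrow> w' \<in> carrier W \<Longrightarrow> v \<in> carrier V \<Longrightarrow>
    ten2 (\<lambda>\<phi>. w \<phi> - w' \<phi>) v = (\<lambda>\<beta>. ten2 w v \<beta> - ten2 w' v \<beta>)"
  by (rule ext) (auto simp: tensor2_def bilinear_formD)

lemma ten2_smult:
  "w \<in> carrier W \<Longrightarrow> c \<in> K \<Longrightarrow> v \<in> carrier V \<Longrightarrow> ten2 w (c \<odot>\<^bsub>V\<^esub> v) = (\<lambda>\<beta>. c * ten2 w v \<beta>)"
  by (rule ext) (auto simp: tensor2_def bilinear_formD)

lemma ten2_G [simp]: "w \<in> carrier W \<Longrightarrow> v \<in> carrier V \<Longrightarrow> ten2 w v \<in> carrier G"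
  unfolding gamma_tensor_def Let_def by (rule fun_span_base) auto

lemma tv_G [simp]: "x \<in> P \<Longrightarrow> v \<in> carrier V \<Longrightarrow> tv x v \<in> carrier G"
  unfolding tensor_vec_def by simp

lemma G_closed:
  "(\<lambda>\<beta>. 0) \<in> carrier G"
  "u \<in> carrier G \<Longrightarrow> w \<in> carrier G \<Longrightarrow> (\<lambda>\<beta>. u \<beta> + w \<beta>) \<in> carrier G"
  "c \<in> K \<Longrightarrow> u \<in> carrier G \<Longrightarrow> (\<lambda>\<beta>. c * u \<beta>) \<in> carrier G"
  by (simp_all add: gamma_tensor_def Let_def fun_span_zero fun_span_add fun_span_smult)

text \<open>The coefficient of a generator moves into its vector, and an inner induction splits its
  first factor into elementary tensors. Membership in the carrier is carried through
  \<open>aux\<close>, because each inner step applies the hypothesis to an intermediate sum.\<close>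

lemma G_induct [consumes 1, case_names zero step]:
  assumes "u \<in> carrier G" "Q (\<lambda>\<beta>. 0)"
    and step: "\<And>x v u. x \<in> P \<Longrightarrow> v \<in> carrier V \<Longrightarrow> u \<in> carrier G \<Longrightarrow> Q u \<Longrightarrow> Q (\<lambda>\<beta>. u \<beta> + tv x v \<beta>)"
  shows "Q u"
proof -
  have aux: "(\<lambda>\<beta>. u \<beta> + ten2 w v \<beta>) \<in> carrier G \<and> Q (\<lambda>\<beta>. u \<beta> + ten2 w v \<beta>)"
    if w: "w \<in> carrier W" and v: "v \<in> carrier V" and u: "u \<in> carrier G" "Q u" for w v u
    using w
  proof (induction rule: W_induct)
    case zero
    have "ten2 (\<lambda>\<phi>. 0) v = (\<lambda>\<beta>. 0)" using v by (auto simp: tensor2_def bilinear_formD)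
    then show ?case using u by simp
  next
    case (step x w)
    have "ten2 (\<lambda>\<phi>. w \<phi> + tens x \<phi>) v = (\<lambda>\<beta>. ten2 w v \<beta> + tv x v \<beta>)"
      using step v by (auto simp: tensor2_def bilinear_formD tensor_vec_def)
    moreover have "Q (\<lambda>\<beta>. (u \<beta> + ten2 w v \<beta>) + tv x v \<beta>)"
      using assms(3)[of x v "\<lambda>\<beta>. u \<beta> + ten2 w v \<beta>"] step v by simp
    moreover have "(\<lambda>\<beta>. (u \<beta> + ten2 w v \<beta>) + tv x v \<beta>) \<in> carrier G"
      using step v u by (intro G_closed) auto
    ultimately show ?case by (simp add: add.assoc)
  qed
  show ?thesis
    using assms(1) unfolding gamma_tensor_def Let_def
  proof (induction rule: fun_span_induct)
    case (step c s u)
    then obtain w v where s: "w \<in> carrier W" "v \<in> carrier V" "s = ten2 w v" by auto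
    have "u \<in> carrier G" using step by (simp add: gamma_tensor_def Let_def)
    then have "Q (\<lambda>\<beta>. u \<beta> + ten2 w (c \<odot>\<^bsub>V\<^esub> v) \<beta>)" using aux step s by auto
    then show ?case using s step by (simp add: ten2_smult)
  qed (rule assms(2))
qed

definition gamma_repr where
  "gamma_repr u m p q v a b \<longleftrightarrow>
     (\<forall>i<m. p i \<in> segre K n X \<and> q i \<in> segre K n X \<and> v i \<in> carrier V \<and> a i \<in> segre K n X \<and> b i \<in> segre K n X) \<and>
     u = (\<lambda>\<beta>. \<Sum>i<m. ten2 (p i \<ominus>\<^bsub>W\<^esub> q i) (v i) \<beta>) \<and> pairs_le K n X m p q m a b"

definition gamma_cost where
  "gamma_cost m v a b = sqrt (\<Sum>i<m. (\<pi> (a i \<ominus>\<^bsub>W\<^esub> b i))\<^sup>2) * sqrt (\<Sum>i<m::nat. (nrm V (v i))\<^sup>2)"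

lemma gamma_alt: "gamma K n X V u = Inf {gamma_cost m v a b |m p q v a b. gamma_repr u m p q v a b}"
  by (simp add: gamma_def Let_def gamma_repr_def gamma_cost_def)

lemma gamma_cost_nonneg: "0 \<le> gamma_cost m v a b"
  by (simp add: gamma_cost_def sum_nonneg)

lemma gamma_lower: "gamma_repr u m p q v a b \<Longrightarrow> gamma K n X V u \<le> gamma_cost m v a b"
  unfolding gamma_alt by (intro cInf_lower bdd_belowI[of _ 0]) (use gamma_cost_nonneg in blast)+

lemma gamma_repr_exists:
  assumes "u \<in> carrier G" shows "\<exists>m p q v a b. gamma_repr u m p q v a b"
proof -
  have "\<exists>m p v. (\<forall>i<m. p i \<in> segre K n X \<and> v i \<in> carrier V) \<and> u = (\<lambda>\<beta>. \<Sum>i<m::nat. ten2 (p i) (v i) \<beta>)"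
    using assms
  proof (induction rule: G_induct)
    case zero
    show ?case by (rule exI[of _ 0]) simp
  next
    case (step x y u)
    then obtain m p v where "\<forall>i<m. p i \<in> segre K n X \<and> v i \<in> carrier V"
      "u = (\<lambda>\<beta>. \<Sum>i<m::nat. ten2 (p i) (v i) \<beta>)" by blast
    then show ?case
      using step by (intro exI[of _ "Suc m"] exI[of _ "p(m := tens x)"] exI[of _ "v(m := y)"])
        (auto simp: less_Suc_eq tensor_vec_def)
  qed
  then obtain m p v where pv: "\<And>i. i < m \<Longrightarrow> p i \<in> segre K n X" "\<And>i. i < m \<Longrightarrow> v i \<in> carrier V"
    "u = (\<lambda>\<beta>. \<Sum>i<m::nat. ten2 (p i) (v i) \<beta>)" by blast
  have "p i \<ominus>\<^bsub>W\<^esub> tens zero_tuple = p i" if "i < m" for i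
    using pv(1)[OF that] by (simp add: segre_W tens_zero)
  \<comment> \<open>The zero tensor is elementary, so it can serve as second member of every pair.
    Comparing the pairs with themselves satisfies \<open>pairs_le\<close> with equality.\<close>
  then have "gamma_repr u m p (\<lambda>_. tens zero_tuple) v p (\<lambda>_. tens zero_tuple)"
    unfolding gamma_repr_def using pv by (simp add: pairs_le_def)
  then show ?thesis by blast
qed

lemma gamma_greatest:
  assumes "u \<in> carrier G" "\<And>m p q v a b. gamma_repr u m p q v a b \<Longrightarrow> r \<le> gamma_cost m v a b"
  shows "r \<le> gamma K n X V u"
  unfolding gamma_alt using gamma_repr_exists[OF assms(1)] assms(2) by (intro cInf_greatest) auto

text \<open>The factor is put on the vectors \<open>v i\<close> alone, so the pairs and the relation
  between them stay as they are.\<close>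

lemma gamma_scale_le:
  assumes "u \<in> carrier G" "r > 0"
  shows "gamma K n X V (\<lambda>\<beta>. complex_of_real r * u \<beta>) \<le> r * gamma K n X V u"
proof -
  have "gamma K n X V (\<lambda>\<beta>. complex_of_real r * u \<beta>) / r \<le> gamma K n X V u"
  proof (rule gamma_greatest[OF assms(1)])
    fix m p q v a b assume g: "gamma_repr u m p q v a b"
    let ?v = "\<lambda>i. complex_of_real r \<odot>\<^bsub>V\<^esub> v i"
    have "gamma_repr (\<lambda>\<beta>. complex_of_real r * u \<beta>) m p q ?v a b"
      using g unfolding gamma_repr_def
      by (auto simp: sum_distrib_left segre_W ten2_smult)
    then have "gamma K n X V (\<lambda>\<beta>. complex_of_real r * u \<beta>) \<le> gamma_cost m ?v a b"
      by (rule gamma_lower)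
    also have "(\<Sum>i<m. (nrm V (?v i))\<^sup>2) = r\<^sup>2 * (\<Sum>i<m. (nrm V (v i))\<^sup>2)"
      using g assms(2) by (simp add: gamma_repr_def V.nrm_scale sum_distrib_left power_mult_distrib)
    then have "gamma_cost m ?v a b = r * gamma_cost m v a b"
      using assms(2) by (simp add: gamma_cost_def real_sqrt_mult)
    finally show "gamma K n X V (\<lambda>\<beta>. complex_of_real r * u \<beta>) / r \<le> gamma_cost m v a b"
      using assms(2) by (simp add: field_simps)
  qed
  then show ?thesis using assms(2) by (simp add: field_simps)
qed

sublocale G: gauged_module K G
proof (intro gauged_module.intro G_module gauged_module_axioms.intro)
  show "0 \<le> nrm G u" if "u \<in> carrier G" for u
    using that gamma_cost_nonneg by (simp add: gamma_greatest)
  fix r :: real and u assume r: "r > 0" and u: "u \<in> carrier G"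
  have "gamma K n X V (\<lambda>\<beta>. complex_of_real (1 / r) * (complex_of_real r * u \<beta>))
      \<le> 1 / r * gamma K n X V (\<lambda>\<beta>. complex_of_real r * u \<beta>)"
    using r u by (intro gamma_scale_le G_closed) auto
  moreover have "(\<lambda>\<beta>. complex_of_real (1 / r) * (complex_of_real r * u \<beta>)) = u"
    using r by auto
  ultimately have "r * gamma K n X V u \<le> gamma K n X V (\<lambda>\<beta>. complex_of_real r * u \<beta>)"
    using r by (simp add: field_simps)
  then show "nrm G (complex_of_real r \<odot>\<^bsub>G\<^esub> u) = r * nrm G u"
    using gamma_scale_le[OF u r] by simp
qed

lemma G_dual_eqI:
  assumes "\<zeta> \<in> carrier (dual_space K G)" "\<xi> \<in> carrier (dual_space K G)"
    and "\<And>x v. x \<in> P \<Longrightarrow> v \<in> carrier V \<Longrightarrow> \<zeta> (tv x v) = \<xi> (tv x v)"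
  shows "\<zeta> = \<xi>"
proof (rule extensionalityI)
  show "\<zeta> \<in> extensional (carrier G)" "\<xi> \<in> extensional (carrier G)"
    using assms G.dualD(1) by auto
  fix u assume "u \<in> carrier G"
  then show "\<zeta> u = \<xi> u"
  proof (induction rule: G_induct)
    case zero
    show ?case using G.dualD(8)[OF assms(1)] G.dualD(8)[OF assms(2)] by simp
  next
    case (step x v u)
    then show ?case
      using G.dualD(4)[OF assms(1), of u "tv x v"] G.dualD(4)[OF assms(2), of u "tv x v"] assms(3)
      by simp
  qed
qed

end

section \<open>Inner products and bounded multilinear maps\<close>

locale hilbert_setting = scalar_field K for K +
  fixes H :: "'h nspace" (structure) and ip :: "'h \<Rightarrow> 'h \<Rightarrow> complex"
  assumes H_normed: "normed_space K H" and ip: "inner_product K H ip"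
begin

sublocale gauged_module K H by (rule normed_space_gauged[OF H_normed])

lemma ip_rules:
  "x \<in> carrier H \<Longrightarrow> y \<in> carrier H \<Longrightarrow> ip x y \<in> K"
  "x \<in> carrier H \<Longrightarrow> y \<in> carrier H \<Longrightarrow> cnj (ip y x) = ip x y"
  "x \<in> carrier H \<Longrightarrow> y \<in> carrier H \<Longrightarrow> z \<in> carrier H \<Longrightarrow> ip (x \<oplus> y) z = ip x z + ip y z"
  "c \<in> K \<Longrightarrow> x \<in> carrier H \<Longrightarrow> y \<in> carrier H \<Longrightarrow> ip (c \<odot> x) y = c * ip x y"
  "x \<in> carrier H \<Longrightarrow> ip x x = complex_of_real ((nrm H x)\<^sup>2)"
  using ip unfolding inner_product_def by (blast, metis, blast, blast, blast)

lemma ip_minus: "x \<in> carrier H \<Longrightarrow> y \<in> carrier H \<Longrightarrow> z \<in> carrier H \<Longrightarrow>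
    ip (x \<ominus> y) z = ip x z - ip y z"
  by (simp add: minus_eq ip_rules)

lemma ip_smult_right: "c \<in> K \<Longrightarrow> x \<in> carrier H \<Longrightarrow> y \<in> carrier H \<Longrightarrow>
    ip y (c \<odot> x) = cnj c * ip y x"
  using ip_rules(4)[of c x y] ip_rules(2)[of y "c \<odot> x"] ip_rules(2)[of y x]
  by (metis complex_cnj_mult smult_in)

lemma ip_minus_right: "x \<in> carrier H \<Longrightarrow> y \<in> carrier H \<Longrightarrow> z \<in> carrier H \<Longrightarrow>
    ip z (x \<ominus> y) = ip z x - ip z y"
  using ip_minus[of x y z] ip_rules(2)[of z "x \<ominus> y"] ip_rules(2)[of z x] ip_rules(2)[of z y]
  by (metis complex_cnj_diff minus_in)

lemma linear_ip: "h \<in> carrier H \<Longrightarrow> linear_map K H (scalars K) (\<lambda>x. ip x h)"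
  by (auto simp: linear_map_def ip_rules)

text \<open>For a unit vector \<open>u\<close> this is the orthogonal projection onto the complement
  of \<open>u\<close>.\<close>

definition proj_away :: "'h \<Rightarrow> 'h \<Rightarrow> 'h" where
  "proj_away u x = x \<ominus> (ip x u \<odot> u)"

lemma proj_away_in: "u \<in> carrier H \<Longrightarrow> x \<in> carrier H \<Longrightarrow> proj_away u x \<in> carrier H"
  by (simp add: proj_away_def ip_rules)

lemma ip_proj_away:
  assumes "u \<in> carrier H" "x \<in> carrier H" "y \<in> carrier H"
  shows "ip (proj_away u x) y = ip x (proj_away u y)"
  using assms ip_rules(2)[of u y]
  by (simp add: proj_away_def ip_minus ip_minus_right ip_rules(1,4) ip_smult_right)

text \<open>Pythagoras for the component of \<open>x\<close> along \<open>u\<close> and the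
  remainder.\<close>

lemma nrm_proj_away:
  assumes u: "u \<in> carrier H" and x: "x \<in> carrier H" and unit: "nrm H u = 1"
  shows "(nrm H x)\<^sup>2 = (cmod (ip x u))\<^sup>2 + (nrm H (proj_away u x))\<^sup>2"
proof -
  have uu: "ip u u = 1" using ip_rules(5)[OF u] unit by simp
  have "complex_of_real ((nrm H (proj_away u x))\<^sup>2) = ip (proj_away u x) (proj_away u x)"
    using proj_away_in u x ip_rules by simp
  also have "\<dots> = ip x x - ip x u * cnj (ip x u)"
    using u x by (simp add: proj_away_def ip_minus ip_minus_right ip_rules(1,3,4) ip_smult_right uu
        ip_rules(2)[OF u x] algebra_simps)
  also have "\<dots> = complex_of_real ((nrm H x)\<^sup>2 - (cmod (ip x u))\<^sup>2)"
    using ip_rules(5)[OF x] by (simp only: of_real_diff complex_norm_square)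
  finally show ?thesis by (simp only: of_real_eq_iff)
qed

text \<open>Projecting off the direction of the first vector preserves the hypothesis and kills that
  vector, so no orthonormal basis is needed.\<close>

lemma sum_nrm_mono:
  assumes "set ds \<subseteq> carrier H" "set es \<subseteq> carrier H"
    and "\<And>h. h \<in> carrier H \<Longrightarrow> (\<Sum>d\<leftarrow>ds. (cmod (ip d h))\<^sup>2) \<le> (\<Sum>e\<leftarrow>es. (cmod (ip e h))\<^sup>2)"
  shows "(\<Sum>d\<leftarrow>ds. (nrm H d)\<^sup>2) \<le> (\<Sum>e\<leftarrow>es. (nrm H e)\<^sup>2)"
  using assms
proof (induction "length ds" arbitrary: ds es)
  case 0
  then show ?case by (auto intro!: sum_list_nonneg)
next
  case (Suc k)
  from Suc.hyps(2) obtain d xs where eq: "ds = d # xs" and len: "k = length xs" by (cases ds) auto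
  note prems = Suc.prems[unfolded eq]
  have d: "d \<in> carrier H" and xs: "set xs \<subseteq> carrier H" using prems by auto
  have "(\<Sum>d\<leftarrow>d # xs. (nrm H d)\<^sup>2) \<le> (\<Sum>e\<leftarrow>es. (nrm H e)\<^sup>2)"
  proof (cases "nrm H d = 0")
    case True
    have "(\<Sum>d\<leftarrow>xs. (nrm H d)\<^sup>2) \<le> (\<Sum>e\<leftarrow>es. (nrm H e)\<^sup>2)"
    proof (rule Suc.hyps(1)[OF len xs prems(2)])
      fix h assume "h \<in> carrier H"
      show "(\<Sum>d\<leftarrow>xs. (cmod (ip d h))\<^sup>2) \<le> (\<Sum>e\<leftarrow>es. (cmod (ip e h))\<^sup>2)"
        using prems(3)[OF \<open>h \<in> carrier H\<close>] zero_le_power2[of "cmod (ip d h)"]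
        unfolding list.map sum_list.Cons by linarith
    qed
    then show ?thesis using True by simp
  next
    case False
    then have pos: "nrm H d > 0" using nrm_nonneg[OF d] by simp
    define u where "u = of_real (1 / nrm H d) \<odot> d"
    have u: "u \<in> carrier H" unfolding u_def by (rule smult_in[OF K_closed(3) d])
    have unit: "nrm H u = 1" unfolding u_def using nrm_scale[of "1 / nrm H d" d] pos d by simp
    have "ip d u = complex_of_real (nrm H d)"
      unfolding u_def using ip_smult_right[OF K_closed(3) d d, of "1 / nrm H d"] ip_rules(5)[OF d] pos
      by (simp add: power2_eq_square)
    then have "(nrm H (proj_away u d))\<^sup>2 = 0" using nrm_proj_away[OF u d unit] pos by simp
    have split: "(\<Sum>d\<leftarrow>ys. (nrm H d)\<^sup>2) =
        (\<Sum>d\<leftarrow>ys. (cmod (ip d u))\<^sup>2) + (\<Sum>d\<leftarrow>map (proj_away u) ys. (nrm H d)\<^sup>2)"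
      if "set ys \<subseteq> carrier H" for ys
      using that by (induction ys) (simp_all add: nrm_proj_away[OF u _ unit])
    \<comment> \<open>Self-adjointness moves the projection from the family to the test vector, so
      the hypothesis at \<open>proj_away u h\<close> becomes the hypothesis for the projected
      families at \<open>h\<close>.\<close>
    have ipp: "(\<Sum>d\<leftarrow>map (proj_away u) ys. (cmod (ip d h))\<^sup>2) = (\<Sum>d\<leftarrow>ys. (cmod (ip d (proj_away u h)))\<^sup>2)"
      if "set ys \<subseteq> carrier H" "h \<in> carrier H" for ys h
      using that by (induction ys) (simp_all add: ip_proj_away[OF u])
    have sub: "set (map (proj_away u) ys) \<subseteq> carrier H" if "set ys \<subseteq> carrier H" for ys
      using that proj_away_in[OF u] by auto
    have "(\<Sum>d\<leftarrow>map (proj_away u) xs. (nrm H d)\<^sup>2) \<le> (\<Sum>e\<leftarrow>map (proj_away u) es. (nrm H e)\<^sup>2)"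
    proof (rule Suc.hyps(1)[OF _ sub[OF xs] sub[OF prems(2)]])
      fix h assume h: "h \<in> carrier H"
      have "(\<Sum>d\<leftarrow>xs. (cmod (ip d (proj_away u h)))\<^sup>2) \<le> (\<Sum>d\<leftarrow>d # xs. (cmod (ip d (proj_away u h)))\<^sup>2)"
        by simp
      also have "\<dots> \<le> (\<Sum>e\<leftarrow>es. (cmod (ip e (proj_away u h)))\<^sup>2)"
        by (rule prems(3)[OF proj_away_in[OF u h]])
      finally show "(\<Sum>d\<leftarrow>map (proj_away u) xs. (cmod (ip d h))\<^sup>2)
          \<le> (\<Sum>e\<leftarrow>map (proj_away u) es. (cmod (ip e h))\<^sup>2)"
        unfolding ipp[OF xs h] ipp[OF prems(2) h] .
    qed (simp add: len)
    \<comment> \<open>The components along \<open>u\<close> are compared by the hypothesis at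
      \<open>h = u\<close>, the remainders by induction; the remainder of \<open>d\<close> is 0,
      which is why one vector fewer is left.\<close>
    then show ?thesis
      using split[OF prems(1)] split[OF prems(2)] prems(3)[OF u]
        \<open>(nrm H (proj_away u d))\<^sup>2 = 0\<close> by simp
  qed
  then show ?case by (simp only: eq)
qed

end

section \<open>Norms of bounded multilinear maps\<close>

context tensor_setting begin

lemma zero_tuple_nrm: "i < n \<Longrightarrow> nrm (X i) (zero_tuple i) = 0"
  using gauged_module.nrm_zero[OF normed_space_gauged[OF X_normed]] by (simp add: zero_tuple_def)

lemma pnorm_le_1: "x \<in> P \<Longrightarrow> \<forall>i<n. nrm (X i) (x i) \<le> 1 \<Longrightarrow> pnorm x \<le> 1"
  unfolding pnorm_def using P_at normed_spaceD(1)[OF X_normed] by (intro prod_le_1) auto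

lemma multilinear_bdd:
  assumes "bounded_multilinear K n X Z A"
  shows "bdd_above {nrm Z (A x) |x. x \<in> P \<and> (\<forall>i<n. nrm (X i) (x i) \<le> 1)}"
proof -
  obtain C where C: "\<And>x. x \<in> P \<Longrightarrow> nrm Z (A x) \<le> C * pnorm x"
    using assms by (auto simp: bounded_multilinear_def pnorm_def)
  show ?thesis
  proof (rule bdd_aboveI)
    fix r assume "r \<in> {nrm Z (A x) |x. x \<in> P \<and> (\<forall>i<n. nrm (X i) (x i) \<le> 1)}"
    then obtain y where y: "r = nrm Z (A y)" "y \<in> P" "\<forall>i<n. nrm (X i) (y i) \<le> 1" by auto
    have "C * pnorm y \<le> \<bar>C\<bar> * 1"
      using pnorm_nonneg[OF y(2)] pnorm_le_1[OF y(2,3)] by (intro mult_mono) auto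
    then show "r \<le> \<bar>C\<bar>" using C[OF y(2)] y(1) by simp
  qed
qed

lemma multilinear_bound:
  assumes Z: "normed_space K Z" and A: "bounded_multilinear K n X Z A" and x: "x \<in> P"
  shows "nrm Z (A x) \<le> multilinear_norm n X Z A * pnorm x"
proof -
  interpret Z: gauged_module K Z by (rule normed_space_gauged[OF Z])
  obtain C where C: "\<And>x. x \<in> P \<Longrightarrow> nrm Z (A x) \<le> C * pnorm x"
    using A by (auto simp: bounded_multilinear_def pnorm_def)
  have ml: "multilinear K n X Z A" using A by (simp add: bounded_multilinear_def)
  show ?thesis
  proof (cases "pnorm x = 0")
    case True
    then show ?thesis using C[OF x] by simp
  next
    case False
    then have nz: "nrm (X i) (x i) \<noteq> 0" if "i < n" for i using that by (auto simp: pnorm_def)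
    define N where "N i = nrm (X i) (x i)" for i
    have Npos: "N i > 0" if "i < n" for i
      using nz[OF that] normed_spaceD(1)[OF X_normed[OF that]] P_at[OF x that] by (simp add: N_def less_le)
    \<comment> \<open>Multilinearity lets one coordinate be normalised at a time: \<open>w k\<close>
      has the first \<open>k\<close> coordinates divided by their norms, and \<open>w n\<close> has
      all coordinates of norm 1.\<close>
    define w where "w k = (\<lambda>i. if i < k then of_real (1 / N i) \<odot>\<^bsub>X i\<^esub> x i else x i)" for k
    have w: "w k \<in> P \<and> A (w k) = of_real (\<Prod>i<k. 1 / N i) \<odot>\<^bsub>Z\<^esub> A x" if "k \<le> n" for k
      using that
    proof (induction k)
      case 0
      then show ?case using x multilinear_in[OF ml x] by (simp add: w_def)
    next
      case (Suc k)
      then have IH: "w k \<in> P" "A (w k) = of_real (\<Prod>i<k. 1 / N i) \<odot>\<^bsub>Z\<^esub> A x" and k: "k < n" by auto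
      have eq: "w (Suc k) = (w k)(k := of_real (1 / N k) \<odot>\<^bsub>X k\<^esub> w k k)"
        by (auto simp: w_def fun_eq_iff less_Suc_eq)
      have "w (Suc k) \<in> P"
        unfolding eq using k by (intro P_upd IH kmodule.smult_in[OF X_module[OF k]] P_at K_closed(3))
      moreover have "A (w (Suc k)) = of_real (1 / N k) \<odot>\<^bsub>Z\<^esub> A (w k)"
        unfolding eq using multilinear_smult[OF ml IH(1) k K_closed(3)] .
      then have "A (w (Suc k)) = of_real (\<Prod>i<Suc k. 1 / N i) \<odot>\<^bsub>Z\<^esub> A x"
        unfolding IH(2) using Z.smult_smult[OF K_closed(3) K_closed(3) multilinear_in[OF ml x], of "1 / N k" "\<Prod>i<k. 1 / N i"]
        by (simp add: mult.commute)
      ultimately show ?case by simp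
    qed
    have wn: "w n \<in> P" "A (w n) = of_real (\<Prod>i<n. 1 / N i) \<odot>\<^bsub>Z\<^esub> A x" using w[of n] by auto
    have unit: "nrm (X i) (w n i) = 1" if "i < n" for i
      using that Npos[OF that] normed_spaceD(4)[OF X_normed[OF that] K_closed(3) P_at[OF x that], of "1 / N i"]
      by (simp add: w_def N_def norm_divide)
    have "nrm Z (A (w n)) \<le> multilinear_norm n X Z A"
      unfolding multilinear_norm_def
    proof (rule cSup_upper)
      show "nrm Z (A (w n)) \<in> {nrm Z (A x) |x. x \<in> P \<and> (\<forall>i<n. nrm (X i) (x i) \<le> 1)}"
        using wn(1) unit by force
    qed (rule multilinear_bdd[OF A])
    moreover have "(\<Prod>i<n. 1 / N i) = 1 / pnorm x" by (simp add: pnorm_def N_def prod_dividef)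
    then have "A (w n) = of_real (1 / pnorm x) \<odot>\<^bsub>Z\<^esub> A x" using wn(2) by (simp only:)
    moreover have pos: "pnorm x > 0" using False pnorm_nonneg[OF x] by simp
    then have "nrm Z (of_real (1 / pnorm x) \<odot>\<^bsub>Z\<^esub> A x) = 1 / pnorm x * nrm Z (A x)"
      using multilinear_in[OF ml x] by (intro Z.nrm_scale) auto
    ultimately show ?thesis using pos by (simp only:) (simp add: field_simps)
  qed
qed

lemma multilinear_norm_nonneg:
  assumes Z: "normed_space K Z" and A: "bounded_multilinear K n X Z A"
  shows "0 \<le> multilinear_norm n X Z A"
proof -
  have "nrm Z (A zero_tuple) \<le> multilinear_norm n X Z A"
    unfolding multilinear_norm_def
    by (rule cSup_upper[OF _ multilinear_bdd[OF A]])
      (auto intro!: exI[of _ zero_tuple] simp: zero_tuple_nrm)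
  moreover have "A zero_tuple \<in> carrier Z"
    using A by (auto simp: bounded_multilinear_def intro: multilinear_in)
  ultimately show ?thesis using normed_spaceD(1)[OF Z, of "A zero_tuple"] by simp
qed

lemma multilinear_norm_le:
  assumes "\<And>x. x \<in> P \<Longrightarrow> nrm Z (A x) \<le> C * pnorm x" "C \<ge> 0"
  shows "multilinear_norm n X Z A \<le> C"
  unfolding multilinear_norm_def
proof (rule cSup_least)
  show "{nrm Z (A x) |x. x \<in> P \<and> (\<forall>i<n. nrm (X i) (x i) \<le> 1)} \<noteq> {}"
    by (auto intro!: exI[of _ zero_tuple] simp: zero_tuple_nrm)
  fix r assume "r \<in> {nrm Z (A x) |x. x \<in> P \<and> (\<forall>i<n. nrm (X i) (x i) \<le> 1)}"
  then obtain y where y: "r = nrm Z (A y)" "y \<in> P" "\<forall>i<n. nrm (X i) (y i) \<le> 1" by auto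
  then have "C * pnorm y \<le> C * 1" using assms(2) pnorm_le_1 by (intro mult_left_mono) auto
  then show "r \<le> C" using assms(1)[OF y(2)] y(1) by simp
qed

end

section \<open>Completion of a semi-inner product\<close>

text \<open>Vectors \<open>x\<close> with \<open>s x x = 0\<close> are allowed; the completion
  collapses them.\<close>

locale semi_inner = kmodule K V for K and V :: "'v nspace" (structure) +
  fixes s :: "'v \<Rightarrow> 'v \<Rightarrow> complex"
  assumes s_in: "x \<in> carrier V \<Longrightarrow> y \<in> carrier V \<Longrightarrow> s x y \<in> K"
    and s_add: "x \<in> carrier V \<Longrightarrow> y \<in> carrier V \<Longrightarrow> z \<in> carrier V \<Longrightarrow> s (x \<oplus> y) z = s x z + s y z"
    and s_smult: "c \<in> K \<Longrightarrow> x \<in> carrier V \<Longrightarrow> y \<in> carrier V \<Longrightarrow> s (c \<odot> x) y = c * s x y"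
    and s_cnj: "x \<in> carrier V \<Longrightarrow> y \<in> carrier V \<Longrightarrow> cnj (s y x) = s x y"
    and s_nonneg: "x \<in> carrier V \<Longrightarrow> 0 \<le> Re (s x x)"
begin

definition N :: "'v \<Rightarrow> real" where "N x = sqrt (Re (s x x))"

lemma s_self: "x \<in> carrier V \<Longrightarrow> s x x = complex_of_real ((N x)\<^sup>2)"
  using s_cnj[of x x] s_nonneg[of x] by (simp add: N_def complex_eq_iff)

lemma N_nonneg [simp]: "x \<in> carrier V \<Longrightarrow> 0 \<le> N x"
  by (simp add: N_def s_nonneg)

lemma s_add_right: "x \<in> carrier V \<Longrightarrow> y \<in> carrier V \<Longrightarrow> z \<in> carrier V \<Longrightarrow> s z (x \<oplus> y) = s z x + s z y"
  using s_add[of x y z] s_cnj[of z "x \<oplus> y"] s_cnj[of z x] s_cnj[of z y]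
  by (metis complex_cnj_add M.a_closed)

lemma s_smult_right: "c \<in> K \<Longrightarrow> x \<in> carrier V \<Longrightarrow> y \<in> carrier V \<Longrightarrow> s y (c \<odot> x) = cnj c * s y x"
  using s_smult[of c x y] s_cnj[of y "c \<odot> x"] s_cnj[of y x]
  by (metis complex_cnj_mult smult_in)

lemma s_minus: "x \<in> carrier V \<Longrightarrow> y \<in> carrier V \<Longrightarrow> z \<in> carrier V \<Longrightarrow> s (x \<ominus> y) z = s x z - s y z"
  and s_minus_right: "x \<in> carrier V \<Longrightarrow> y \<in> carrier V \<Longrightarrow> z \<in> carrier V \<Longrightarrow> s z (x \<ominus> y) = s z x - s z y"
  by (simp_all add: minus_eq s_add s_smult s_add_right s_smult_right)

lemma cauchy_schwarz:
  assumes x: "x \<in> carrier V" and y: "y \<in> carrier V"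
  shows "cmod (s x y) \<le> N x * N y"
proof -
  define c where "c = s x y"
  have c: "c \<in> K" by (simp add: c_def s_in x y)
  \<comment> \<open>Nonnegativity of \<open>s\<close> at \<open>x - t c y\<close> for real
    \<open>t\<close>; the factor \<open>c\<close> makes both mixed terms equal to \<open>t\<close>
    times the squared modulus of \<open>c\<close>.\<close>
  have quad: "0 \<le> (N x)\<^sup>2 - 2 * t * (cmod c)\<^sup>2 + t\<^sup>2 * (cmod c)\<^sup>2 * (N y)\<^sup>2" for t :: real
  proof -
    let ?z = "(complex_of_real t * c) \<odot> y"
    have tc: "complex_of_real t * c \<in> K" using c by simp
    have z: "?z \<in> carrier V" using tc y by simp
    have cc: "c * cnj c = complex_of_real ((cmod c)\<^sup>2)" using complex_norm_square[of c] by simp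
    have yx: "s y x = cnj c" using s_cnj[OF y x] by (simp add: c_def)
    have "s (x \<ominus> ?z) (x \<ominus> ?z) = s x x - complex_of_real t * cnj c * c - complex_of_real t * c * cnj c
        + complex_of_real t * c * (complex_of_real t * cnj c) * s y y"
      using x y z tc by (simp add: s_minus s_minus_right s_smult s_smult_right yx c_def[symmetric] algebra_simps)
    also have "\<dots> = complex_of_real ((N x)\<^sup>2) - complex_of_real (2 * t) * (c * cnj c)
        + complex_of_real (t\<^sup>2) * (c * cnj c) * complex_of_real ((N y)\<^sup>2)"
      using x y by (simp add: s_self algebra_simps power2_eq_square)
    also have "\<dots> = complex_of_real ((N x)\<^sup>2 - 2 * t * (cmod c)\<^sup>2 + t\<^sup>2 * (cmod c)\<^sup>2 * (N y)\<^sup>2)"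
      unfolding cc by simp
    finally show ?thesis using s_nonneg[of "x \<ominus> ?z"] x z by simp
  qed
  have "(cmod c)\<^sup>2 \<le> (N x * N y)\<^sup>2"
  proof (cases "N y = 0")
    case True
    have "c = 0"
    proof (rule ccontr)
      assume "c \<noteq> 0"
      \<comment> \<open>With \<open>N y = 0\<close> the polynomial in \<open>quad\<close> is affine
        in \<open>t\<close>, and this \<open>t\<close> is large enough to make it negative.\<close>
      then have "((N x)\<^sup>2 + 1) / (cmod c)\<^sup>2 * (cmod c)\<^sup>2 = (N x)\<^sup>2 + 1" by simp
      then have "2 * (((N x)\<^sup>2 + 1) / (cmod c)\<^sup>2) * (cmod c)\<^sup>2 = 2 * ((N x)\<^sup>2 + 1)"
        by (simp only: mult.assoc)
      then show False
        using quad[of "((N x)\<^sup>2 + 1) / (cmod c)\<^sup>2"] zero_le_power2[of "N x"] True by simp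
    qed
    then show ?thesis by simp
  next
    case False
    \<comment> \<open>The choice \<open>1 / (N y)\<^sup>2\<close> is the minimiser of the quadratic
      polynomial in \<open>t\<close>.\<close>
    then have "0 \<le> (N x)\<^sup>2 - (cmod c)\<^sup>2 / (N y)\<^sup>2"
      using quad[of "1 / (N y)\<^sup>2"] by (simp add: power2_eq_square field_simps)
    then show ?thesis using False by (simp add: field_simps power_mult_distrib)
  qed
  then show ?thesis using x y by (simp add: c_def abs_le_square_iff[symmetric])
qed

lemma N_triangle:
  assumes x: "x \<in> carrier V" and y: "y \<in> carrier V" shows "N (x \<oplus> y) \<le> N x + N y"
proof (rule power2_le_imp_le)
  have "(N (x \<oplus> y))\<^sup>2 = Re (s (x \<oplus> y) (x \<oplus> y))" using s_self[of "x \<oplus> y"] x y by simp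
  also have "\<dots> = (N x)\<^sup>2 + Re (s x y) + Re (s y x) + (N y)\<^sup>2"
    using x y by (simp add: s_add s_add_right s_self[OF x] s_self[OF y] del: of_real_power)
  also have "\<dots> \<le> (N x)\<^sup>2 + N x * N y + N y * N x + (N y)\<^sup>2"
    using cauchy_schwarz[OF x y] cauchy_schwarz[OF y x] complex_Re_le_cmod[of "s x y"]
      complex_Re_le_cmod[of "s y x"] by linarith
  finally show "(N (x \<oplus> y))\<^sup>2 \<le> (N x + N y)\<^sup>2" by (simp add: power2_eq_square algebra_simps)
qed (use x y in simp)

lemma N_smult: "c \<in> K \<Longrightarrow> x \<in> carrier V \<Longrightarrow> N (c \<odot> x) = cmod c * N x"
proof -
  assume c: "c \<in> K" and x: "x \<in> carrier V"
  have "complex_of_real ((N (c \<odot> x))\<^sup>2) = c * cnj c * s x x"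
    using s_self[of "c \<odot> x"] c x by (simp add: s_smult s_smult_right mult_ac)
  also have "\<dots> = complex_of_real ((cmod c * N x)\<^sup>2)"
    using x by (simp add: s_self complex_norm_square[symmetric] power_mult_distrib)
  finally have "(N (c \<odot> x))\<^sup>2 = (cmod c * N x)\<^sup>2" by (simp only: of_real_eq_iff)
  then show ?thesis using c x by (simp add: power2_eq_iff_nonneg)
qed

lemma N_zero: "N \<zero> = 0"
  using N_smult[of 0 "\<zero>"] by simp

lemma N_minus_ge: "x \<in> carrier V \<Longrightarrow> y \<in> carrier V \<Longrightarrow> N x - N y \<le> N (x \<ominus> y)"
  using N_triangle[of "x \<ominus> y" y] by (simp add: add_minus_cancel)

definition cauchy :: "(nat \<Rightarrow> 'v) \<Rightarrow> bool" where
  "cauchy w \<longleftrightarrow> (\<forall>i. w i \<in> carrier V) \<and> (\<forall>e>0. \<exists>m. \<forall>i\<ge>m. \<forall>j\<ge>m. N (w i \<ominus> w j) < e)"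

lemma cauchy_in: "cauchy w \<Longrightarrow> w i \<in> carrier V"
  by (simp add: cauchy_def)

lemma cauchy_const: "x \<in> carrier V \<Longrightarrow> cauchy (\<lambda>_. x)"
  by (simp add: cauchy_def N_zero)

lemma cauchy_add:
  assumes "cauchy w" "cauchy w'" shows "cauchy (\<lambda>i. w i \<oplus> w' i)"
  unfolding cauchy_def
proof (intro conjI allI impI)
  show "w i \<oplus> w' i \<in> carrier V" for i using assms cauchy_in by simp
  fix e :: real assume "e > 0"
  then obtain a b where a: "\<And>i j. i \<ge> a \<Longrightarrow> j \<ge> a \<Longrightarrow> N (w i \<ominus> w j) < e / 2"
    and b: "\<And>i j. i \<ge> b \<Longrightarrow> j \<ge> b \<Longrightarrow> N (w' i \<ominus> w' j) < e / 2"
    using assms unfolding cauchy_def by (meson half_gt_zero)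
  have "N ((w i \<oplus> w' i) \<ominus> (w j \<oplus> w' j)) < e" if "i \<ge> max a b" "j \<ge> max a b" for i j
  proof -
    have c: "w i \<in> carrier V" "w j \<in> carrier V" "w' i \<in> carrier V" "w' j \<in> carrier V"
      using assms cauchy_in by auto
    have "(w i \<oplus> w' i) \<ominus> (w j \<oplus> w' j) = (w i \<ominus> w j) \<oplus> (w' i \<ominus> w' j)"
      using c by (simp add: minus_eq smult_distr_vec M.a_ac)
    then show ?thesis
      using N_triangle[of "w i \<ominus> w j" "w' i \<ominus> w' j"] c a[of i j] b[of i j] that by simp
  qed
  then show "\<exists>m. \<forall>i\<ge>m. \<forall>j\<ge>m. N ((w i \<oplus> w' i) \<ominus> (w j \<oplus> w' j)) < e" by blast
qed

lemma cauchy_smult: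
  assumes "cauchy w" "c \<in> K" shows "cauchy (\<lambda>i. c \<odot> w i)"
  unfolding cauchy_def
proof (intro conjI allI impI)
  show "c \<odot> w i \<in> carrier V" for i using assms cauchy_in by simp
  fix e :: real assume "e > 0"
  then obtain a where a: "\<And>i j. i \<ge> a \<Longrightarrow> j \<ge> a \<Longrightarrow> N (w i \<ominus> w j) < e / (cmod c + 1)"
    using assms unfolding cauchy_def by (meson add_nonneg_pos divide_pos_pos norm_ge_zero zero_less_one)
  have "N ((c \<odot> w i) \<ominus> (c \<odot> w j)) < e" if "i \<ge> a" "j \<ge> a" for i j
  proof -
    have c: "w i \<in> carrier V" "w j \<in> carrier V" using assms cauchy_in by auto
    have "(c \<odot> w i) \<ominus> (c \<odot> w j) = c \<odot> (w i \<ominus> w j)"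
      using c assms(2) by (simp add: minus_eq smult_distr_vec smult_smult mult.commute)
    then have "N ((c \<odot> w i) \<ominus> (c \<odot> w j)) = cmod c * N (w i \<ominus> w j)"
      using c assms(2) by (simp add: N_smult)
    also have "\<dots> \<le> (cmod c + 1) * N (w i \<ominus> w j)"
      using c by (intro mult_right_mono) auto
    also have "\<dots> < e"
    proof -
      have "cmod c + 1 > 0" by (simp add: add_nonneg_pos)
      then show ?thesis using a[OF that] by (simp add: pos_less_divide_eq mult.commute)
    qed
    finally show ?thesis .
  qed
  then show "\<exists>m. \<forall>i\<ge>m. \<forall>j\<ge>m. N ((c \<odot> w i) \<ominus> (c \<odot> w j)) < e" by blast
qed

lemma cauchy_minus: "cauchy w \<Longrightarrow> cauchy w' \<Longrightarrow> cauchy (\<lambda>i. w i \<ominus> w' i)"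
  using cauchy_add[OF _ cauchy_smult[of w' "- 1"], of w] by (simp add: minus_eq cauchy_in)

lemma cauchy_bounded:
  assumes "cauchy w" obtains B where "B > 0" "\<And>i. N (w i) \<le> B"
proof -
  have "Cauchy (\<lambda>i. N (w i))"
    unfolding Cauchy_def dist_real_def
  proof (intro allI impI)
    fix e :: real assume "e > 0"
    then obtain m where m: "\<And>i j. i \<ge> m \<Longrightarrow> j \<ge> m \<Longrightarrow> N (w i \<ominus> w j) < e"
      using assms unfolding cauchy_def by blast
    have "\<bar>N (w i) - N (w j)\<bar> < e" if "i \<ge> m" "j \<ge> m" for i j
      using N_minus_ge[of "w i" "w j"] N_minus_ge[of "w j" "w i"] m[of i j] m[of j i] that
        cauchy_in[OF assms] by fastforce
    then show "\<exists>m. \<forall>i\<ge>m. \<forall>j\<ge>m. \<bar>N (w i) - N (w j)\<bar> < e" by blast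
  qed
  then have "Bseq (\<lambda>i. N (w i))" by (rule Cauchy_Bseq)
  then obtain B where "B > 0" "\<And>i. \<bar>N (w i)\<bar> \<le> B" by (auto simp: Bseq_def)
  then show thesis using that by (meson abs_ge_self order_trans)
qed

lemma s_convergent:
  assumes w: "cauchy w" and w': "cauchy w'" shows "convergent (\<lambda>i. s (w i) (w' i))"
proof -
  obtain B where B: "B > 0" "\<And>i. N (w i) \<le> B" using cauchy_bounded[OF w] by blast
  obtain B' where B': "B' > 0" "\<And>i. N (w' i) \<le> B'" using cauchy_bounded[OF w'] by blast
  have "Cauchy (\<lambda>i. s (w i) (w' i))"
    unfolding Cauchy_def dist_complex_def
  proof (intro allI impI)
    fix e :: real assume e: "e > 0"
    have "e / (2 * B') > 0" "e / (2 * B) > 0" using e B B' by auto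
    then obtain a b where a: "\<And>i j. i \<ge> a \<Longrightarrow> j \<ge> a \<Longrightarrow> N (w i \<ominus> w j) < e / (2 * B')"
      and b: "\<And>i j. i \<ge> b \<Longrightarrow> j \<ge> b \<Longrightarrow> N (w' i \<ominus> w' j) < e / (2 * B)"
      using w w' unfolding cauchy_def by meson
    have "cmod (s (w i) (w' i) - s (w j) (w' j)) < e" if "i \<ge> max a b" "j \<ge> max a b" for i j
    proof -
      have c: "w i \<in> carrier V" "w j \<in> carrier V" "w' i \<in> carrier V" "w' j \<in> carrier V"
        using w w' cauchy_in by auto
      have "s (w i) (w' i) - s (w j) (w' j) = s (w i \<ominus> w j) (w' i) + s (w j) (w' i \<ominus> w' j)"
        using c by (simp add: s_minus s_minus_right)
      then have "cmod (s (w i) (w' i) - s (w j) (w' j))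
          \<le> N (w i \<ominus> w j) * N (w' i) + N (w j) * N (w' i \<ominus> w' j)"
        using norm_triangle_ineq[of "s (w i \<ominus> w j) (w' i)" "s (w j) (w' i \<ominus> w' j)"]
          cauchy_schwarz[of "w i \<ominus> w j" "w' i"] cauchy_schwarz[of "w j" "w' i \<ominus> w' j"] c by simp
      also have "\<dots> \<le> N (w i \<ominus> w j) * B' + B * N (w' i \<ominus> w' j)"
        using c B B' by (intro add_mono mult_left_mono mult_right_mono) auto
      also have "\<dots> < e" using a[of i j] b[of i j] that B B' by (simp add: field_simps)
      finally show ?thesis .
    qed
    then show "\<exists>m. \<forall>i\<ge>m. \<forall>j\<ge>m. cmod (s (w i) (w' i) - s (w j) (w' j)) < e" by blast
  qed
  then show ?thesis by (simp add: Cauchy_convergent)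
qed

lemma s_null:
  assumes z: "(\<lambda>i. N (z i)) \<longlonglongrightarrow> 0" "\<And>i. z i \<in> carrier V" and w: "cauchy w"
  shows "(\<lambda>i. s (z i) (w i)) \<longlonglongrightarrow> 0" "(\<lambda>i. s (w i) (z i)) \<longlonglongrightarrow> 0"
proof -
  obtain B where B: "B > 0" "\<And>i. N (w i) \<le> B" using cauchy_bounded[OF w] by blast
  have lim: "(\<lambda>i. N (z i) * B) \<longlonglongrightarrow> 0" using tendsto_mult_right[OF z(1), of B] by simp
  have "cmod (s (z i) (w i)) \<le> N (z i) * B" for i
    using cauchy_schwarz[of "z i" "w i"] mult_left_mono[OF B(2)[of i], of "N (z i)"] z(2) cauchy_in[OF w]
    by fastforce
  then show "(\<lambda>i. s (z i) (w i)) \<longlonglongrightarrow> 0"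
    by (intro Lim_null_comparison[OF _ lim]) simp
  have "cmod (s (w i) (z i)) \<le> N (z i) * B" for i
    using cauchy_schwarz[of "w i" "z i"] mult_left_mono[OF B(2)[of i], of "N (z i)"] z(2) cauchy_in[OF w]
    by (fastforce simp: mult.commute)
  then show "(\<lambda>i. s (w i) (z i)) \<longlonglongrightarrow> 0"
    by (intro Lim_null_comparison[OF _ lim]) simp
qed

text \<open>A point of the completion is represented by the weak limit of a Cauchy sequence, a function
  on the original space.\<close>

definition L :: "(nat \<Rightarrow> 'v) \<Rightarrow> 'v \<Rightarrow> complex" where
  "L w = (\<lambda>v. if v \<in> carrier V then lim (\<lambda>i. s (w i) v) else 0)"

lemma L_lim: "cauchy w \<Longrightarrow> v \<in> carrier V \<Longrightarrow> (\<lambda>i. s (w i) v) \<longlonglongrightarrow> L w v"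
  using s_convergent[OF _ cauchy_const] by (simp add: L_def convergent_LIMSEQ_iff)

lemma L_add: "cauchy w \<Longrightarrow> cauchy w' \<Longrightarrow> L (\<lambda>i. w i \<oplus> w' i) = (\<lambda>v. L w v + L w' v)"
proof
  fix v assume w: "cauchy w" "cauchy w'"
  show "L (\<lambda>i. w i \<oplus> w' i) v = L w v + L w' v"
  proof (cases "v \<in> carrier V")
    case True
    have "(\<lambda>i. s (w i \<oplus> w' i) v) \<longlonglongrightarrow> L w v + L w' v"
      using tendsto_add[OF L_lim[OF w(1) True] L_lim[OF w(2) True]] w True by (simp add: s_add cauchy_in)
    then show ?thesis using LIMSEQ_unique L_lim[OF cauchy_add[OF w] True] by blast
  qed (simp add: L_def)
qed

lemma L_smult: "cauchy w \<Longrightarrow> c \<in> K \<Longrightarrow> L (\<lambda>i. c \<odot> w i) = (\<lambda>v. c * L w v)"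
proof
  fix v assume w: "cauchy w" "c \<in> K"
  show "L (\<lambda>i. c \<odot> w i) v = c * L w v"
  proof (cases "v \<in> carrier V")
    case True
    have "(\<lambda>i. s (c \<odot> w i) v) \<longlonglongrightarrow> c * L w v"
      using tendsto_mult_left[OF L_lim[OF w(1) True], of c] w True by (simp add: s_smult cauchy_in)
    then show ?thesis using LIMSEQ_unique L_lim[OF cauchy_smult[OF w] True] by blast
  qed (simp add: L_def)
qed

lemma L_minus:
  assumes "cauchy w" "cauchy w'" shows "L (\<lambda>i. w i \<ominus> w' i) = (\<lambda>v. L w v - L w' v)"
  using L_add[OF assms(1) cauchy_smult[OF assms(2), of "- 1"]] L_smult[OF assms(2), of "- 1"] assms
  by (simp add: minus_eq cauchy_in)

text \<open>For a Cauchy sequence weak convergence to 0 implies convergence in seminorm: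
  \<open>s (w i) (w i)\<close> differs from \<open>s (w i) (w m)\<close> by at most
  \<open>B * e\<close> for large \<open>i\<close>, and the latter tends to 0. Hence two Cauchy
  sequences have the same weak limit only if their difference is null, so equality of functions is
  the right equality of points of the completion.\<close>

lemma L_zero_null:
  assumes w: "cauchy w" and L: "L w = (\<lambda>v. 0)" shows "(\<lambda>i. N (w i)) \<longlonglongrightarrow> 0"
proof -
  obtain B where B: "B > 0" "\<And>i. N (w i) \<le> B" using cauchy_bounded[OF w] by blast
  obtain c where c: "(\<lambda>i. s (w i) (w i)) \<longlonglongrightarrow> c"
    using s_convergent[OF w w] by (auto simp: convergent_def)
  have "cmod c \<le> B * e" if e: "e > 0" for e
  proof -
    obtain m where m: "\<And>i j. i \<ge> m \<Longrightarrow> j \<ge> m \<Longrightarrow> N (w i \<ominus> w j) < e"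
      using w e unfolding cauchy_def by blast
    have "(\<lambda>i. s (w i) (w m)) \<longlonglongrightarrow> 0" using L_lim[OF w cauchy_in[OF w, of m]] L by simp
    then have "(\<lambda>i. cmod (s (w i) (w i) - s (w i) (w m))) \<longlonglongrightarrow> cmod (c - 0)"
      by (intro tendsto_norm tendsto_diff c)
    moreover have "cmod (s (w i) (w i) - s (w i) (w m)) \<le> B * e" if "i \<ge> m" for i
    proof -
      have c: "w i \<in> carrier V" "w m \<in> carrier V" using cauchy_in[OF w] by auto
      have "s (w i) (w i) - s (w i) (w m) = s (w i) (w i \<ominus> w m)" using c by (simp add: s_minus_right)
      also have "cmod \<dots> \<le> N (w i) * N (w i \<ominus> w m)" using c by (intro cauchy_schwarz) auto
      also have "\<dots> \<le> B * e"
        using B m[of i m] that c by (intro mult_mono) (auto intro: less_imp_le)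
      finally show ?thesis .
    qed
    ultimately show ?thesis by (intro LIMSEQ_le_const2) auto
  qed
  then have "cmod c / B \<le> 0 + e" if "e > 0" for e
    using that B(1) by (simp add: divide_le_eq mult.commute[of e])
  then have "cmod c / B \<le> 0" by (rule field_le_epsilon) simp
  then have "c = 0" using B(1) by (simp add: divide_le_0_iff)
  then have "(\<lambda>i. sqrt (Re (s (w i) (w i)))) \<longlonglongrightarrow> sqrt (Re 0)"
    using c by (intro tendsto_real_sqrt tendsto_Re) simp
  then show ?thesis by (simp add: N_def)
qed

definition rep :: "('v \<Rightarrow> complex) \<Rightarrow> nat \<Rightarrow> 'v" where
  "rep h = (SOME w. cauchy w \<and> L w = h)"

definition ip where "ip h k = lim (\<lambda>i. s (rep h i) (rep k i))"

lemma rep: "cauchy w \<Longrightarrow> cauchy (rep (L w)) \<and> L (rep (L w)) = L w"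
  unfolding rep_def by (rule someI[of _ w]) simp

text \<open>Independence of the chosen representative: \<open>w\<close> and \<open>rep (L w)\<close>
  have equal weak limits, so their difference is null by \<open>L_zero_null\<close>, and null
  sequences do not affect limits of \<open>s\<close> against Cauchy sequences.\<close>

lemma ip_lim:
  assumes w: "cauchy w" and w': "cauchy w'"
  shows "(\<lambda>i. s (w i) (w' i)) \<longlonglongrightarrow> ip (L w) (L w')"
proof -
  let ?u = "rep (L w)" and ?u' = "rep (L w')"
  note u = rep[OF w] and u' = rep[OF w']
  have uc: "cauchy ?u" "cauchy ?u'" using u u' by auto
  have null: "(\<lambda>i. N (x i \<ominus> rep (L x) i)) \<longlonglongrightarrow> 0" if "cauchy x" for x
    using rep[OF that] that by (intro L_zero_null cauchy_minus) (auto simp: L_minus)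
  have "(\<lambda>i. s (?u i) (?u' i)) \<longlonglongrightarrow> ip (L w) (L w')"
    using s_convergent[OF uc] by (simp add: ip_def convergent_LIMSEQ_iff)
  moreover have "(\<lambda>i. s (w i \<ominus> ?u i) (w' i)) \<longlonglongrightarrow> 0"
    using null[OF w] w' cauchy_in[OF w] cauchy_in[OF uc(1)] by (intro s_null) auto
  moreover have "(\<lambda>i. s (?u i) (w' i \<ominus> ?u' i)) \<longlonglongrightarrow> 0"
    using null[OF w'] uc cauchy_in[OF w'] cauchy_in[OF uc(2)] by (intro s_null) auto
  ultimately have "(\<lambda>i. s (?u i) (?u' i) + s (w i \<ominus> ?u i) (w' i) + s (?u i) (w' i \<ominus> ?u' i))
      \<longlonglongrightarrow> ip (L w) (L w') + 0 + 0"
    by (intro tendsto_add)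
  then show ?thesis
    by (simp add: s_minus s_minus_right cauchy_in[OF w] cauchy_in[OF w'] cauchy_in[OF uc(1)] cauchy_in[OF uc(2)])
qed

definition completion :: "('v \<Rightarrow> complex) nspace" where
  "completion = \<lparr>carrier = {L w |w. cauchy w}, mult = undefined, one = undefined,
     zero = (\<lambda>v. 0), add = (\<lambda>f g. \<lambda>v. f v + g v), smult = (\<lambda>c f. \<lambda>v. c * f v),
     nrm = (\<lambda>h. sqrt (Re (ip h h)))\<rparr>"

lemma completion_simps:
  "carrier completion = {L w |w. cauchy w}" "\<zero>\<^bsub>completion\<^esub> = (\<lambda>v. 0)"
  "f \<oplus>\<^bsub>completion\<^esub> g = (\<lambda>v. f v + g v)" "c \<odot>\<^bsub>completion\<^esub> f = (\<lambda>v. c * f v)"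
  "nrm completion h = sqrt (Re (ip h h))"
  by (simp_all add: completion_def)

lemma completion_cases:
  assumes "h \<in> carrier completion" obtains w where "cauchy w" "h = L w"
  using assms by (auto simp: completion_simps)

lemma L_zero: "L (\<lambda>_. \<zero>) = (\<lambda>v. 0)"
  using L_smult[OF cauchy_const[of "\<zero>"], of 0] by simp

lemma completion_add_L: "cauchy w \<Longrightarrow> cauchy w' \<Longrightarrow> L w \<oplus>\<^bsub>completion\<^esub> L w' = L (\<lambda>i. w i \<oplus> w' i)"
  and completion_smult_L: "cauchy w \<Longrightarrow> c \<in> K \<Longrightarrow> c \<odot>\<^bsub>completion\<^esub> L w = L (\<lambda>i. c \<odot> w i)"
  by (simp_all add: completion_simps L_add L_smult)

lemma L_in: "cauchy w \<Longrightarrow> L w \<in> carrier completion"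
  by (auto simp: completion_simps)

lemma completion_module: "kmodule K completion"
proof (intro kmoduleI module_scalarsI)
  show "\<zero>\<^bsub>completion\<^esub> \<in> carrier completion"
    using L_in[OF cauchy_const[of "\<zero>"]] by (simp add: L_zero completion_simps(2))
  show "f \<oplus>\<^bsub>completion\<^esub> g \<in> carrier completion"
    if "f \<in> carrier completion" "g \<in> carrier completion" for f g
    using that by (auto elim!: completion_cases simp: completion_add_L L_in cauchy_add)
  show "c \<odot>\<^bsub>completion\<^esub> f \<in> carrier completion" if "c \<in> K" "f \<in> carrier completion" for c f
    using that by (auto elim!: completion_cases simp: completion_smult_L L_in cauchy_smult)
qed (auto simp: completion_simps(2-) algebra_simps)

lemma completion_minus_L: "cauchy w \<Longrightarrow> cauchy w' \<Longrightarrow> L w \<ominus>\<^bsub>completion\<^esub> L w' = L (\<lambda>i. w i \<ominus> w' i)"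
  by (simp add: kmodule.minus_eq[OF completion_module] L_in completion_simps(2-) L_minus)

lemma nrm_L_lim:
  assumes "cauchy w" shows "(\<lambda>i. N (w i)) \<longlonglongrightarrow> nrm completion (L w)"
  unfolding completion_simps N_def by (intro tendsto_real_sqrt tendsto_Re ip_lim assms)

lemma nrm_const: "x \<in> carrier V \<Longrightarrow> nrm completion (L (\<lambda>_. x)) = N x"
  using LIMSEQ_unique[OF nrm_L_lim[OF cauchy_const] tendsto_const] by simp

lemma completion_normed: "normed_space K completion"
  unfolding normed_space_def
proof (intro conjI ballI)
  show "Module.module (scalars K) completion"
    using completion_module by (simp add: kmodule_def)
  fix h assume "h \<in> carrier completion"
  then obtain w where w: "cauchy w" "h = L w" by (rule completion_cases)
  show "0 \<le> nrm completion h"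
    unfolding w(2) using nrm_L_lim[OF w(1)] cauchy_in[OF w(1)] by (intro LIMSEQ_le_const) auto
  show "nrm completion h = 0 \<longleftrightarrow> h = \<zero>\<^bsub>completion\<^esub>"
  proof
    assume "nrm completion h = 0"
    then have lim: "(\<lambda>i. N (w i)) \<longlonglongrightarrow> 0" using nrm_L_lim[OF w(1)] w(2) by simp
    have "L w v = 0" for v
    proof (cases "v \<in> carrier V")
      case True
      show ?thesis
        using LIMSEQ_unique[OF L_lim[OF w(1) True] s_null(1)[OF lim cauchy_in[OF w(1)] cauchy_const[OF True]]] .
    qed (simp add: L_def)
    then show "h = \<zero>\<^bsub>completion\<^esub>" by (auto simp: w(2) completion_simps(2))
  next
    assume "h = \<zero>\<^bsub>completion\<^esub>"
    then have "L w = (\<lambda>v. 0)" by (simp add: w(2) completion_simps(2))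
    then show "nrm completion h = 0"
      using LIMSEQ_unique[OF nrm_L_lim[OF w(1)] L_zero_null[OF w(1)]] by (simp add: w(2))
  qed
  show "nrm completion (c \<odot>\<^bsub>completion\<^esub> h) = cmod c * nrm completion h" if c: "c \<in> K" for c
  proof -
    have "(\<lambda>i. N (c \<odot> w i)) \<longlonglongrightarrow> cmod c * nrm completion h"
      using tendsto_mult_left[OF nrm_L_lim[OF w(1)], of "cmod c"] c
      by (simp add: N_smult cauchy_in[OF w(1)] w(2))
    then show ?thesis
      using LIMSEQ_unique[OF nrm_L_lim[OF cauchy_smult[OF w(1) c]]] w(2) completion_smult_L[OF w(1) c] by simp
  qed
  fix k assume "k \<in> carrier completion"
  then obtain w' where w': "cauchy w'" "k = L w'" by (rule completion_cases)
  have "nrm completion (L (\<lambda>i. w i \<oplus> w' i)) \<le> nrm completion (L w) + nrm completion (L w')"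
    using N_triangle cauchy_in w w'
    by (intro LIMSEQ_le[OF nrm_L_lim[OF cauchy_add[OF w(1) w'(1)]]
          tendsto_add[OF nrm_L_lim[OF w(1)] nrm_L_lim[OF w'(1)]]]) auto
  then show "nrm completion (h \<oplus>\<^bsub>completion\<^esub> k) \<le> nrm completion h + nrm completion k"
    using w w' by (simp add: completion_add_L)
qed

lemma completion_dense:
  assumes w: "cauchy w" and e: "e > 0"
  obtains m where "\<And>i. i \<ge> m \<Longrightarrow> nrm completion (L w \<ominus>\<^bsub>completion\<^esub> L (\<lambda>_. w i)) \<le> e"
proof -
  obtain m where m: "\<And>i j. i \<ge> m \<Longrightarrow> j \<ge> m \<Longrightarrow> N (w i \<ominus> w j) < e"
    using w e unfolding cauchy_def by blast
  have "nrm completion (L w \<ominus>\<^bsub>completion\<^esub> L (\<lambda>_. w i)) \<le> e" if "i \<ge> m" for i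
  proof -
    have c: "cauchy (\<lambda>_. w i)" by (intro cauchy_const cauchy_in w)
    have "nrm completion (L (\<lambda>j. w j \<ominus> w i)) \<le> e"
      using m that by (intro LIMSEQ_le_const2[OF nrm_L_lim[OF cauchy_minus[OF w c]]])
        (auto intro!: exI[of _ m] less_imp_le)
    then show ?thesis by (simp add: completion_minus_L[OF w c])
  qed
  then show thesis by (rule that)
qed

text \<open>Each member \<open>h k\<close> of a Cauchy sequence is approximated by a constant
  sequence at some \<open>y k\<close> up to \<open>1 / (k + 1)\<close>. The sequence
  \<open>y\<close> is then Cauchy in the original space, and its weak limit is the limit
  sought.\<close>

lemma completion_banach: "banach_space K completion"
  unfolding banach_space_def
proof (intro conjI completion_normed allI impI)
  interpret C: gauged_module K completion by (rule normed_space_gauged[OF completion_normed])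
  let ?n = "nrm completion" and ?m = "\<lambda>x y. x \<ominus>\<^bsub>completion\<^esub> y"
  have tri: "?n (?m x z) \<le> ?n (?m x y) + ?n (?m y z)"
    if "x \<in> carrier completion" "y \<in> carrier completion" "z \<in> carrier completion" for x y z
    using normed_spaceD(3)[OF completion_normed, of "?m x y" "?m y z"] that by (simp add: C.minus_add_minus)
  have comm: "?n (?m x y) = ?n (?m y x)" if "x \<in> carrier completion" "y \<in> carrier completion" for x y
  proof -
    have "?m x y = (- 1) \<odot>\<^bsub>completion\<^esub> ?m y x"
      using that by (simp add: C.minus_eq completion_simps(2-))
    then show ?thesis using normed_spaceD(4)[OF completion_normed, of "- 1" "?m y x"] that by simp
  qed
  fix h :: "nat \<Rightarrow> 'v \<Rightarrow> complex"
  assume "range h \<subseteq> carrier completion"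
    and cau: "\<forall>e>0. \<exists>M. \<forall>i\<ge>M. \<forall>j\<ge>M. ?n (?m (h i) (h j)) < e"
  then have h: "h k \<in> carrier completion" for k by auto
  have "\<exists>y\<in>carrier V. ?n (?m (h k) (L (\<lambda>_. y))) \<le> 1 / (real k + 1)" for k
  proof -
    obtain w where w: "cauchy w" "h k = L w" using h completion_cases by metis
    obtain m where "\<And>i. i \<ge> m \<Longrightarrow> ?n (?m (L w) (L (\<lambda>_. w i))) \<le> 1 / (real k + 1)"
      using completion_dense[OF w(1), of "1 / (real k + 1)"] by auto
    then show ?thesis using w cauchy_in[OF w(1)] by (intro bexI[of _ "w m"]) auto
  qed
  then obtain y where y: "\<And>k. y k \<in> carrier V" "\<And>k. ?n (?m (h k) (L (\<lambda>_. y k))) \<le> 1 / (real k + 1)"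
    by metis
  let ?J = "\<lambda>k. L (\<lambda>_. y k)"
  have J: "?J k \<in> carrier completion" for k by (intro L_in cauchy_const y)
  have inv: "\<exists>m. \<forall>k\<ge>m. 1 / (real k + 1) < e" if "e > 0" for e
  proof -
    obtain m where "1 / e < real m" using reals_Archimedean2 by blast
    then have "1 / (real k + 1) < e" if "k \<ge> m" for k
      using \<open>e > 0\<close> that by (simp add: field_simps) (smt (verit) mult_left_mono of_nat_mono)
    then show ?thesis by blast
  qed
  have "cauchy y"
    unfolding cauchy_def
  proof (intro conjI allI impI y)
    fix e :: real assume e: "e > 0"
    obtain a where a: "\<forall>k\<ge>a. 1 / (real k + 1) < e / 3" using inv[of "e / 3"] e by auto
    obtain b where b: "\<forall>i\<ge>b. \<forall>j\<ge>b. ?n (?m (h i) (h j)) < e / 3" using cau e by (meson divide_pos_pos zero_less_numeral)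
    have "N (y i \<ominus> y j) < e" if "i \<ge> max a b" "j \<ge> max a b" for i j
    proof -
      have "N (y i \<ominus> y j) = ?n (?m (?J i) (?J j))"
        using y by (simp add: completion_minus_L cauchy_const nrm_const)
      also have "\<dots> \<le> ?n (?m (h i) (?J i)) + ?n (?m (h i) (h j)) + ?n (?m (h j) (?J j))"
        using tri[OF J[of i] h[of i] J[of j]] tri[OF h[of i] h[of j] J[of j]] comm[OF J[of i] h[of i]] by simp
      also have "\<dots> < e / 3 + e / 3 + e / 3"
        using y(2)[of i] y(2)[of j] a b that by (intro add_strict_mono) (auto intro: le_less_trans)
      finally show ?thesis by simp
    qed
    then show "\<exists>m. \<forall>i\<ge>m. \<forall>j\<ge>m. N (y i \<ominus> y j) < e" by blast
  qed
  have "(\<lambda>i. ?n (?m (h i) (L y))) \<longlonglongrightarrow> 0"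
  proof (rule LIMSEQ_I)
    fix e :: real assume e: "e > 0"
    obtain a where a: "\<forall>k\<ge>a. 1 / (real k + 1) < e / 2" using inv[of "e / 2"] e by auto
    obtain b where b: "\<And>i. i \<ge> b \<Longrightarrow> ?n (?m (L y) (?J i)) \<le> e / 2"
      using completion_dense[OF \<open>cauchy y\<close>, of "e / 2"] e by auto
    have "norm (?n (?m (h i) (L y)) - 0) < e" if "i \<ge> max a b" for i
    proof -
      have "?n (?m (h i) (L y)) \<le> ?n (?m (h i) (?J i)) + ?n (?m (L y) (?J i))"
        using tri[OF h[of i] J[of i] L_in[OF \<open>cauchy y\<close>]] comm[OF J[of i] L_in[OF \<open>cauchy y\<close>]] by simp
      also have "\<dots> < e / 2 + e / 2"
        using y(2)[of i] a b[of i] that by (intro add_less_le_mono) (auto intro: le_less_trans)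
      finally show ?thesis
        using normed_spaceD(1)[OF completion_normed C.minus_in[OF h[of i] L_in[OF \<open>cauchy y\<close>]]] by simp
    qed
    then show "\<exists>m. \<forall>i\<ge>m. norm (?n (?m (h i) (L y)) - 0) < e" by blast
  qed
  then show "\<exists>l\<in>carrier completion. (\<lambda>i. ?n (?m (h i) l)) \<longlonglongrightarrow> 0"
    using L_in[OF \<open>cauchy y\<close>] by blast
qed

lemma K_limit:
  assumes "f \<longlonglongrightarrow> l" "\<And>i. f i \<in> K" shows "l \<in> K"
proof -
  have "closed K" using K_cases closed_complex_Reals by auto
  then show ?thesis using assms by (auto intro: closed_sequentially)
qed

lemma completion_hilbert: "hilbert_space K completion"
proof -
  have "inner_product K completion ip"
    unfolding inner_product_def
  proof (intro conjI ballI)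
    fix f g assume "f \<in> carrier completion" "g \<in> carrier completion"
    then obtain w w' where w: "cauchy w" "f = L w" and w': "cauchy w'" "g = L w'"
      by (metis completion_cases)
    show "ip f g \<in> K"
      unfolding w w' using cauchy_in w w' by (intro K_limit[OF ip_lim] s_in) auto
    show "ip g f = cnj (ip f g)"
    proof -
      have "(\<lambda>i. cnj (s (w i) (w' i))) \<longlonglongrightarrow> cnj (ip f g)"
        unfolding w w' by (intro tendsto_cnj ip_lim w w')
      then have "(\<lambda>i. s (w' i) (w i)) \<longlonglongrightarrow> cnj (ip f g)"
        using s_cnj[OF cauchy_in[OF w'(1)] cauchy_in[OF w(1)]] by simp
      then show ?thesis using LIMSEQ_unique[OF ip_lim[OF w'(1) w(1)]] w w' by simp
    qed
    show "ip (c \<odot>\<^bsub>completion\<^esub> f) g = c * ip f g" if c: "c \<in> K" for c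
    proof -
      have "(\<lambda>i. s (c \<odot> w i) (w' i)) \<longlonglongrightarrow> c * ip f g"
        using tendsto_mult_left[OF ip_lim[OF w(1) w'(1)], of c] c w w' by (simp add: s_smult cauchy_in)
      then show ?thesis
        using LIMSEQ_unique[OF ip_lim[OF cauchy_smult[OF w(1) c] w'(1)]] w w' completion_smult_L[OF w(1) c] by simp
    qed
    fix k assume "k \<in> carrier completion"
    then obtain z where z: "cauchy z" "k = L z" by (rule completion_cases)
    have "(\<lambda>i. s (w i \<oplus> w' i) (z i)) \<longlonglongrightarrow> ip f k + ip g k"
      using tendsto_add[OF ip_lim[OF w(1) z(1)] ip_lim[OF w'(1) z(1)]] w w' z by (simp add: s_add cauchy_in)
    then show "ip (f \<oplus>\<^bsub>completion\<^esub> g) k = ip f k + ip g k"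
      using LIMSEQ_unique[OF ip_lim[OF cauchy_add[OF w(1) w'(1)] z(1)]] w w' z
        completion_add_L[OF w(1) w'(1)] by simp
  next
    fix f assume "f \<in> carrier completion"
    then obtain w where w: "cauchy w" "f = L w" by (rule completion_cases)
    have "(\<lambda>i. complex_of_real ((N (w i))\<^sup>2)) \<longlonglongrightarrow> complex_of_real ((nrm completion f)\<^sup>2)"
      unfolding w by (intro tendsto_of_real tendsto_power nrm_L_lim w)
    then have "(\<lambda>i. s (w i) (w i)) \<longlonglongrightarrow> complex_of_real ((nrm completion f)\<^sup>2)"
      by (simp add: s_self cauchy_in[OF w(1)])
    then show "ip f f = complex_of_real ((nrm completion f)\<^sup>2)"
      using LIMSEQ_unique[OF ip_lim[OF w(1) w(1)]] w by simp
  qed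
  then show ?thesis using completion_banach by (auto simp: hilbert_space_def)
qed

lemma completion_embedding: "linear_map K V completion (\<lambda>x. L (\<lambda>_. x))"
  unfolding linear_map_def
  by (auto simp: L_in cauchy_const completion_add_L completion_smult_L)

end

section \<open>From a factorization to a functional\<close>

locale gamma_duality = tensor_setting K n X for K n and X :: "nat \<Rightarrow> 'a nspace" +
  fixes Y :: "'y nspace" (structure)
  assumes Y_normed: "normed_space K Y"
begin

sublocale Y: gauged_module K Y by (rule normed_space_gauged[OF Y_normed])

abbreviation "D \<equiv> dual_space K Y"

sublocale gamma_setting K n X D
  by unfold_locales (rule Y.normed_dual)

definition bform :: "((nat \<Rightarrow> 'a) \<Rightarrow> 'y) \<Rightarrow> (((nat \<Rightarrow> 'a) \<Rightarrow> complex) \<Rightarrow> complex) \<Rightarrow> ('y \<Rightarrow> complex) \<Rightarrow> complex" where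
  "bform T = (\<lambda>w f. w (\<lambda>x. f (T x)))"

definition zeta where
  "zeta T = (\<lambda>u\<in>carrier G. u (bform T))"

lemma form_comp: "multilinear K n X Y T \<Longrightarrow> f \<in> carrier D \<Longrightarrow> form (\<lambda>x. f (T x))"
  by (rule multilinear_comp[OF _ Y.dualD(2)])

text \<open>Linearity in the functional is linearity of tensors on forms (\<open>W_linear\<close>);
  linearity in the tensor holds pointwise.\<close>

lemma bilinear_bform:
  assumes T: "multilinear K n X Y T" shows "bilinear_form K W D (bform T)"
  unfolding bilinear_form_def
proof (intro conjI ballI)
  fix w assume w: "w \<in> carrier W"
  show "linear_map K D (scalars K) (bform T w)"
    unfolding linear_map_def bform_def
  proof (intro conjI ballI funcsetI)
    fix f assume f: "f \<in> carrier D"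
    show "w (\<lambda>x. f (T x)) \<in> carrier (scalars K)" using W_value[OF w form_comp[OF T f]] by simp
    show "w (\<lambda>x. (c \<odot>\<^bsub>D\<^esub> f) (T x)) = c \<odot>\<^bsub>scalars K\<^esub> w (\<lambda>x. f (T x))" if c: "c \<in> K" for c
      using W_linear[OF w form_comp[OF T f] form_comp[OF T f] form_comp[OF T V.smult_in[OF c f]], of c 0]
        multilinear_in[OF T] by simp
    fix g assume g: "g \<in> carrier D"
    show "w (\<lambda>x. (f \<oplus>\<^bsub>D\<^esub> g) (T x)) = w (\<lambda>x. f (T x)) \<oplus>\<^bsub>scalars K\<^esub> w (\<lambda>x. g (T x))"
      using W_linear[OF w form_comp[OF T f] form_comp[OF T g] form_comp[OF T V.M.a_closed[OF f g]], of 1 1]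
        multilinear_in[OF T] by simp
  qed
next
  fix f assume "f \<in> carrier D"
  then show "linear_map K W (scalars K) (\<lambda>w. bform T w f)"
    unfolding linear_map_def bform_def using W_value[OF _ form_comp[OF T]] by auto
qed

lemma zeta_tv:
  "multilinear K n X Y T \<Longrightarrow> x \<in> P \<Longrightarrow> f \<in> carrier D \<Longrightarrow> zeta T (tv x f) = f (T x)"
  by (simp add: zeta_def, simp add: tensor_vec_def ten2_form[OF bilinear_bform], simp add: bform_def form_comp)

lemma ten2_bform:
  assumes T: "multilinear K n X Y T" and "x \<in> P" "y \<in> P" "f \<in> carrier D"
  shows "ten2 (tens x \<ominus>\<^bsub>W\<^esub> tens y) f (bform T) = f (T x \<ominus> T y)"
  unfolding ten2_form[OF bilinear_bform[OF T]]
  using assms by (simp add: bform_def form_comp Y.dualD(6) multilinear_in[OF T])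

lemma bounded_form_ip:
  assumes H: "hilbert_setting K H ip" and A: "bounded_multilinear K n X H A" and h: "h \<in> carrier H"
  shows "bounded_multilinear K n X (scalars K) (\<lambda>x. ip (A x) h)"
proof -
  interpret hilbert_setting K H ip by (rule H)
  have ml: "multilinear K n X H A" using A by (simp add: bounded_multilinear_def)
  have "cmod (ip (A x) h) \<le> (multilinear_norm n X H A * nrm H h) * pnorm x" if x: "x \<in> P" for x
  proof -
    have "cmod (ip (A x) h) \<le> nrm H (A x) * nrm H h"
      by (rule inner_product_cauchy_schwarz[OF H_normed ip multilinear_in[OF ml x] h])
    also have "\<dots> \<le> (multilinear_norm n X H A * pnorm x) * nrm H h"
      by (rule mult_right_mono[OF multilinear_bound[OF H_normed A x] nrm_nonneg[OF h]])
    finally show ?thesis by (simp add: mult_ac)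
  qed
  then show ?thesis
    using multilinear_comp[OF ml linear_ip[OF h]]
    by (auto simp: bounded_multilinear_def pnorm_def intro!: exI[of _ "multilinear_norm n X H A * nrm H h"])
qed

text \<open>For each \<open>h\<close> the relation between the pairs applies to the bounded form
  \<open>\<lambda>x. ip (A x) h\<close>; \<open>sum_nrm_mono\<close> then turns this family of
  scalar inequalities into one between norms.\<close>

lemma hilbert_diff_mono:
  assumes H: "hilbert_setting K H ip" and A: "bounded_multilinear K n X H A"
    and in_P: "\<And>i. i < m \<Longrightarrow> p i \<in> P \<and> q i \<in> P \<and> a i \<in> P \<and> b i \<in> P"
    and le: "pairs_le K n X m (\<lambda>i. tens (p i)) (\<lambda>i. tens (q i)) m (\<lambda>i. tens (a i)) (\<lambda>i. tens (b i))"
  shows "(\<Sum>i<m. (nrm H (A (p i) \<ominus>\<^bsub>H\<^esub> A (q i)))\<^sup>2) \<le> (\<Sum>i<m. (nrm H (A (a i) \<ominus>\<^bsub>H\<^esub> A (b i)))\<^sup>2)"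
proof -
  interpret hilbert_setting K H ip by (rule H)
  have ml: "multilinear K n X H A" using A by (simp add: bounded_multilinear_def)
  have AH: "A x \<in> carrier H" if "x \<in> P" for x by (rule multilinear_in[OF ml that])
  let ?d = "\<lambda>p q. map (\<lambda>i. A (p i) \<ominus>\<^bsub>H\<^esub> A (q i)) [0..<m]"
  have conv: "(\<Sum>d\<leftarrow>?d p q. g d) = (\<Sum>i<m. g (A (p i) \<ominus>\<^bsub>H\<^esub> A (q i)))" for p q and g :: "_ \<Rightarrow> real"
    by (simp add: comp_def interv_sum_list_conv_sum_set_nat atLeast0LessThan)
  have "(\<Sum>d\<leftarrow>?d p q. (nrm H d)\<^sup>2) \<le> (\<Sum>e\<leftarrow>?d a b. (nrm H e)\<^sup>2)"
  proof (rule sum_nrm_mono)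
    show "set (?d p q) \<subseteq> carrier H" "set (?d a b) \<subseteq> carrier H" using in_P AH by auto
    fix h assume h: "h \<in> carrier H"
    have b: "bounded_multilinear K n X (scalars K) (\<lambda>x. ip (A x) h)"
      by (rule bounded_form_ip[OF H A h])
    then have f: "form (\<lambda>x. ip (A x) h)" by (simp add: bounded_multilinear_def)
    show "(\<Sum>d\<leftarrow>?d p q. (cmod (ip d h))\<^sup>2) \<le> (\<Sum>e\<leftarrow>?d a b. (cmod (ip e h))\<^sup>2)"
      using le b f in_P AH h unfolding conv pairs_le_def by (auto simp: linearised_def ip_minus)
  qed
  then show ?thesis unfolding conv .
qed

text \<open>The linearisation of \<open>A\<close> has norm at most that of \<open>A\<close> with
  respect to the projective norm. Tensors are evaluated at scalar forms only, so a representation of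
  the difference is tested with the form \<open>\<lambda>x. ip (A x) d\<close>, where
  \<open>d\<close> is the difference of the images; this yields the square of the norm of
  \<open>d\<close>.\<close>

lemma hilbert_proj_norm:
  assumes H: "hilbert_setting K H ip" and A: "bounded_multilinear K n X H A"
    and x: "x \<in> P" and y: "y \<in> P"
  shows "nrm H (A x \<ominus>\<^bsub>H\<^esub> A y) \<le> multilinear_norm n X H A * \<pi> (tens x \<ominus>\<^bsub>W\<^esub> tens y)"
proof -
  interpret hilbert_setting K H ip by (rule H)
  have ml: "multilinear K n X H A" using A by (simp add: bounded_multilinear_def)
  have AH: "A x \<in> carrier H" if "x \<in> P" for x by (rule multilinear_in[OF ml that])
  define d where "d = A x \<ominus>\<^bsub>H\<^esub> A y"
  have d: "d \<in> carrier H" using AH x y by (simp add: d_def)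
  let ?N = "multilinear_norm n X H A" and ?w = "tens x \<ominus>\<^bsub>W\<^esub> tens y"
  have w: "?w \<in> carrier W" using x y by simp
  have N0: "0 \<le> ?N" by (rule multilinear_norm_nonneg[OF H_normed A])
  have key: "nrm H d \<le> ?N * (\<Sum>j<m. pnorm (z j))"
    if z: "\<forall>j<m. z j \<in> P" and eq: "?w = (\<lambda>\<phi>. \<Sum>j<m::nat. tens (z j) \<phi>)" for m z
  proof (cases "nrm H d = 0")
    case True
    then show ?thesis using N0 pnorm_nonneg z by (auto intro!: mult_nonneg_nonneg sum_nonneg)
  next
    case False
    then have pos: "nrm H d > 0" using nrm_nonneg[OF d] by simp
    have f: "form (\<lambda>x. ip (A x) d)"
      using bounded_form_ip[OF H A d] by (simp add: bounded_multilinear_def)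
    have "ip d d = (\<Sum>j<m. ip (A (z j)) d)"
      using fun_cong[OF eq, of "\<lambda>x. ip (A x) d"] f x y AH d by (simp add: d_def ip_minus)
    then have "(nrm H d)\<^sup>2 = cmod (\<Sum>j<m. ip (A (z j)) d)"
      using ip_rules(5)[OF d] by (metis norm_of_real abs_of_nonneg zero_le_power2)
    also have "\<dots> \<le> (\<Sum>j<m. cmod (ip (A (z j)) d))" by (rule norm_sum)
    also have "\<dots> \<le> (\<Sum>j<m. (?N * pnorm (z j)) * nrm H d)"
    proof (rule sum_mono)
      fix j assume "j \<in> {..<m}"
      then have zj: "z j \<in> P" using z by simp
      have "cmod (ip (A (z j)) d) \<le> nrm H (A (z j)) * nrm H d"
        by (rule inner_product_cauchy_schwarz[OF H_normed ip AH[OF zj] d])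
      also have "\<dots> \<le> (?N * pnorm (z j)) * nrm H d"
        by (rule mult_right_mono[OF multilinear_bound[OF H_normed A zj] nrm_nonneg[OF d]])
      finally show "cmod (ip (A (z j)) d) \<le> (?N * pnorm (z j)) * nrm H d" .
    qed
    also have "\<dots> = (?N * (\<Sum>j<m. pnorm (z j))) * nrm H d"
      by (simp add: sum_distrib_left sum_distrib_right)
    finally show ?thesis using pos by (simp add: power2_eq_square)
  qed
  show ?thesis
  proof (cases "?N = 0")
    case True
    \<comment> \<open>Division by \<open>?N\<close> is impossible here, but a single representation
      already forces the norm of \<open>d\<close> to be at most 0.\<close>
    obtain m z where "\<forall>j<m. z j \<in> P" "?w = (\<lambda>\<phi>. \<Sum>j<m::nat. tens (z j) \<phi>)" by (rule W_repr[OF w])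
    then show ?thesis using key True by (fastforce simp: d_def)
  next
    case False
    then have "nrm H d / ?N \<le> \<pi> ?w"
      using N0 key by (intro proj_norm_greatest[OF w]) (simp add: divide_le_eq mult.commute)
    then show ?thesis using False N0 by (simp add: d_def divide_le_eq mult.commute)
  qed
qed

text \<open>The infimum is attained: for a pair at positive distance the difference quotient is a
  lower bound of all Lipschitz constants, and for a pair at distance 0 any one of them forces the
  images to be at distance 0.\<close>

lemma lipschitz_const_Lip:
  assumes H: "normed_space K H" and M: "M \<subseteq> carrier H" and L: "\<exists>L. lipschitz_const H Y M B L"
  shows "lipschitz_const H Y M B (Lip H Y M B)"
proof -
  interpret H: gauged_module K H by (rule normed_space_gauged[OF H])
  have ne: "{L. lipschitz_const H Y M B L} \<noteq> {}" using L by auto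
  have "nrm Y (B u \<ominus> B v) \<le> Lip H Y M B * nrm H (u \<ominus>\<^bsub>H\<^esub> v)" if uv: "u \<in> M" "v \<in> M" for u v
  proof (cases "nrm H (u \<ominus>\<^bsub>H\<^esub> v) = 0")
    case True
    then show ?thesis using L uv by (force simp: lipschitz_const_def)
  next
    case False
    then have pos: "nrm H (u \<ominus>\<^bsub>H\<^esub> v) > 0"
      using H.nrm_nonneg[of "u \<ominus>\<^bsub>H\<^esub> v"] uv M by (simp add: less_le subset_iff)
    have "nrm Y (B u \<ominus> B v) / nrm H (u \<ominus>\<^bsub>H\<^esub> v) \<le> Lip H Y M B"
      unfolding Lip_def using uv pos
      by (intro cInf_greatest[OF ne]) (auto simp: lipschitz_const_def divide_le_eq)
    then show ?thesis using pos by (simp add: divide_le_eq)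
  qed
  moreover have "0 \<le> Lip H Y M B"
    unfolding Lip_def by (rule cInf_greatest[OF ne]) (auto simp: lipschitz_const_def)
  ultimately show ?thesis by (simp add: lipschitz_const_def)
qed

lemma zeta_bound:
  assumes T: "multilinear K n X Y T" and fac: "hilbert_factorization K n X Y T H A M B"
    and u: "u \<in> carrier G"
  shows "cmod (zeta T u) \<le> (multilinear_norm n X H A * Lip H Y M B) * gamma K n X D u"
proof -
  have hil: "hilbert_space K H" and MH: "M \<subseteq> carrier H"
    and A: "bounded_multilinear K n X H A" and AM: "A ` P \<subseteq> M"
    and TBA: "\<And>x. x \<in> P \<Longrightarrow> T x = B (A x)" and L: "\<exists>L. lipschitz_const H Y M B L"
    using fac by (auto simp: hilbert_factorization_def)
  have H_normed: "normed_space K H" using hil by (simp add: hilbert_space_def banach_space_def)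
  obtain ip where "inner_product K H ip" using hil by (auto simp: hilbert_space_def)
  then have H: "hilbert_setting K H ip"
    by (intro hilbert_setting.intro hilbert_setting_axioms.intro scalar_field_axioms H_normed)
  have Lip: "lipschitz_const H Y M B (Lip H Y M B)" by (rule lipschitz_const_Lip[OF H_normed MH L])
  let ?N = "multilinear_norm n X H A" and ?L = "Lip H Y M B"
  have N0: "0 \<le> ?N" by (rule multilinear_norm_nonneg[OF H_normed A])
  have L0: "0 \<le> ?L" using Lip by (simp add: lipschitz_const_def)
  have key: "cmod (zeta T u) \<le> (?N * ?L) * gamma_cost m v a b" if g: "gamma_repr u m p q v a b" for m p q v a b
  proof -
    have "\<exists>x\<in>P. r = tens x" if "r \<in> segre K n X" for r using that by (auto simp: segre_def)
    then have "\<forall>i. i < m \<longrightarrow> (\<exists>x y z w. x \<in> P \<and> y \<in> P \<and> z \<in> P \<and> w \<in> P \<and>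
        p i = tens x \<and> q i = tens y \<and> a i = tens z \<and> b i = tens w)"
      using g unfolding gamma_repr_def by meson
    then obtain p' q' a' b' where pq: "\<And>i. i < m \<Longrightarrow> p' i \<in> P \<and> q' i \<in> P \<and> a' i \<in> P \<and> b' i \<in> P \<and>
        p i = tens (p' i) \<and> q i = tens (q' i) \<and> a i = tens (a' i) \<and> b i = tens (b' i)"
      by metis
    have v: "v i \<in> carrier D" if "i < m" for i using g that by (simp add: gamma_repr_def)
    have TY: "T x \<in> carrier Y" if "x \<in> P" for x by (rule multilinear_in[OF T that])
    let ?s = "\<lambda>i. nrm H (A (p' i) \<ominus>\<^bsub>H\<^esub> A (q' i))"
    have "zeta T u = u (bform T)" using u by (simp add: zeta_def)
    also have "\<dots> = (\<Sum>i<m. ten2 (p i \<ominus>\<^bsub>W\<^esub> q i) (v i) (bform T))"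
      using g by (simp add: gamma_repr_def)
    also have "\<dots> = (\<Sum>i<m. v i (T (p' i) \<ominus> T (q' i)))"
      using pq v by (intro sum.cong) (simp_all add: ten2_bform[OF T] del: W_minus)
    finally have "cmod (zeta T u) \<le> (\<Sum>i<m. cmod (v i (T (p' i) \<ominus> T (q' i))))"
      by (simp add: norm_sum)
    \<comment> \<open>The absolute values give the form in which \<open>L2_set_mult_ineq\<close>,
      the Cauchy-Schwarz inequality for finite sums, applies.\<close>
    also have "\<dots> \<le> (\<Sum>i<m. ?L * (\<bar>nrm D (v i)\<bar> * \<bar>?s i\<bar>))"
    proof (rule sum_mono)
      fix i assume "i \<in> {..<m}"
      then have i: "i < m" by simp
      have "cmod (v i (T (p' i) \<ominus> T (q' i))) \<le> nrm D (v i) * nrm Y (T (p' i) \<ominus> T (q' i))"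
        using pq[OF i] TY by (intro Y.dual_bound[OF v[OF i]]) auto
      also have "\<dots> \<le> nrm D (v i) * (?L * ?s i)"
      proof (rule mult_left_mono[OF _ Y.dual_nonneg[OF v[OF i]]])
        have "A (p' i) \<in> M" "A (q' i) \<in> M" using AM pq[OF i] by auto
        then show "nrm Y (T (p' i) \<ominus> T (q' i)) \<le> ?L * ?s i"
          using Lip pq[OF i] TBA by (simp add: lipschitz_const_def)
      qed
      also have "\<dots> \<le> ?L * (\<bar>nrm D (v i)\<bar> * \<bar>?s i\<bar>)"
        using mult_left_mono[OF abs_ge_self[of "nrm D (v i) * ?s i"] L0] by (simp add: abs_mult mult_ac)
      finally show "cmod (v i (T (p' i) \<ominus> T (q' i))) \<le> ?L * (\<bar>nrm D (v i)\<bar> * \<bar>?s i\<bar>)" .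
    qed
    also have "\<dots> = ?L * (\<Sum>i<m. \<bar>nrm D (v i)\<bar> * \<bar>?s i\<bar>)" by (simp add: sum_distrib_left)
    also have "\<dots> \<le> ?L * (L2_set (\<lambda>i. nrm D (v i)) {..<m} * L2_set ?s {..<m})"
      by (rule mult_left_mono[OF L2_set_mult_ineq L0])
    also have "L2_set ?s {..<m} \<le> ?N * sqrt (\<Sum>i<m. (\<pi> (a i \<ominus>\<^bsub>W\<^esub> b i))\<^sup>2)"
    proof -
      have le: "pairs_le K n X m (\<lambda>i. tens (p' i)) (\<lambda>i. tens (q' i)) m (\<lambda>i. tens (a' i)) (\<lambda>i. tens (b' i))"
        using g pq by (simp add: gamma_repr_def pairs_le_def)
      have "(\<Sum>i<m. (?s i)\<^sup>2) \<le> (\<Sum>i<m. (nrm H (A (a' i) \<ominus>\<^bsub>H\<^esub> A (b' i)))\<^sup>2)"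
        using pq by (intro hilbert_diff_mono[OF H A _ le]) auto
      also have "\<dots> \<le> (\<Sum>i<m. (?N * \<pi> (a i \<ominus>\<^bsub>W\<^esub> b i))\<^sup>2)"
      proof (intro sum_mono power_mono)
        fix i assume "i \<in> {..<m}"
        then have i: "i < m" by simp
        show "nrm H (A (a' i) \<ominus>\<^bsub>H\<^esub> A (b' i)) \<le> ?N * \<pi> (a i \<ominus>\<^bsub>W\<^esub> b i)"
          using hilbert_proj_norm[OF H A, of "a' i" "b' i"] pq[OF i] by simp
        have "A (a' i) \<in> M" "A (b' i) \<in> M" using AM pq[OF i] by auto
        then have "A (a' i) \<ominus>\<^bsub>H\<^esub> A (b' i) \<in> carrier H"
          using MH by (intro kmodule.minus_in[OF normed_space_kmodule[OF H_normed]]) auto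
        then show "0 \<le> nrm H (A (a' i) \<ominus>\<^bsub>H\<^esub> A (b' i))"
          by (rule normed_spaceD(1)[OF H_normed])
      qed
      also have "\<dots> = ?N\<^sup>2 * (\<Sum>i<m. (\<pi> (a i \<ominus>\<^bsub>W\<^esub> b i))\<^sup>2)"
        by (simp add: power_mult_distrib sum_distrib_left)
      finally have "L2_set ?s {..<m} \<le> sqrt (?N\<^sup>2 * (\<Sum>i<m. (\<pi> (a i \<ominus>\<^bsub>W\<^esub> b i))\<^sup>2))"
        unfolding L2_set_def by (rule real_sqrt_le_mono)
      then show ?thesis unfolding real_sqrt_mult real_sqrt_abs abs_of_nonneg[OF N0] .
    qed
    then have "?L * (L2_set (\<lambda>i. nrm D (v i)) {..<m} * L2_set ?s {..<m}) \<le>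
        ?L * (L2_set (\<lambda>i. nrm D (v i)) {..<m} * (?N * sqrt (\<Sum>i<m. (\<pi> (a i \<ominus>\<^bsub>W\<^esub> b i))\<^sup>2)))"
      by (intro mult_left_mono L0 L2_set_nonneg)
    finally show ?thesis by (simp add: gamma_cost_def L2_set_def mult_ac)
  qed
  show ?thesis
  proof (cases "?N * ?L = 0")
    case True
    \<comment> \<open>When the constant vanishes one cannot divide by it to reach the infimum; one
      representation suffices to get \<open>zeta T u = 0\<close>.\<close>
    then show ?thesis using key gamma_repr_exists[OF u] by fastforce
  next
    case False
    then have pos: "?N * ?L > 0" using N0 L0 by simp
    have "cmod (zeta T u) / (?N * ?L) \<le> gamma K n X D u"
    proof (rule gamma_greatest[OF u])
      fix m p q v a b assume "gamma_repr u m p q v a b"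
      from key[OF this] show "cmod (zeta T u) / (?N * ?L) \<le> gamma_cost m v a b"
        unfolding pos_divide_le_eq[OF pos] by (simp add: mult_ac)
    qed
    then show ?thesis unfolding pos_divide_le_eq[OF pos] by (simp add: mult_ac)
  qed
qed

lemma zeta_dual:
  assumes T: "multilinear K n X Y T" and "hilbert_factorization K n X Y T H A M B"
  shows "zeta T \<in> carrier (dual_space K G)"
proof (rule G.dualI)
  show "zeta T \<in> extensional (carrier G)" by (simp add: zeta_def)
  show "cmod (zeta T u) \<le> (multilinear_norm n X H A * Lip H Y M B) * nrm G u" if "u \<in> carrier G" for u
    using zeta_bound[OF assms that] by simp
  show "zeta T u \<in> K" if "u \<in> carrier G" for u
    using that
  proof (induction rule: G_induct)
    case zero
    show ?case by (simp add: zeta_def G_closed)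
  next
    case (step x f u)
    then show ?case
      using zeta_tv[OF T, of x f] Y.dualD(3)[of f "T x"] multilinear_in[OF T, of x]
      by (simp add: zeta_def G_closed)
  qed
qed (simp_all add: zeta_def G_closed)

end

section \<open>From a functional to a factorization\<close>

type_synonym 'a tuple_pair = "(nat \<Rightarrow> 'a) \<times> (nat \<Rightarrow> 'a)"

text \<open>Instantiated twice: with \<open>zeta T\<close> for a factorable \<open>T\<close>, to
  compare the norms, and with a given functional, to show surjectivity. In the second case
  factorability of \<open>T\<close> is still to be proved, so only multilinearity is
  assumed.\<close>

locale gamma_functional = gamma_duality K n X Y for K n and X :: "nat \<Rightarrow> 'a nspace" and Y :: "'y nspace" (structure) +
  fixes \<zeta> T
  assumes \<zeta>: "\<zeta> \<in> carrier (dual_space K (gamma_tensor K n X (dual_space K Y)))"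
    and T: "multilinear K n X Y T"
    and \<zeta>_tv: "\<And>x f. x \<in> prod_carrier n X \<Longrightarrow> f \<in> carrier (dual_space K Y) \<Longrightarrow>
      \<zeta> (tensor_vec K n X (dual_space K Y) x f) = f (T x)"
begin

definition C where "C = nrm (dual_space K G) \<zeta>"

lemma C_nonneg: "0 \<le> C"
  unfolding C_def by (rule G.dual_nonneg[OF \<zeta>])

lemma TY: "x \<in> P \<Longrightarrow> T x \<in> carrier Y"
  by (rule multilinear_in[OF T])

lemma \<zeta>_sum:
  assumes "\<And>i. i < m \<Longrightarrow> p i \<in> P \<and> q i \<in> P \<and> v i \<in> carrier D"
  shows "(\<lambda>\<beta>. \<Sum>i<m::nat. ten2 (tens (p i) \<ominus>\<^bsub>W\<^esub> tens (q i)) (v i) \<beta>) \<in> carrier G \<and>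
    \<zeta> (\<lambda>\<beta>. \<Sum>i<m. ten2 (tens (p i) \<ominus>\<^bsub>W\<^esub> tens (q i)) (v i) \<beta>) = (\<Sum>i<m. v i (T (p i) \<ominus> T (q i)))"
  using assms
proof (induction m)
  case 0
  show ?case using G.dualD(8)[OF \<zeta>] G_closed by simp
next
  case (Suc m)
  let ?u = "\<lambda>\<beta>. \<Sum>i<m. ten2 (tens (p i) \<ominus>\<^bsub>W\<^esub> tens (q i)) (v i) \<beta>"
  let ?t = "ten2 (tens (p m) \<ominus>\<^bsub>W\<^esub> tens (q m)) (v m)"
  have pq: "p m \<in> P" "q m \<in> P" "v m \<in> carrier D" using Suc.prems[of m] by auto
  have u: "?u \<in> carrier G" "\<zeta> ?u = (\<Sum>i<m. v i (T (p i) \<ominus> T (q i)))"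
    using Suc by auto
  have eq: "?t = tv (p m) (v m) \<ominus>\<^bsub>G\<^esub> tv (q m) (v m)"
    using pq by (simp add: G.minus_eq ten2_minus tensor_vec_def)
  have t: "?t \<in> carrier G" unfolding eq using pq by simp
  have "\<zeta> ?t = v m (T (p m) \<ominus> T (q m))"
    unfolding eq using pq by (simp add: G.dualD(6)[OF \<zeta>] \<zeta>_tv Y.dualD(6) TY)
  then show ?case using G.dualD(4)[OF \<zeta> u(1) t] G_closed(2)[OF u(1) t] u(2) by simp
qed

lemma summing_inequality_index:
  assumes P: "\<And>i. i < m \<Longrightarrow> p i \<in> P \<and> q i \<in> P \<and> a i \<in> P \<and> b i \<in> P"
    and le: "pairs_le K n X m (\<lambda>i. tens (p i)) (\<lambda>i. tens (q i)) m (\<lambda>i. tens (a i)) (\<lambda>i. tens (b i))"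
  shows "(\<Sum>i<m. (nrm Y (T (p i) \<ominus> T (q i)))\<^sup>2)
    \<le> C\<^sup>2 * (\<Sum>i<m. (\<pi> (tens (a i) \<ominus>\<^bsub>W\<^esub> tens (b i)))\<^sup>2)"
proof -
  let ?y = "\<lambda>i. T (p i) \<ominus> T (q i)"
  define S where "S = (\<Sum>i<m. (nrm Y (?y i))\<^sup>2)"
  define R where "R = (\<Sum>i<m. (\<pi> (tens (a i) \<ominus>\<^bsub>W\<^esub> tens (b i)))\<^sup>2)"
  have "\<exists>f. f \<in> carrier D \<and> f (?y i) = complex_of_real ((nrm Y (?y i))\<^sup>2) \<and> nrm D f \<le> nrm Y (?y i)"
    if i: "i < m" for i
  proof -
    have y: "?y i \<in> carrier Y" using P[OF i] TY by simp
    obtain f where f: "f \<in> carrier D" "f (?y i) = complex_of_real (nrm Y (?y i))" "nrm D f \<le> 1"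
      using norming_functional[OF Y_normed y] by blast
    \<comment> \<open>The weight makes \<open>\<zeta>\<close> take the value \<open>S\<close> at the
      test element, while the squared norms of the functionals sum to at most \<open>S\<close>. The
      resulting \<open>S \<le> C * (sqrt R * sqrt S)\<close> allows a factor \<open>sqrt S\<close>
      to be cancelled.\<close>
    let ?g = "complex_of_real (nrm Y (?y i)) \<odot>\<^bsub>D\<^esub> f"
    have "nrm D ?g = nrm Y (?y i) * nrm D f"
      using normed_spaceD(4)[OF Y.normed_dual _ f(1)] Y.nrm_nonneg[OF y] by (simp del: Y.dual_simps)
    then have "nrm D ?g \<le> nrm Y (?y i)"
      using mult_left_mono[OF f(3) Y.nrm_nonneg[OF y]] by simp
    moreover have "?g (?y i) = complex_of_real ((nrm Y (?y i))\<^sup>2)"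
      using f(2) y by (simp add: power2_eq_square)
    moreover have "?g \<in> carrier D" by (rule V.smult_in[OF K_closed(3) f(1)])
    ultimately show ?thesis by blast
  qed
  then obtain v where v: "\<And>i. i < m \<Longrightarrow> v i \<in> carrier D"
    "\<And>i. i < m \<Longrightarrow> v i (?y i) = complex_of_real ((nrm Y (?y i))\<^sup>2)"
    "\<And>i. i < m \<Longrightarrow> nrm D (v i) \<le> nrm Y (?y i)" by metis
  define u where "u = (\<lambda>\<beta>. \<Sum>i<m. ten2 (tens (p i) \<ominus>\<^bsub>W\<^esub> tens (q i)) (v i) \<beta>)"
  have u: "u \<in> carrier G" "\<zeta> u = (\<Sum>i<m. v i (?y i))"
    unfolding u_def using \<zeta>_sum[of m p q v] P v by auto
  have S0: "0 \<le> S" "0 \<le> R" by (simp_all add: S_def R_def sum_nonneg)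
  have "\<zeta> u = complex_of_real S" using v u by (simp add: S_def)
  then have "S \<le> C * gamma K n X D u"
    using G.dual_bound[OF \<zeta> u(1)] S0 by (simp add: C_def)
  also have "gamma K n X D u \<le> gamma_cost m v (\<lambda>i. tens (a i)) (\<lambda>i. tens (b i))"
    using P v le by (intro gamma_lower) (auto simp: gamma_repr_def u_def)
  also have "\<dots> \<le> sqrt R * sqrt S"
    unfolding gamma_cost_def R_def S_def
    using v Y.dual_nonneg by (intro mult_left_mono real_sqrt_le_mono sum_mono power_mono) (auto simp: sum_nonneg)
  finally have SC: "S \<le> C * (sqrt R * sqrt S)" using C_nonneg by (simp add: mult_left_mono)
  have "S \<le> C\<^sup>2 * R"
  proof (cases "S = 0")
    case False
    then have pos: "sqrt S > 0" using S0 by simp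
    have "sqrt S * sqrt S \<le> (C * sqrt R) * sqrt S" using SC S0 by (simp add: mult_ac)
    then have "sqrt S \<le> C * sqrt R" by (rule mult_right_le_imp_le) (rule pos)
    then have "(sqrt S)\<^sup>2 \<le> (C * sqrt R)\<^sup>2" using pos by (intro power_mono) auto
    then show ?thesis using S0 by (simp add: power_mult_distrib)
  qed (use S0 in simp)
  then show ?thesis by (simp add: S_def R_def)
qed

section \<open>Quadratic costs of finite families of pairs; as lists, families are added by
  concatenation\<close>

definition energy :: "'a tuple_pair list \<Rightarrow> ((nat \<Rightarrow> 'a) \<Rightarrow> complex) \<Rightarrow> real" where
  "energy L \<phi> = (\<Sum>(x, y)\<leftarrow>L. (cmod (tens x \<phi> - tens y \<phi>))\<^sup>2)"

definition proj_cost :: "'a tuple_pair list \<Rightarrow> real" where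
  "proj_cost L = (\<Sum>(x, y)\<leftarrow>L. (\<pi> (tens x \<ominus>\<^bsub>W\<^esub> tens y))\<^sup>2)"

definition image_cost :: "'a tuple_pair list \<Rightarrow> real" where
  "image_cost L = (\<Sum>(x, y)\<leftarrow>L. (nrm Y (T x \<ominus> T y))\<^sup>2)"

text \<open>The square root appears because all three costs are quadratic: scaling the tuples by
  \<open>sqrt t\<close> multiplies each cost by \<open>t\<close>.\<close>

definition scale_pairs :: "real \<Rightarrow> 'a tuple_pair list \<Rightarrow> 'a tuple_pair list" where
  "scale_pairs t = map (\<lambda>(x, y). (scale_tuple (complex_of_real (sqrt t)) x, scale_tuple (complex_of_real (sqrt t)) y))"

abbreviation pairs :: "'a tuple_pair list \<Rightarrow> bool" where
  "pairs L \<equiv> set L \<subseteq> P \<times> P"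

abbreviation "\<Phi> \<equiv> {\<phi>. bounded_multilinear K n X (scalars K) \<phi>}"

lemma cost_simps [simp]:
  "energy [] \<phi> = 0" "proj_cost [] = 0" "image_cost [] = 0"
  "energy ((x, y) # L) \<phi> = (cmod (tens x \<phi> - tens y \<phi>))\<^sup>2 + energy L \<phi>"
  "proj_cost ((x, y) # L) = (\<pi> (tens x \<ominus>\<^bsub>W\<^esub> tens y))\<^sup>2 + proj_cost L"
  "image_cost ((x, y) # L) = (nrm Y (T x \<ominus> T y))\<^sup>2 + image_cost L"
  "energy (L @ L') \<phi> = energy L \<phi> + energy L' \<phi>"
  "proj_cost (L @ L') = proj_cost L + proj_cost L'"
  "image_cost (L @ L') = image_cost L + image_cost L'"
  by (simp_all add: energy_def proj_cost_def image_cost_def)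

lemma energy_nonneg: "0 \<le> energy L \<phi>"
  by (auto simp: energy_def intro!: sum_list_nonneg)

lemma pairs_scale: "pairs L \<Longrightarrow> pairs (scale_pairs t L)"
  by (auto simp: scale_pairs_def)

lemma energy_scale: "pairs L \<Longrightarrow> t > 0 \<Longrightarrow> energy (scale_pairs t L) \<phi> = t * energy L \<phi>"
proof (induction L)
  case (Cons z L)
  obtain x y where z: "z = (x, y)" by force
  have "(cmod (complex_of_real (sqrt t) * tens x \<phi> - complex_of_real (sqrt t) * tens y \<phi>))\<^sup>2
      = t * (cmod (tens x \<phi> - tens y \<phi>))\<^sup>2"
    using Cons.prems(2) by (simp add: right_diff_distrib[symmetric] norm_mult power_mult_distrib)
  then show ?case using Cons z by (simp add: scale_pairs_def tens_scale algebra_simps)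
qed (simp add: scale_pairs_def)

lemma proj_cost_scale: "pairs L \<Longrightarrow> t > 0 \<Longrightarrow> proj_cost (scale_pairs t L) = t * proj_cost L"
proof (induction L)
  case (Cons z L)
  obtain x y where z: "z = (x, y)" by force
  then have xy: "x \<in> P" "y \<in> P" using Cons by auto
  let ?s = "complex_of_real (sqrt t)"
  have "tens (scale_tuple ?s x) \<ominus>\<^bsub>W\<^esub> tens (scale_tuple ?s y) = (\<lambda>\<phi>. ?s * (tens x \<phi> - tens y \<phi>))"
    using xy by (simp add: tens_scale right_diff_distrib)
  then have "\<pi> (tens (scale_tuple ?s x) \<ominus>\<^bsub>W\<^esub> tens (scale_tuple ?s y))
      = sqrt t * \<pi> (tens x \<ominus>\<^bsub>W\<^esub> tens y)"
    using xy Cons.prems(2) proj_norm_scale[of "\<lambda>\<phi>. tens x \<phi> - tens y \<phi>" "sqrt t"] by simp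
  then show ?case using Cons z by (simp add: scale_pairs_def power_mult_distrib algebra_simps del: W_minus)
qed (simp add: scale_pairs_def)

lemma image_cost_scale: "pairs L \<Longrightarrow> t > 0 \<Longrightarrow> image_cost (scale_pairs t L) = t * image_cost L"
proof (induction L)
  case (Cons z L)
  obtain x y where z: "z = (x, y)" by force
  then have xy: "x \<in> P" "y \<in> P" using Cons by auto
  let ?s = "complex_of_real (sqrt t)"
  have "T (scale_tuple ?s x) \<ominus> T (scale_tuple ?s y) = ?s \<odot> (T x \<ominus> T y)"
    using xy TY by (simp add: multilinear_scale[OF T] Y.minus_eq Y.smult_distr_vec Y.smult_smult)
  then have "nrm Y (T (scale_tuple ?s x) \<ominus> T (scale_tuple ?s y)) = sqrt t * nrm Y (T x \<ominus> T y)"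
    using xy Cons.prems(2) TY by (simp add: Y.nrm_scale)
  then show ?case using Cons z by (simp add: scale_pairs_def power_mult_distrib algebra_simps)
qed (simp add: scale_pairs_def)

lemma replicate_costs:
  "energy (replicate k (zero_tuple, zero_tuple)) \<phi> = 0"
  "proj_cost (replicate k (zero_tuple, zero_tuple)) = 0"
  "image_cost (replicate k (zero_tuple, zero_tuple)) = 0"
  by (induction k) (simp_all add: proj_norm_zero TY Y.nrm_zero)

text \<open>In \<open>gamma\<close> both families have the same length, so each list is padded with
  pairs of zero tuples, which contribute nothing to any cost.\<close>

lemma summing_inequality:
  assumes L: "pairs L" "pairs L'" and le: "\<And>\<phi>. \<phi> \<in> \<Phi> \<Longrightarrow> energy L \<phi> \<le> energy L' \<phi>"
  shows "image_cost L \<le> C\<^sup>2 * proj_cost L'"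
proof -
  let ?r = "\<lambda>k. replicate k (zero_tuple, zero_tuple)"
  define A where "A = L @ ?r (length L')"
  define B where "B = L' @ ?r (length L)"
  define m where "m = length A"
  have mB: "m = length B" by (simp add: m_def A_def B_def)
  have A: "pairs A" and B: "pairs B" using L by (auto simp: A_def B_def)
  have conv: "(\<Sum>(x, y)\<leftarrow>Z. g x y) = (\<Sum>i<m. g (fst (Z ! i)) (snd (Z ! i)))"
    if "length Z = m" for Z :: "'a tuple_pair list" and g :: "_ \<Rightarrow> _ \<Rightarrow> real"
    using that by (simp add: sum_list_sum_nth atLeast0LessThan case_prod_beta)
  have P: "fst (A ! i) \<in> P \<and> snd (A ! i) \<in> P \<and> fst (B ! i) \<in> P \<and> snd (B ! i) \<in> P" if "i < m" for i
  proof -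
    have "A ! i \<in> P \<times> P" using A nth_mem that m_def by blast
    moreover have "B ! i \<in> P \<times> P" using B nth_mem that mB by blast
    ultimately show ?thesis by (simp add: mem_Times_iff)
  qed
  have "pairs_le K n X m (\<lambda>i. tens (fst (A ! i))) (\<lambda>i. tens (snd (A ! i)))
      m (\<lambda>i. tens (fst (B ! i))) (\<lambda>i. tens (snd (B ! i)))"
    unfolding pairs_le_def
  proof (intro allI impI)
    fix \<phi> assume "bounded_multilinear K n X (scalars K) \<phi>"
    then have "energy A \<phi> \<le> energy B \<phi>" using le by (simp add: A_def B_def replicate_costs)
    then show "(\<Sum>i<m. (cmod (linearised \<phi> (tens (fst (A ! i))) - linearised \<phi> (tens (snd (A ! i)))))\<^sup>2)
        \<le> (\<Sum>i<m. (cmod (linearised \<phi> (tens (fst (B ! i))) - linearised \<phi> (tens (snd (B ! i)))))\<^sup>2)"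
      unfolding energy_def linearised_def using conv[of A] conv[of B] m_def mB by simp
  qed
  from summing_inequality_index[OF P this]
  have "image_cost A \<le> C\<^sup>2 * proj_cost B"
    unfolding image_cost_def proj_cost_def using conv[of A] conv[of B] m_def mB by simp
  then show ?thesis by (simp add: A_def B_def replicate_costs)
qed

text \<open>The order ideal generated by the energies, with order taken on \<open>\<Phi>\<close>
  only. Domination by an energy is what makes \<open>gauge\<close> finite. Scalars have type
  \<open>complex\<close> in every space, so the real scalar is read off with
  \<open>Re\<close>.\<close>

definition FR :: "(((nat \<Rightarrow> 'a) \<Rightarrow> complex) \<Rightarrow> real) nspace" where
  "FR = \<lparr>carrier = {g. \<exists>L. pairs L \<and> (\<forall>\<phi>\<in>\<Phi>. \<bar>g \<phi>\<bar> \<le> energy L \<phi>)},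
     mult = undefined, one = undefined, zero = (\<lambda>\<phi>. 0), add = (\<lambda>f g. \<lambda>\<phi>. f \<phi> + g \<phi>),
     smult = (\<lambda>c g. \<lambda>\<phi>. Re c * g \<phi>), nrm = undefined\<rparr>"

lemma FR_simps [simp]:
  "\<zero>\<^bsub>FR\<^esub> = (\<lambda>\<phi>. 0)" "f \<oplus>\<^bsub>FR\<^esub> g = (\<lambda>\<phi>. f \<phi> + g \<phi>)" "c \<odot>\<^bsub>FR\<^esub> g = (\<lambda>\<phi>. Re c * g \<phi>)"
  by (simp_all add: FR_def)

lemma FR_I: "pairs L \<Longrightarrow> (\<And>\<phi>. \<phi> \<in> \<Phi> \<Longrightarrow> \<bar>g \<phi>\<bar> \<le> energy L \<phi>) \<Longrightarrow> g \<in> carrier FR"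
  by (auto simp: FR_def)

lemma FR_E: 
  assumes "g \<in> carrier FR"
  obtains L where "pairs L" "\<And>\<phi>. \<phi> \<in> \<Phi> \<Longrightarrow> \<bar>g \<phi>\<bar> \<le> energy L \<phi>"
  using assms by (auto simp: FR_def)

lemma FR_zero: "(\<lambda>\<phi>. 0) \<in> carrier FR"
  by (rule FR_I[of "[]"]) auto

lemma FR_add:
  assumes "f \<in> carrier FR" "g \<in> carrier FR" shows "(\<lambda>\<phi>. f \<phi> + g \<phi>) \<in> carrier FR"
proof -
  obtain L where L: "pairs L" "\<And>\<phi>. \<phi> \<in> \<Phi> \<Longrightarrow> \<bar>f \<phi>\<bar> \<le> energy L \<phi>" using FR_E[OF assms(1)] by blast
  obtain L' where L': "pairs L'" "\<And>\<phi>. \<phi> \<in> \<Phi> \<Longrightarrow> \<bar>g \<phi>\<bar> \<le> energy L' \<phi>" using FR_E[OF assms(2)] by blast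
  show ?thesis
  proof (rule FR_I[of "L @ L'"])
    fix \<phi> assume "\<phi> \<in> \<Phi>"
    from L(2)[OF this] L'(2)[OF this] show "\<bar>f \<phi> + g \<phi>\<bar> \<le> energy (L @ L') \<phi>" by simp
  qed (use L L' in simp)
qed

lemma FR_smult:
  assumes "g \<in> carrier FR" shows "(\<lambda>\<phi>. r * g \<phi>) \<in> carrier FR"
proof -
  obtain L where L: "pairs L" "\<And>\<phi>. \<phi> \<in> \<Phi> \<Longrightarrow> \<bar>g \<phi>\<bar> \<le> energy L \<phi>" using FR_E[OF assms] by blast
  show ?thesis
  proof (cases "r = 0")
    case False
    show ?thesis
    proof (rule FR_I[OF pairs_scale[OF L(1), of "\<bar>r\<bar>"]])
      fix \<phi> assume "\<phi> \<in> \<Phi>"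
      then show "\<bar>r * g \<phi>\<bar> \<le> energy (scale_pairs \<bar>r\<bar> L) \<phi>"
        using L False by (simp add: energy_scale abs_mult mult_left_mono)
    qed
  qed (simp add: FR_zero)
qed

lemma FR_module: "kmodule \<real> FR"
proof -
  interpret R: scalar_field \<real> by unfold_locales simp
  show ?thesis
    by (intro R.kmoduleI R.module_scalarsI)
      (auto simp: FR_zero FR_add FR_smult complex_is_Real_iff distrib_left distrib_right add_ac mult.assoc)
qed

lemma FR_energy: "pairs L \<Longrightarrow> energy L \<in> carrier FR"
  by (rule FR_I) (auto simp: energy_nonneg)

text \<open>A linear functional below this gauge is positive and has both required bounds: take
  \<open>L\<close>, \<open>L'\<close> or both empty.\<close>

definition gauge :: "(((nat \<Rightarrow> 'a) \<Rightarrow> complex) \<Rightarrow> real) \<Rightarrow> real" where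
  "gauge g = Inf {C\<^sup>2 * proj_cost L' - image_cost L |L L'. pairs L \<and> pairs L' \<and>
     (\<forall>\<phi>\<in>\<Phi>. g \<phi> + energy L \<phi> \<le> energy L' \<phi>)}"

text \<open>If \<open>L0\<close> dominates \<open>g\<close> in absolute value, then admissible lists
  satisfy \<open>energy L \<le> energy (L' @ L0)\<close> on \<open>\<Phi>\<close>, and
  \<open>summing_inequality\<close> gives the lower bound
  \<open>- (C\<^sup>2 * proj_cost L0)\<close>.\<close>

lemma gauge_bdd:
  assumes "g \<in> carrier FR"
  shows "bdd_below {C\<^sup>2 * proj_cost L' - image_cost L |L L'. pairs L \<and> pairs L' \<and>
     (\<forall>\<phi>\<in>\<Phi>. g \<phi> + energy L \<phi> \<le> energy L' \<phi>)}"
proof -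
  obtain L0 where L0: "pairs L0" "\<And>\<phi>. \<phi> \<in> \<Phi> \<Longrightarrow> \<bar>g \<phi>\<bar> \<le> energy L0 \<phi>" using FR_E[OF assms] by blast
  show ?thesis
  proof (rule bdd_belowI)
    fix r assume "r \<in> {C\<^sup>2 * proj_cost L' - image_cost L |L L'. pairs L \<and> pairs L' \<and>
       (\<forall>\<phi>\<in>\<Phi>. g \<phi> + energy L \<phi> \<le> energy L' \<phi>)}"
    then obtain L L' where L: "pairs L" "pairs L'" "\<forall>\<phi>\<in>\<Phi>. g \<phi> + energy L \<phi> \<le> energy L' \<phi>"
      and r: "r = C\<^sup>2 * proj_cost L' - image_cost L" by blast
    have "image_cost L \<le> C\<^sup>2 * proj_cost (L' @ L0)"
    proof (rule summing_inequality)
      fix \<phi> assume "\<phi> \<in> \<Phi>"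
      then show "energy L \<phi> \<le> energy (L' @ L0) \<phi>" using L(3) L0(2) by fastforce
    qed (use L L0 in auto)
    then show "- (C\<^sup>2 * proj_cost L0) \<le> r" by (simp add: r algebra_simps)
  qed
qed

lemma gauge_le:
  "g \<in> carrier FR \<Longrightarrow> pairs L \<Longrightarrow> pairs L' \<Longrightarrow> (\<And>\<phi>. \<phi> \<in> \<Phi> \<Longrightarrow> g \<phi> + energy L \<phi> \<le> energy L' \<phi>) \<Longrightarrow>
    gauge g \<le> C\<^sup>2 * proj_cost L' - image_cost L"
  unfolding gauge_def by (rule cInf_lower[OF _ gauge_bdd]) auto

lemma gauge_greatest:
  assumes "g \<in> carrier FR"
    and "\<And>L L'. pairs L \<Longrightarrow> pairs L' \<Longrightarrow> (\<And>\<phi>. \<phi> \<in> \<Phi> \<Longrightarrow> g \<phi> + energy L \<phi> \<le> energy L' \<phi>) \<Longrightarrow>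
      r \<le> C\<^sup>2 * proj_cost L' - image_cost L"
  shows "r \<le> gauge g"
proof -
  obtain L0 where L0: "pairs L0" "\<And>\<phi>. \<phi> \<in> \<Phi> \<Longrightarrow> \<bar>g \<phi>\<bar> \<le> energy L0 \<phi>" using FR_E[OF assms(1)] by blast
  have le0: "\<forall>\<phi>\<in>\<Phi>. g \<phi> + energy [] \<phi> \<le> energy L0 \<phi>" using L0(2) by fastforce
  let ?S = "{C\<^sup>2 * proj_cost L' - image_cost L |L L'. pairs L \<and> pairs L' \<and>
     (\<forall>\<phi>\<in>\<Phi>. g \<phi> + energy L \<phi> \<le> energy L' \<phi>)}"
  \<comment> \<open>A dominating list together with the empty one is admissible, so the infimum is
    over a nonempty set.\<close>
  have "C\<^sup>2 * proj_cost L0 - image_cost [] \<in> ?S"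
    by (rule CollectI, rule exI[of _ "[]"], rule exI[of _ L0]) (use le0 L0(1) in simp)
  moreover have "r \<le> y" if "y \<in> ?S" for y using that assms(2) by blast
  ultimately show ?thesis unfolding gauge_def by (intro cInf_greatest) blast+
qed

lemma gauge_smult_le:
  assumes g: "g \<in> carrier FR" and t: "t > 0"
  shows "gauge (\<lambda>\<phi>. t * g \<phi>) \<le> t * gauge g"
proof -
  have "gauge (\<lambda>\<phi>. t * g \<phi>) / t \<le> gauge g"
  proof (rule gauge_greatest[OF g])
    fix L L' assume L: "pairs L" "pairs L'" and le: "\<And>\<phi>. \<phi> \<in> \<Phi> \<Longrightarrow> g \<phi> + energy L \<phi> \<le> energy L' \<phi>"
    have "gauge (\<lambda>\<phi>. t * g \<phi>) \<le> C\<^sup>2 * proj_cost (scale_pairs t L') - image_cost (scale_pairs t L)"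
    proof (rule gauge_le[OF FR_smult[OF g] pairs_scale[OF L(1)] pairs_scale[OF L(2)]])
      fix \<phi> assume "\<phi> \<in> \<Phi>"
      then show "t * g \<phi> + energy (scale_pairs t L) \<phi> \<le> energy (scale_pairs t L') \<phi>"
        using mult_left_mono[OF le, of \<phi> t] L t by (simp add: energy_scale distrib_left)
    qed
    also have "\<dots> = t * (C\<^sup>2 * proj_cost L' - image_cost L)"
      using L t by (simp add: proj_cost_scale image_cost_scale algebra_simps)
    finally show "gauge (\<lambda>\<phi>. t * g \<phi>) / t \<le> C\<^sup>2 * proj_cost L' - image_cost L"
      using t by (simp add: divide_le_eq mult.commute)
  qed
  then show ?thesis using t by (simp add: divide_le_eq mult.commute)
qed

text \<open>Nonnegativity at the zero function is \<open>summing_inequality\<close> itself.\<close>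

lemma gauge_zero: "gauge (\<lambda>\<phi>. 0) = 0"
proof (rule antisym)
  show "gauge (\<lambda>\<phi>. 0) \<le> 0" using gauge_le[OF FR_zero, of "[]" "[]"] by simp
  show "0 \<le> gauge (\<lambda>\<phi>. 0)"
    using summing_inequality by (intro gauge_greatest[OF FR_zero]) simp
qed

text \<open>Concatenations of lists admissible for \<open>f\<close> and for \<open>g\<close> are
  admissible for the sum, and all costs are additive. Homogeneity comes from
  \<open>scale_pairs\<close> with the factors \<open>t\<close> and \<open>1 / t\<close>.\<close>

lemma gauge_sublinear: "sublinear FR gauge"
  unfolding sublinear_def
proof (intro conjI ballI allI impI)
  fix f g assume f: "f \<in> carrier FR" and g: "g \<in> carrier FR"
  have fg: "(\<lambda>\<phi>. f \<phi> + g \<phi>) \<in> carrier FR" by (rule FR_add[OF f g])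
  have *: "gauge (\<lambda>\<phi>. f \<phi> + g \<phi>) - (C\<^sup>2 * proj_cost M' - image_cost M) \<le> gauge f"
    if M: "pairs M" "pairs M'" "\<And>\<phi>. \<phi> \<in> \<Phi> \<Longrightarrow> g \<phi> + energy M \<phi> \<le> energy M' \<phi>" for M M'
  proof (rule gauge_greatest[OF f])
    fix L L' assume L: "pairs L" "pairs L'" and le: "\<And>\<phi>. \<phi> \<in> \<Phi> \<Longrightarrow> f \<phi> + energy L \<phi> \<le> energy L' \<phi>"
    have "gauge (\<lambda>\<phi>. f \<phi> + g \<phi>) \<le> C\<^sup>2 * proj_cost (L' @ M') - image_cost (L @ M)"
    proof (rule gauge_le[OF fg])
      fix \<phi> assume "\<phi> \<in> \<Phi>"
      from le[OF this] M(3)[OF this]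
      show "f \<phi> + g \<phi> + energy (L @ M) \<phi> \<le> energy (L' @ M') \<phi>" by simp
    qed (use L M in auto)
    then show "gauge (\<lambda>\<phi>. f \<phi> + g \<phi>) - (C\<^sup>2 * proj_cost M' - image_cost M)
        \<le> C\<^sup>2 * proj_cost L' - image_cost L" by (simp add: algebra_simps)
  qed
  have "gauge (\<lambda>\<phi>. f \<phi> + g \<phi>) - gauge f \<le> gauge g"
  proof (rule gauge_greatest[OF g])
    fix M M' assume "pairs M" "pairs M'" "\<And>\<phi>. \<phi> \<in> \<Phi> \<Longrightarrow> g \<phi> + energy M \<phi> \<le> energy M' \<phi>"
    from *[OF this] show "gauge (\<lambda>\<phi>. f \<phi> + g \<phi>) - gauge f \<le> C\<^sup>2 * proj_cost M' - image_cost M" by simp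
  qed
  then show "gauge (f \<oplus>\<^bsub>FR\<^esub> g) \<le> gauge f + gauge g" by simp
next
  fix t :: real and g assume t: "0 \<le> t" and g: "g \<in> carrier FR"
  show "gauge (complex_of_real t \<odot>\<^bsub>FR\<^esub> g) = t * gauge g"
  proof (cases "t = 0")
    case True
    then show ?thesis by (simp add: gauge_zero)
  next
    case False
    then have "t > 0" using t by simp
    have "gauge (\<lambda>\<phi>. (1 / t) * (t * g \<phi>)) \<le> (1 / t) * gauge (\<lambda>\<phi>. t * g \<phi>)"
      using \<open>t > 0\<close> by (intro gauge_smult_le FR_smult g) simp
    then have "t * gauge g \<le> gauge (\<lambda>\<phi>. t * g \<phi>)" using \<open>t > 0\<close> by (simp add: field_simps)
    then show ?thesis using gauge_smult_le[OF g \<open>t > 0\<close>] by simp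
  qed
qed

lemma exists_positive_functional:
  obtains l where "\<And>f g. f \<in> carrier FR \<Longrightarrow> g \<in> carrier FR \<Longrightarrow> l (\<lambda>\<phi>. f \<phi> + g \<phi>) = l f + l g"
    and "\<And>t g. g \<in> carrier FR \<Longrightarrow> l (\<lambda>\<phi>. t * g \<phi>) = t * l g"
    and "\<And>g. g \<in> carrier FR \<Longrightarrow> \<forall>\<phi>\<in>\<Phi>. 0 \<le> g \<phi> \<Longrightarrow> 0 \<le> l g"
    and "\<And>x y. x \<in> P \<Longrightarrow> y \<in> P \<Longrightarrow>
      l (\<lambda>\<phi>. (cmod (tens x \<phi> - tens y \<phi>))\<^sup>2) \<le> C\<^sup>2 * (\<pi> (tens x \<ominus>\<^bsub>W\<^esub> tens y))\<^sup>2"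
    and "\<And>x y. x \<in> P \<Longrightarrow> y \<in> P \<Longrightarrow>
      (nrm Y (T x \<ominus> T y))\<^sup>2 \<le> l (\<lambda>\<phi>. (cmod (tens x \<phi> - tens y \<phi>))\<^sup>2)"
proof -
  \<comment> \<open>The contact point is the zero function, where every linear functional agrees
    with \<open>gauge\<close> by \<open>gauge_zero\<close>.\<close>
  obtain l where add: "\<And>f g. f \<in> carrier FR \<Longrightarrow> g \<in> carrier FR \<Longrightarrow> l (f \<oplus>\<^bsub>FR\<^esub> g) = l f + l g"
    and smult: "\<And>t g. g \<in> carrier FR \<Longrightarrow> l (complex_of_real t \<odot>\<^bsub>FR\<^esub> g) = t * l g"
    and le: "\<And>g. g \<in> carrier FR \<Longrightarrow> l g \<le> gauge g"
    and "l (\<lambda>\<phi>. 0) = gauge (\<lambda>\<phi>. 0)"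
    by (rule hahn_banach[OF FR_module gauge_sublinear FR_zero], rule that)
  have E: "energy [(x, y)] = (\<lambda>\<phi>. (cmod (tens x \<phi> - tens y \<phi>))\<^sup>2)" for x y
    by (rule ext) simp
  have neg: "l (\<lambda>\<phi>. - g \<phi>) = - l g" if "g \<in> carrier FR" for g
    using smult[OF that, of "- 1"] by simp
  have FR_neg: "(\<lambda>\<phi>. - g \<phi>) \<in> carrier FR" if "g \<in> carrier FR" for g
    using FR_smult[OF that, of "- 1"] by simp
  show thesis
  proof (rule that[of l])
    show "l (\<lambda>\<phi>. f \<phi> + g \<phi>) = l f + l g" if "f \<in> carrier FR" "g \<in> carrier FR" for f g
      using add[OF that] by simp
    show "l (\<lambda>\<phi>. t * g \<phi>) = t * l g" if "g \<in> carrier FR" for t g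
      using smult[OF that, of t] by simp
    show "0 \<le> l g" if g: "g \<in> carrier FR" "\<forall>\<phi>\<in>\<Phi>. 0 \<le> g \<phi>" for g
    proof -
      have "gauge (\<lambda>\<phi>. - g \<phi>) \<le> 0"
        using gauge_le[OF FR_neg[OF g(1)], of "[]" "[]"] g(2) by simp
      then show ?thesis using le[OF FR_neg[OF g(1)]] neg[OF g(1)] by simp
    qed
    fix x y assume xy: "x \<in> P" "y \<in> P"
    have m: "energy [(x, y)] \<in> carrier FR" using xy by (intro FR_energy) auto
    have "gauge (energy [(x, y)]) \<le> C\<^sup>2 * proj_cost [(x, y)]"
      using gauge_le[OF m, of "[]" "[(x, y)]"] xy by simp
    then show "l (\<lambda>\<phi>. (cmod (tens x \<phi> - tens y \<phi>))\<^sup>2) \<le> C\<^sup>2 * (\<pi> (tens x \<ominus>\<^bsub>W\<^esub> tens y))\<^sup>2"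
      using le[OF m] unfolding E by simp
    have "gauge (\<lambda>\<phi>. - energy [(x, y)] \<phi>) \<le> - image_cost [(x, y)]"
      using gauge_le[OF FR_neg[OF m], of "[(x, y)]" "[]"] xy by simp
    then show "(nrm Y (T x \<ominus> T y))\<^sup>2 \<le> l (\<lambda>\<phi>. (cmod (tens x \<phi> - tens y \<phi>))\<^sup>2)"
      using le[OF FR_neg[OF m]] neg[OF m] unfolding E by simp
  qed
qed

text \<open>The square of an elementary tensor is the energy of the pair with the zero tuple, and
  \<open>\<bar>a + b\<bar>\<^sup>2 \<le> 2 * (\<bar>a\<bar>\<^sup>2 + \<bar>b\<bar>\<^sup>2)\<close>
  carries domination over to sums.\<close>

lemma W_square_FR:
  assumes "w \<in> carrier W" shows "(\<lambda>\<phi>. (cmod (w \<phi>))\<^sup>2) \<in> carrier FR"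
  using assms
proof (induction rule: W_induct)
  case zero
  show ?case by (simp add: FR_zero)
next
  case (step x u)
  have x: "(\<lambda>\<phi>. (cmod (tens x \<phi>))\<^sup>2) \<in> carrier FR"
    by (rule FR_I[of "[(x, zero_tuple)]"]) (use step in \<open>auto simp: tens_zero\<close>)
  have "(\<lambda>\<phi>. 2 * ((cmod (u \<phi>))\<^sup>2 + (cmod (tens x \<phi>))\<^sup>2)) \<in> carrier FR"
    by (intro FR_smult FR_add step.IH x)
  then obtain L where L: "pairs L"
    "\<And>\<phi>. \<phi> \<in> \<Phi> \<Longrightarrow> \<bar>2 * ((cmod (u \<phi>))\<^sup>2 + (cmod (tens x \<phi>))\<^sup>2)\<bar> \<le> energy L \<phi>" using FR_E by blast
  have sq: "(cmod (a + b))\<^sup>2 \<le> 2 * ((cmod a)\<^sup>2 + (cmod b)\<^sup>2)" for a b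
  proof -
    have "(cmod (a + b))\<^sup>2 \<le> (cmod a + cmod b)\<^sup>2" by (intro power_mono norm_triangle_ineq) simp
    also have "\<dots> \<le> 2 * ((cmod a)\<^sup>2 + (cmod b)\<^sup>2)"
      using zero_le_power2[of "cmod a - cmod b"] by (simp add: power2_eq_square algebra_simps)
    finally show ?thesis .
  qed
  show ?case
  proof (rule FR_I[OF L(1)])
    fix \<phi> assume "\<phi> \<in> \<Phi>"
    from L(2)[OF this] show "\<bar>(cmod (u \<phi> + tens x \<phi>))\<^sup>2\<bar> \<le> energy L \<phi>"
      using sq[of "u \<phi>" "tens x \<phi>"] zero_le_power2[of "cmod (u \<phi> + tens x \<phi>)"] by linarith
  qed
qed

text \<open>Twice a product of moduli is at most the sum of their squares, so both parts of the
  product lie in the domain of the positive functional.\<close>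

lemma W_product_FR:
  assumes "w \<in> carrier W" "w' \<in> carrier W"
  shows "(\<lambda>\<phi>. Re (w \<phi> * cnj (w' \<phi>))) \<in> carrier FR" "(\<lambda>\<phi>. Im (w \<phi> * cnj (w' \<phi>))) \<in> carrier FR"
proof -
  obtain L where L: "pairs L" "\<And>\<phi>. \<phi> \<in> \<Phi> \<Longrightarrow> \<bar>(cmod (w \<phi>))\<^sup>2 + (cmod (w' \<phi>))\<^sup>2\<bar> \<le> energy L \<phi>"
    using FR_add[OF W_square_FR[OF assms(1)] W_square_FR[OF assms(2)]] FR_E by blast
  have le: "cmod (w \<phi> * cnj (w' \<phi>)) \<le> energy L \<phi>" if "\<phi> \<in> \<Phi>" for \<phi>
  proof -
    have "2 * (cmod (w \<phi>) * cmod (w' \<phi>)) \<le> (cmod (w \<phi>))\<^sup>2 + (cmod (w' \<phi>))\<^sup>2"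
      using zero_le_power2[of "cmod (w \<phi>) - cmod (w' \<phi>)"] by (simp add: power2_eq_square algebra_simps)
    moreover have "0 \<le> cmod (w \<phi>) * cmod (w' \<phi>)" by simp
    ultimately show ?thesis using L(2)[OF that] unfolding norm_mult complex_mod_cnj by linarith
  qed
  show "(\<lambda>\<phi>. Re (w \<phi> * cnj (w' \<phi>))) \<in> carrier FR" "(\<lambda>\<phi>. Im (w \<phi> * cnj (w' \<phi>))) \<in> carrier FR"
    using le abs_Re_le_cmod abs_Im_le_cmod by (intro FR_I[OF L(1)]; meson order_trans)+
qed

lemma hilbert_factorization_exists:
  obtains H :: "((nat \<Rightarrow> 'a) \<Rightarrow> complex) nspace" and A M B
  where "hilbert_factorization K n X Y T H A M B" "multilinear_norm n X H A * Lip H Y M B \<le> C"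
proof -
  obtain l where l_add: "\<And>f g. f \<in> carrier FR \<Longrightarrow> g \<in> carrier FR \<Longrightarrow> l (\<lambda>\<phi>. f \<phi> + g \<phi>) = l f + l g"
    and l_smult: "\<And>t g. g \<in> carrier FR \<Longrightarrow> l (\<lambda>\<phi>. t * g \<phi>) = t * l g"
    and l_pos: "\<And>g. g \<in> carrier FR \<Longrightarrow> \<forall>\<phi>\<in>\<Phi>. 0 \<le> g \<phi> \<Longrightarrow> 0 \<le> l g"
    and l_le: "\<And>x y. x \<in> P \<Longrightarrow> y \<in> P \<Longrightarrow>
      l (\<lambda>\<phi>. (cmod (tens x \<phi> - tens y \<phi>))\<^sup>2) \<le> C\<^sup>2 * (\<pi> (tens x \<ominus>\<^bsub>W\<^esub> tens y))\<^sup>2"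
    and l_ge: "\<And>x y. x \<in> P \<Longrightarrow> y \<in> P \<Longrightarrow>
      (nrm Y (T x \<ominus> T y))\<^sup>2 \<le> l (\<lambda>\<phi>. (cmod (tens x \<phi> - tens y \<phi>))\<^sup>2)"
    by (rule exists_positive_functional, rule that)
  \<comment> \<open>The functional acts on real functions, so the sesquilinear form is assembled
    from the real and imaginary parts of the product.\<close>
  define s where "s w w' = Complex (l (\<lambda>\<phi>. Re (w \<phi> * cnj (w' \<phi>)))) (l (\<lambda>\<phi>. Im (w \<phi> * cnj (w' \<phi>))))" for w w'
  \<comment> \<open>Positivity of \<open>l\<close> at \<open>g\<close> and at \<open>- g\<close>:
    only the values on \<open>\<Phi>\<close> count. Over the reals this makes \<open>s\<close> real
    valued, since tensors are known to take real values on forms only.\<close>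
  have l_zero: "l g = 0" if "g \<in> carrier FR" "\<And>\<phi>. \<phi> \<in> \<Phi> \<Longrightarrow> g \<phi> = 0" for g
    using l_pos[OF that(1)] l_pos[OF FR_smult[OF that(1)], of "- 1"] l_smult[OF that(1), of "- 1"] that(2) by simp
  interpret S: semi_inner K W s
  proof (intro semi_inner.intro W_module semi_inner_axioms.intro)
    fix w w' assume w: "w \<in> carrier W" and w': "w' \<in> carrier W"
    note FR = W_product_FR[OF w w']
    show "s w w' \<in> K"
    proof (cases "K = UNIV")
      case False
      then have K: "K = \<real>" using K_cases by simp
      have "Im (w \<phi> * cnj (w' \<phi>)) = 0" if "\<phi> \<in> \<Phi>" for \<phi>
      proof -
        have "form \<phi>" using that by (simp add: bounded_multilinear_def)
        then have "w \<phi> \<in> \<real>" "w' \<phi> \<in> \<real>" using W_value w w' K by auto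
        then show ?thesis by (simp add: complex_is_Real_iff)
      qed
      then have "Im (s w w') = 0" unfolding s_def using l_zero[OF FR(2)] by simp
      then show ?thesis by (simp add: K complex_is_Real_iff)
    qed simp
    show "cnj (s w' w) = s w w'"
    proof -
      have "(\<lambda>\<phi>. Im (w' \<phi> * cnj (w \<phi>))) = (\<lambda>\<phi>. (- 1) * Im (w \<phi> * cnj (w' \<phi>)))"
        by (auto simp: algebra_simps)
      then have "l (\<lambda>\<phi>. Im (w' \<phi> * cnj (w \<phi>))) = - l (\<lambda>\<phi>. Im (w \<phi> * cnj (w' \<phi>)))"
        using l_smult[OF FR(2), of "- 1"] by (simp only: mult_minus1)
      moreover have "(\<lambda>\<phi>. Re (w' \<phi> * cnj (w \<phi>))) = (\<lambda>\<phi>. Re (w \<phi> * cnj (w' \<phi>)))"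
        by (auto simp: algebra_simps)
      ultimately show ?thesis unfolding s_def complex_eq_iff by (simp only: complex.sel cnj.sel) simp
    qed
    show "s (c \<odot>\<^bsub>W\<^esub> w) w' = c * s w w'" if "c \<in> K" for c
    proof -
      have eq: "(\<lambda>\<phi>. Re (c * w \<phi> * cnj (w' \<phi>)))
          = (\<lambda>\<phi>. Re c * Re (w \<phi> * cnj (w' \<phi>)) + (- Im c) * Im (w \<phi> * cnj (w' \<phi>)))"
        "(\<lambda>\<phi>. Im (c * w \<phi> * cnj (w' \<phi>)))
          = (\<lambda>\<phi>. Re c * Im (w \<phi> * cnj (w' \<phi>)) + Im c * Re (w \<phi> * cnj (w' \<phi>)))"
        by (auto simp: algebra_simps)
      have "l (\<lambda>\<phi>. Re (c * w \<phi> * cnj (w' \<phi>)))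
          = Re c * l (\<lambda>\<phi>. Re (w \<phi> * cnj (w' \<phi>))) + (- Im c) * l (\<lambda>\<phi>. Im (w \<phi> * cnj (w' \<phi>)))"
        "l (\<lambda>\<phi>. Im (c * w \<phi> * cnj (w' \<phi>)))
          = Re c * l (\<lambda>\<phi>. Im (w \<phi> * cnj (w' \<phi>))) + Im c * l (\<lambda>\<phi>. Re (w \<phi> * cnj (w' \<phi>)))"
        unfolding eq l_smult[OF FR(1), symmetric] l_smult[OF FR(2), symmetric]
        by (intro l_add FR_smult FR)+
      then show ?thesis unfolding s_def W_simps by (simp only:) (simp add: complex_eq_iff)
    qed
    fix z assume z: "z \<in> carrier W"
    have "(\<lambda>\<phi>. Re ((w \<phi> + w' \<phi>) * cnj (z \<phi>))) = (\<lambda>\<phi>. Re (w \<phi> * cnj (z \<phi>)) + Re (w' \<phi> * cnj (z \<phi>)))"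
      "(\<lambda>\<phi>. Im ((w \<phi> + w' \<phi>) * cnj (z \<phi>))) = (\<lambda>\<phi>. Im (w \<phi> * cnj (z \<phi>)) + Im (w' \<phi> * cnj (z \<phi>)))"
      by (auto simp: algebra_simps)
    then show "s (w \<oplus>\<^bsub>W\<^esub> w') z = s w z + s w' z"
      unfolding s_def complex_eq_iff W_simps
      by (simp only: l_add W_product_FR w w' z complex.sel plus_complex.sel)
  next
    fix w assume w: "w \<in> carrier W"
    have "0 \<le> l (\<lambda>\<phi>. Re (w \<phi> * cnj (w \<phi>)))"
      by (rule l_pos[OF W_product_FR(1)[OF w w]]) (simp add: complex_mult_cnj)
    then show "0 \<le> Re (s w w)" by (simp add: s_def)
  qed
  have N2: "(S.N w)\<^sup>2 = l (\<lambda>\<phi>. (cmod (w \<phi>))\<^sup>2)" if "w \<in> carrier W" for w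
  proof -
    have "(\<lambda>\<phi>. Re (w \<phi> * cnj (w \<phi>))) = (\<lambda>\<phi>. (cmod (w \<phi>))\<^sup>2)"
      by (simp add: cmod_power2 flip: power2_eq_square)
    then show ?thesis using S.s_nonneg[OF that] by (simp add: S.N_def s_def)
  qed
  define A where "A x = S.L (\<lambda>_. tens x)" for x
  \<comment> \<open>An arbitrary preimage is chosen; \<open>T_diff\<close> shows that tuples with
    the same image under \<open>A\<close> have the same image under \<open>T\<close>.\<close>
  define B where "B h = T (SOME x. x \<in> P \<and> A x = h)" for h
  let ?H = "S.completion"
  have H_normed: "normed_space K ?H" by (rule S.completion_normed)
  have A_lin: "multilinear K n X ?H A"
    unfolding A_def by (rule multilinear_comp[OF multilinear_tens S.completion_embedding])
  have A_diff: "nrm ?H (A x \<ominus>\<^bsub>?H\<^esub> A y) = S.N (tens x \<ominus>\<^bsub>W\<^esub> tens y)" if "x \<in> P" "y \<in> P" for x y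
    using that by (simp add: A_def S.completion_minus_L S.cauchy_const S.nrm_const del: W_minus)
  have T_diff: "nrm Y (T x \<ominus> T y) \<le> nrm ?H (A x \<ominus>\<^bsub>?H\<^esub> A y)" if "x \<in> P" "y \<in> P" for x y
  proof (rule power2_le_imp_le)
    show "(nrm Y (T x \<ominus> T y))\<^sup>2 \<le> (nrm ?H (A x \<ominus>\<^bsub>?H\<^esub> A y))\<^sup>2"
      unfolding A_diff[OF that] using l_ge[OF that] that by (simp add: N2)
    show "0 \<le> nrm ?H (A x \<ominus>\<^bsub>?H\<^esub> A y)" unfolding A_diff[OF that] using that by simp
  qed
  have A_bound: "nrm ?H (A x) \<le> C * pnorm x" if x: "x \<in> P" for x
  proof -
    \<comment> \<open>The upper bound for pairs, with the zero tuple as second member.\<close>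
    have "(S.N (tens x))\<^sup>2 \<le> C\<^sup>2 * (\<pi> (tens x))\<^sup>2"
      using l_le[OF x zero_tuple_in] x by (simp add: N2 tens_zero)
    also have "\<dots> \<le> (C * pnorm x)\<^sup>2"
      using proj_norm_tens[OF x] proj_norm_nonneg[OF tens_W[OF x]]
      by (simp add: power_mult_distrib mult_left_mono power_mono)
    finally have "S.N (tens x) \<le> C * pnorm x"
      by (rule power2_le_imp_le) (intro mult_nonneg_nonneg C_nonneg pnorm_nonneg x)
    then show ?thesis using x by (simp add: A_def S.nrm_const)
  qed
  have A: "bounded_multilinear K n X ?H A"
    using A_lin A_bound by (auto simp: bounded_multilinear_def pnorm_def)
  have BA: "\<exists>x'\<in>P. A x' = A x \<and> B (A x) = T x'" if "x \<in> P" for x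
    using someI[of "\<lambda>x'. x' \<in> P \<and> A x' = A x" x] that unfolding B_def by blast
  have TBA: "T x = B (A x)" if x: "x \<in> P" for x
  proof -
    obtain x' where x': "x' \<in> P" "A x' = A x" "B (A x) = T x'" using BA[OF x] by blast
    interpret H: gauged_module K ?H by (rule normed_space_gauged[OF H_normed])
    have "nrm Y (T x \<ominus> T x') \<le> 0"
      using T_diff[OF x x'(1)] x'(2) multilinear_in[OF A_lin x] by (simp add: H.nrm_zero)
    then have "T x \<ominus> T x' = \<zero>"
      using normed_spaceD(2)[OF Y_normed, of "T x \<ominus> T x'"] Y.nrm_nonneg[of "T x \<ominus> T x'"]
        TY[OF x] TY[OF x'(1)] by simp
    then show ?thesis using TY[OF x] TY[OF x'(1)] x'(3) by (simp add: Y.minus_eq_zero)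
  qed
  \<comment> \<open>The whole constant \<open>C\<close> sits in the norm of
    \<open>A\<close>.\<close>
  have lip: "lipschitz_const ?H Y (A ` P) B 1"
    using T_diff TBA by (auto simp: lipschitz_const_def)
  have fac: "hilbert_factorization K n X Y T ?H A (A ` P) B"
    unfolding hilbert_factorization_def
    using S.completion_hilbert A lip TBA TY multilinear_in[OF A_lin] by (auto simp: Pi_iff)
  \<comment> \<open>Points of the completion are functions on tensors; this passes to a Hilbert
    space of functions on tuples without increasing the product of the constants.\<close>
  obtain H' :: "((nat \<Rightarrow> 'a) \<Rightarrow> complex) nspace" and A' M' B'
    where fac': "hilbert_factorization K n X Y T H' A' M' B'"
      and eqs: "multilinear_norm n X H' A' = multilinear_norm n X ?H A"
        "Lip H' Y M' B' \<le> Lip ?H Y (A ` P) B"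
    using hilbert_factorization_universe[OF fac] by blast
  have N: "multilinear_norm n X ?H A \<le> C"
    by (rule multilinear_norm_le[OF A_bound C_nonneg])
  have "Lip ?H Y (A ` P) B \<le> 1"
    unfolding Lip_def using lip by (intro cInf_lower) (auto intro!: bdd_belowI[of _ 0] simp: lipschitz_const_def)
  then have "multilinear_norm n X H' A' * Lip H' Y M' B' \<le> C * 1"
    unfolding eqs(1) using eqs(2) N multilinear_norm_nonneg[OF H_normed A] C_nonneg
    by (intro order_trans[OF mult_left_mono mult_right_mono]) auto
  then show thesis using that[OF fac'] by simp
qed

end

section \<open>The isometric isomorphism\<close>

context scalar_field begin

text \<open>Every module law and norm law of \<open>V\<close> is checked after applying the
  injection \<open>f\<close>, so that \<open>V\<close> need only be closed under its operations
  beforehand.\<close>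

lemma isometric_isomorphismI:
  assumes W: "normed_space K W" and bij: "bij_betw f (carrier V) (carrier W)"
    and zero: "\<zero>\<^bsub>V\<^esub> \<in> carrier V" "f \<zero>\<^bsub>V\<^esub> = \<zero>\<^bsub>W\<^esub>"
    and add: "\<And>x y. x \<in> carrier V \<Longrightarrow> y \<in> carrier V \<Longrightarrow> x \<oplus>\<^bsub>V\<^esub> y \<in> carrier V"
      "\<And>x y. x \<in> carrier V \<Longrightarrow> y \<in> carrier V \<Longrightarrow> f (x \<oplus>\<^bsub>V\<^esub> y) = f x \<oplus>\<^bsub>W\<^esub> f y"
    and smult: "\<And>c x. c \<in> K \<Longrightarrow> x \<in> carrier V \<Longrightarrow> c \<odot>\<^bsub>V\<^esub> x \<in> carrier V"
      "\<And>c x. c \<in> K \<Longrightarrow> x \<in> carrier V \<Longrightarrow> f (c \<odot>\<^bsub>V\<^esub> x) = c \<odot>\<^bsub>W\<^esub> f x"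
    and nrm: "\<And>x. x \<in> carrier V \<Longrightarrow> nrm W (f x) = nrm V x"
  shows "isometric_isomorphism K V W f"
proof -
  interpret W: kmodule K W by (rule normed_space_kmodule[OF W])
  have f: "f x \<in> carrier W" if "x \<in> carrier V" for x
    using bij that by (auto simp: bij_betw_def)
  have inj: "x = y \<longleftrightarrow> f x = f y" if "x \<in> carrier V" "y \<in> carrier V" for x y
    using bij that by (auto simp: bij_betw_def inj_on_def)
  have "Module.module (scalars K) V"
    by (rule module_scalarsI)
      (simp_all add: inj zero add smult f W.M.a_ac W.smult_distr_scalar W.smult_distr_vec W.smult_smult)
  then have "normed_space K V"
    unfolding normed_space_def
    using normed_spaceD[OF W] by (auto simp: nrm[symmetric] inj zero add smult f)
  then show ?thesis
    unfolding isometric_isomorphism_def linear_map_def using W bij f add smult nrm by auto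
qed

end

context gamma_duality begin

abbreviation "Gam \<equiv> Gamma_space K n X Y"
abbreviation "GD \<equiv> gamma_dual K n X Y"

lemma Gam_carrier:
  "T \<in> carrier Gam \<longleftrightarrow> T \<in> extensional P \<and> multilinear K n X Y T \<and> factors_through_hilbert K n X Y T"
  by (simp add: Gamma_space_def)

lemma Gam_simps:
  "\<zero>\<^bsub>Gam\<^esub> = (\<lambda>x\<in>P. \<zero>)" "S \<oplus>\<^bsub>Gam\<^esub> T = (\<lambda>x\<in>P. S x \<oplus> T x)"
  "c \<odot>\<^bsub>Gam\<^esub> T = (\<lambda>x\<in>P. c \<odot> T x)" "nrm Gam = Gamma_norm K n X Y"
  by (simp_all add: Gamma_space_def)

text \<open>The associated operator and the canonical embedding are both restricted to the dual of
  \<open>Y\<close>, so their equality amounts to equality at the functionals in that dual.\<close>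

lemma GD_carrier:
  "\<zeta> \<in> carrier GD \<longleftrightarrow> \<zeta> \<in> carrier (dual_space K G) \<and>
     (\<forall>x\<in>P. \<exists>y\<in>carrier Y. \<forall>f\<in>carrier D. \<zeta> (tv x f) = f y)"
proof -
  have "associated_op K n X Y \<zeta> x = canonical_embedding K Y y \<longleftrightarrow> (\<forall>f\<in>carrier D. \<zeta> (tv x f) = f y)" for x y
    unfolding associated_op_def canonical_embedding_def by (auto simp: fun_eq_iff restrict_def)
  then show ?thesis by (simp add: gamma_dual_def Let_def image_iff)
qed

lemma GD_eq: "GD = (dual_space K G)\<lparr>carrier := carrier GD\<rparr>"
  by (simp add: gamma_dual_def Let_def)

lemma GD_simps:
  "\<zero>\<^bsub>GD\<^esub> = (\<lambda>u\<in>carrier G. 0)" "\<zeta> \<oplus>\<^bsub>GD\<^esub> \<xi> = (\<lambda>u\<in>carrier G. \<zeta> u + \<xi> u)"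
  "c \<odot>\<^bsub>GD\<^esub> \<zeta> = (\<lambda>u\<in>carrier G. c * \<zeta> u)" "nrm GD = nrm (dual_space K G)"
  by (simp_all add: gamma_dual_def Let_def dual_space_def)

lemma GD_normed: "normed_space K GD"
proof (subst GD_eq, rule normed_subspace[OF G.normed_dual])
  interpret GD: kmodule K "dual_space K G" by (rule normed_space_kmodule[OF G.normed_dual])
  show "carrier GD \<subseteq> carrier (dual_space K G)" by (auto simp: GD_carrier)
  have "(\<lambda>u\<in>carrier G. 0) (tv x f) = f \<zero>" if "x \<in> P" "f \<in> carrier D" for x f
    using that Y.dualD(8) by simp
  then show "\<zero>\<^bsub>dual_space K G\<^esub> \<in> carrier GD"
    using GD.M.zero_closed by (auto simp: GD_carrier)
  fix \<zeta> assume z: "\<zeta> \<in> carrier GD"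
  show "\<zeta> \<oplus>\<^bsub>dual_space K G\<^esub> \<xi> \<in> carrier GD" if x: "\<xi> \<in> carrier GD" for \<xi>
    unfolding GD_carrier
  proof (intro conjI ballI)
    show "\<zeta> \<oplus>\<^bsub>dual_space K G\<^esub> \<xi> \<in> carrier (dual_space K G)"
      using z x by (intro GD.M.a_closed) (auto simp: GD_carrier)
    fix p assume p: "p \<in> P"
    obtain y y' where "y \<in> carrier Y" "\<forall>f\<in>carrier D. \<zeta> (tv p f) = f y"
      "y' \<in> carrier Y" "\<forall>f\<in>carrier D. \<xi> (tv p f) = f y'"
      using z x p unfolding GD_carrier by blast
    then show "\<exists>y\<in>carrier Y. \<forall>f\<in>carrier D. (\<zeta> \<oplus>\<^bsub>dual_space K G\<^esub> \<xi>) (tv p f) = f y"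
      using p by (intro bexI[of _ "y \<oplus> y'"]) (auto simp: Y.dualD(4))
  qed
  show "c \<odot>\<^bsub>dual_space K G\<^esub> \<zeta> \<in> carrier GD" if c: "c \<in> K" for c
    unfolding GD_carrier
  proof (intro conjI ballI)
    show "c \<odot>\<^bsub>dual_space K G\<^esub> \<zeta> \<in> carrier (dual_space K G)"
      using z c by (intro GD.smult_in) (auto simp: GD_carrier)
    fix p assume p: "p \<in> P"
    obtain y where "y \<in> carrier Y" "\<forall>f\<in>carrier D. \<zeta> (tv p f) = f y"
      using z p unfolding GD_carrier by blast
    then show "\<exists>y\<in>carrier Y. \<forall>f\<in>carrier D. (c \<odot>\<^bsub>dual_space K G\<^esub> \<zeta>) (tv p f) = f y"
      using p c by (intro bexI[of _ "c \<odot> y"]) (auto simp: Y.dualD(5))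
  qed
qed

lemma factorization_nonneg:
  assumes "hilbert_factorization K n X Y T H A M B"
  shows "0 \<le> multilinear_norm n X H A * Lip H Y M B"
proof -
  have H: "normed_space K H" and A: "bounded_multilinear K n X H A" and M: "M \<subseteq> carrier H"
    and L: "\<exists>L. lipschitz_const H Y M B L"
    using assms by (auto simp: hilbert_factorization_def hilbert_space_def banach_space_def)
  have "0 \<le> Lip H Y M B" using lipschitz_const_Lip[OF H M L] by (simp add: lipschitz_const_def)
  then show ?thesis using multilinear_norm_nonneg[OF H A] by simp
qed

text \<open>\<open>zeta_bound\<close> puts the dual norm below the product of constants of every
  factorization, and \<open>hilbert_factorization_exists\<close> supplies one whose product does not
  exceed it.\<close>

lemma zeta_GD:
  assumes "T \<in> carrier Gam"
  shows "zeta T \<in> carrier GD" "nrm GD (zeta T) = nrm Gam T"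
proof -
  have T: "multilinear K n X Y T" using assms by (simp add: Gam_carrier)
  obtain H0 :: "((nat \<Rightarrow> 'a) \<Rightarrow> complex) nspace" and A0 M0 B0
    where fac0: "hilbert_factorization K n X Y T H0 A0 M0 B0"
    using assms unfolding Gam_carrier factors_through_hilbert_def by blast
  have z: "zeta T \<in> carrier (dual_space K G)" by (rule zeta_dual[OF T fac0])
  then show "zeta T \<in> carrier GD"
    unfolding GD_carrier using zeta_tv[OF T] multilinear_in[OF T] by blast
  let ?S = "{multilinear_norm n X H A * Lip H Y M B |(H :: ((nat \<Rightarrow> 'a) \<Rightarrow> complex) nspace) A M B.
            hilbert_factorization K n X Y T H A M B}"
  have "nrm (dual_space K G) (zeta T) \<le> Inf ?S"
  proof (rule cInf_greatest)
    show "?S \<noteq> {}" using fac0 by blast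
    fix r assume "r \<in> ?S"
    then obtain H :: "((nat \<Rightarrow> 'a) \<Rightarrow> complex) nspace" and A M B
      where r: "r = multilinear_norm n X H A * Lip H Y M B"
        and fac: "hilbert_factorization K n X Y T H A M B" by blast
    show "nrm (dual_space K G) (zeta T) \<le> r"
      unfolding r using zeta_bound[OF T fac] factorization_nonneg[OF fac] by (intro G.dual_norm_le) auto
  qed
  moreover have "Inf ?S \<le> nrm (dual_space K G) (zeta T)"
  proof -
    interpret gamma_functional K n X Y "zeta T" T
      by unfold_locales (use z T zeta_tv[OF T] in auto)
    obtain H :: "((nat \<Rightarrow> 'a) \<Rightarrow> complex) nspace" and A M B
      where fac: "hilbert_factorization K n X Y T H A M B"
        and le: "multilinear_norm n X H A * Lip H Y M B \<le> C" by (rule hilbert_factorization_exists)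
    have "Inf ?S \<le> multilinear_norm n X H A * Lip H Y M B"
      using fac factorization_nonneg by (intro cInf_lower bdd_belowI[of _ 0]) blast+
    then show ?thesis using le by (simp add: C_def)
  qed
  ultimately show "nrm GD (zeta T) = nrm Gam T"
    unfolding GD_simps Gam_simps Gamma_norm_def by (rule antisym)
qed

lemma tv_add:
  assumes "x \<in> P" "i < n" "y \<in> carrier (X i)" "z \<in> carrier (X i)" "f \<in> carrier D"
  shows "tv (x(i := y \<oplus>\<^bsub>X i\<^esub> z)) f = (\<lambda>\<beta>. tv (x(i := y)) f \<beta> + tv (x(i := z)) f \<beta>)"
proof -
  have "tens (x(i := y \<oplus>\<^bsub>X i\<^esub> z)) = (\<lambda>\<phi>. tens (x(i := y)) \<phi> + tens (x(i := z)) \<phi>)"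
    using multilinear_tens assms by (simp add: multilinear_def linear_map_def)
  then show ?thesis
    using assms P_upd by (auto simp: tensor_vec_def tensor2_def bilinear_formD)
qed

lemma tv_smult:
  assumes "x \<in> P" "i < n" "y \<in> carrier (X i)" "c \<in> K" "f \<in> carrier D"
  shows "tv (x(i := c \<odot>\<^bsub>X i\<^esub> y)) f = (\<lambda>\<beta>. c * tv (x(i := y)) f \<beta>)"
proof -
  have "tens (x(i := c \<odot>\<^bsub>X i\<^esub> y)) = (\<lambda>\<phi>. c * tens (x(i := y)) \<phi>)"
    using multilinear_tens assms by (simp add: multilinear_def linear_map_def)
  then show ?thesis
    using assms P_upd by (auto simp: tensor_vec_def tensor2_def bilinear_formD)
qed

text \<open>Membership in \<open>GD\<close> provides values in \<open>Y\<close> tuple by tuple.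
  Multilinearity of the resulting map is tested with functionals, which separate points of
  \<open>Y\<close>, and there it reduces to multilinearity of the elementary tensors.\<close>

lemma zeta_surj:
  assumes \<zeta>: "\<zeta> \<in> carrier GD"
  obtains T where "T \<in> carrier Gam" "zeta T = \<zeta>"
proof -
  have \<zeta>G: "\<zeta> \<in> carrier (dual_space K G)" using \<zeta> by (simp add: GD_carrier)
  obtain T0 where T0: "\<And>x. x \<in> P \<Longrightarrow> T0 x \<in> carrier Y"
    "\<And>x f. x \<in> P \<Longrightarrow> f \<in> carrier D \<Longrightarrow> \<zeta> (tv x f) = f (T0 x)"
    using \<zeta> unfolding GD_carrier by metis
  define T where "T = restrict T0 P"
  have TY: "T x \<in> carrier Y" and T\<zeta>: "f \<in> carrier D \<Longrightarrow> f (T x) = \<zeta> (tv x f)" if "x \<in> P" for x f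
    using that T0 by (simp_all add: T_def)
  have T: "multilinear K n X Y T"
    unfolding multilinear_def
  proof (intro conjI ballI allI impI)
    show "T \<in> P \<rightarrow> carrier Y" using TY by auto
    fix x i assume x: "x \<in> P" and i: "i < n"
    interpret Xi: kmodule K "X i" by (rule X_module[OF i])
    note upd = P_upd[OF x i]
    show "linear_map K (X i) Y (\<lambda>y. T (x(i := y)))"
      unfolding linear_map_def
    proof (intro conjI ballI funcsetI)
      fix y assume y: "y \<in> carrier (X i)"
      show "T (x(i := y)) \<in> carrier Y" by (rule TY[OF upd[OF y]])
      show "T (x(i := y \<oplus>\<^bsub>X i\<^esub> z)) = T (x(i := y)) \<oplus> T (x(i := z))" if z: "z \<in> carrier (X i)" for z
      proof (rule dual_separates[OF Y_normed])
        fix f assume f: "f \<in> carrier D"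
        have "f (T (x(i := y \<oplus>\<^bsub>X i\<^esub> z))) = \<zeta> (\<lambda>\<beta>. tv (x(i := y)) f \<beta> + tv (x(i := z)) f \<beta>)"
          using T\<zeta>[OF upd f, of "y \<oplus>\<^bsub>X i\<^esub> z"] tv_add[OF x i y z f] y z by simp
        also have "\<dots> = \<zeta> (tv (x(i := y)) f) + \<zeta> (tv (x(i := z)) f)"
          using G.dualD(4)[OF \<zeta>G tv_G[OF upd[OF y] f] tv_G[OF upd[OF z] f]] by simp
        also have "\<dots> = f (T (x(i := y)) \<oplus> T (x(i := z)))"
          using y z f upd by (simp add: Y.dualD(4)[OF f] TY T\<zeta>)
        finally show "f (T (x(i := y \<oplus>\<^bsub>X i\<^esub> z))) = f (T (x(i := y)) \<oplus> T (x(i := z)))" .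
      qed (use y z upd TY in auto)
      show "T (x(i := c \<odot>\<^bsub>X i\<^esub> y)) = c \<odot> T (x(i := y))" if c: "c \<in> K" for c
      proof (rule dual_separates[OF Y_normed])
        fix f assume f: "f \<in> carrier D"
        have "f (T (x(i := c \<odot>\<^bsub>X i\<^esub> y))) = \<zeta> (\<lambda>\<beta>. c * tv (x(i := y)) f \<beta>)"
          using T\<zeta>[OF upd f, of "c \<odot>\<^bsub>X i\<^esub> y"] tv_smult[OF x i y c f] y c by simp
        also have "\<dots> = c * \<zeta> (tv (x(i := y)) f)"
          using G.dualD(5)[OF \<zeta>G c tv_G[OF upd[OF y] f]] by simp
        also have "\<dots> = f (c \<odot> T (x(i := y)))"
          using y c f upd by (simp add: Y.dualD(5)[OF f] TY T\<zeta>)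
        finally show "f (T (x(i := c \<odot>\<^bsub>X i\<^esub> y))) = f (c \<odot> T (x(i := y)))" .
      qed (use y c upd TY in auto)
    qed
  qed
  interpret gamma_functional K n X Y \<zeta> T
    by unfold_locales (use \<zeta>G T T\<zeta> in auto)
  obtain H :: "((nat \<Rightarrow> 'a) \<Rightarrow> complex) nspace" and A M B
    where fac: "hilbert_factorization K n X Y T H A M B" by (rule hilbert_factorization_exists)
  have "T \<in> carrier Gam"
    using T fac unfolding Gam_carrier factors_through_hilbert_def by (auto simp: T_def)
  moreover have "zeta T = \<zeta>"
    by (rule G_dual_eqI[OF zeta_dual[OF T fac] \<zeta>G]) (simp add: zeta_tv[OF T] T\<zeta>)
  ultimately show thesis by (rule that)
qed

text \<open>This gives closure of the factorable operators under the vector space operations: a sum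
  or multiple of functionals has a preimage, and the preimage must be the pointwise sum or multiple
  because the dual separates points.\<close>

lemma Gam_memI:
  assumes \<zeta>: "\<zeta> \<in> carrier GD" and R: "R \<in> extensional P" "\<And>x. x \<in> P \<Longrightarrow> R x \<in> carrier Y"
    and eq: "\<And>x f. x \<in> P \<Longrightarrow> f \<in> carrier D \<Longrightarrow> \<zeta> (tv x f) = f (R x)"
  shows "R \<in> carrier Gam" "zeta R = \<zeta>"
proof -
  obtain U where U: "U \<in> carrier Gam" "zeta U = \<zeta>" using zeta_surj[OF \<zeta>] by blast
  then have ml: "multilinear K n X Y U" by (simp add: Gam_carrier)
  have "R = U"
  proof (rule extensionalityI)
    show "R \<in> extensional P" "U \<in> extensional P" using R U by (auto simp: Gam_carrier)
    fix x assume x: "x \<in> P"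
    show "R x = U x"
      using eq[OF x] zeta_tv[OF ml x] U(2) R(2)[OF x] multilinear_in[OF ml x]
      by (intro dual_separates[OF Y_normed]) auto
  qed
  then show "R \<in> carrier Gam" "zeta R = \<zeta>" using U by auto
qed

lemma zeta_isometric_isomorphism: "isometric_isomorphism K Gam GD zeta"
proof (rule isometric_isomorphismI[OF GD_normed])
  interpret GD: kmodule K GD by (rule normed_space_kmodule[OF GD_normed])
  have ml: "multilinear K n X Y T" if "T \<in> carrier Gam" for T using that by (simp add: Gam_carrier)
  have tv_val: "zeta T (tv x f) = f (T x)"
    if "T \<in> carrier Gam" "x \<in> P" "f \<in> carrier D" for T x f
    using that zeta_tv[OF ml] by auto
  have TY: "T x \<in> carrier Y" if "T \<in> carrier Gam" "x \<in> P" for T x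
    using that multilinear_in[OF ml] by auto
  show "bij_betw zeta (carrier Gam) (carrier GD)"
  proof (rule bij_betw_imageI)
    show "inj_on zeta (carrier Gam)"
    proof (rule inj_onI)
      fix S T assume S: "S \<in> carrier Gam" and T: "T \<in> carrier Gam" and eq: "zeta S = zeta T"
      show "S = T"
      proof (rule extensionalityI)
        show "S \<in> extensional P" "T \<in> extensional P" using S T by (auto simp: Gam_carrier)
        fix x assume x: "x \<in> P"
        show "S x = T x"
        proof (rule dual_separates[OF Y_normed TY[OF S x] TY[OF T x]])
          show "f (S x) = f (T x)" if "f \<in> carrier D" for f
            using tv_val[OF S x that] tv_val[OF T x that] eq by simp
        qed
      qed
    qed
    show "zeta ` carrier Gam = carrier GD"
      using zeta_GD(1) zeta_surj by (auto, metis imageI)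
  qed
  show "\<zero>\<^bsub>Gam\<^esub> \<in> carrier Gam" "zeta \<zero>\<^bsub>Gam\<^esub> = \<zero>\<^bsub>GD\<^esub>"
    by (rule Gam_memI[OF GD.M.zero_closed]; simp add: Gam_simps GD_simps Y.dualD(8))+
  fix S assume S: "S \<in> carrier Gam"
  show "nrm GD (zeta S) = nrm Gam S" by (rule zeta_GD(2)[OF S])
  show "c \<odot>\<^bsub>Gam\<^esub> S \<in> carrier Gam" "zeta (c \<odot>\<^bsub>Gam\<^esub> S) = c \<odot>\<^bsub>GD\<^esub> zeta S" if c: "c \<in> K" for c
    by (rule Gam_memI[OF GD.smult_in[OF c zeta_GD(1)[OF S]]];
        simp add: Gam_simps GD_simps tv_val[OF S] TY[OF S] c Y.dualD(5))+
  fix T assume T: "T \<in> carrier Gam"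
  show "S \<oplus>\<^bsub>Gam\<^esub> T \<in> carrier Gam" "zeta (S \<oplus>\<^bsub>Gam\<^esub> T) = zeta S \<oplus>\<^bsub>GD\<^esub> zeta T"
    by (rule Gam_memI[OF GD.M.a_closed[OF zeta_GD(1)[OF S] zeta_GD(1)[OF T]]];
        simp add: Gam_simps GD_simps tv_val[OF S] TY[OF S] tv_val[OF T] TY[OF T] Y.dualD(4))+
qed

end

theorem corollary4p5:
  fixes K :: "complex set" and n :: nat
    and X :: "nat \<Rightarrow> 'a nspace" and Y :: "'y nspace"
  assumes "K = \<real> \<or> K = UNIV"
    and "n \<ge> 1"
    and "\<And>i. i < n \<Longrightarrow> banach_space K (X i)"
    and "banach_space K Y"
  shows "\<exists>Z. isometric_isomorphism K (Gamma_space K n X Y) (gamma_dual K n X Y) Z \<and>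
    (\<forall>T \<in> carrier (Gamma_space K n X Y).
       \<forall>\<zeta> \<in> carrier (dual_space K (gamma_tensor K n X (dual_space K Y))).
         \<zeta> = Z T \<longleftrightarrow>
         (\<forall>x \<in> prod_carrier n X. \<forall>f \<in> carrier (dual_space K Y).
            \<zeta> (tensor_vec K n X (dual_space K Y) x f) = f (T x)))"
proof -
  interpret gamma_duality K n X Y
    by unfold_locales (use assms in \<open>auto simp: banach_space_def\<close>)
  have "\<zeta> = zeta T \<longleftrightarrow> (\<forall>x\<in>P. \<forall>f\<in>carrier D. \<zeta> (tv x f) = f (T x))"
    if T: "T \<in> carrier Gam" and \<zeta>: "\<zeta> \<in> carrier (dual_space K G)" for T \<zeta>
  proof -
    have ml: "multilinear K n X Y T" and "zeta T \<in> carrier (dual_space K G)"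
      using T zeta_GD(1)[OF T] by (auto simp: Gam_carrier GD_carrier)
    \<comment> \<open>Elementary tensors span the tensor product, so the values on them determine
      the functional.\<close>
    then show ?thesis using G_dual_eqI[OF \<zeta>, of "zeta T"] zeta_tv[OF ml] by auto
  qed
  then show ?thesis using zeta_isometric_isomorphism by blast
qed

end
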